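(* Consider the single-mode bosonic multiple-access channel with three transmitters (the third being a helper) with input modes $\hat a_1,\hat a_2,\hat a_3$ and output modes, for the legitimate receiver and the warden respectively, $$\hat b=\sqrt{\tfrac16}\,\hat a_1+\sqrt{\tfrac16}\,\hat a_2+\sqrt{\tfrac23}\,\hat a_3,\qquad \hat e=\sqrt{\tfrac13}\,\hat a_1+\sqrt{\tfrac13}\,\hat a_2-\sqrt{\tfrac13}\,\hat a_3,$$ where the transmitters use coherent states $|X_t\rangle$, $X_t\in\mathbb C$, with codewords satisfying $\frac1n\sum_{i=1}^n|x_{t,i}|^2\le N_t$ for $t=1,2,3$, and the innocent state of each transmitter is the vacuum $|0\rangle$. Transmitter 1 knows message $M_1$, transmitter 2 knows message $M_2$, and transmitter 3 knows both. Then the covert capacity region $\mathcal C_{\text{CC-BMAC}}$ contains every non-negative rate pair $(R_1,R_2)$ with $$R_1<g\big(\tfrac32\tilde N_1\big),\qquad R_2<g\big(\tfrac32\tilde N_2\big),\qquad R_1+R_2<g\big(\tfrac32\tilde N_3\big),$$ where $\tilde N_1=\min\{N_1,N_3\}$, $\tilde N_2=\min\{N_2,N_3\}$, $\tilde N_3=\min\{N_1+N_2,N_3\}$, and $g(N)=(N+1)\log(N+1)-N\log N$ for $N>0$, $g(0)=0$.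
   Context: Logarithms are base 2. A coherent state is $|\alpha\rangle=D(\alpha)|0\rangle$ with $D(\alpha)=\exp(\alpha\hat a^\dagger-\alpha^*\hat a)$ on the single-mode Fock space. The channel arises from two beam splitters, of transmissivities $\eta_1=\frac12$ (combining $\hat a_1,\hat a_2$ into $\hat c=\sqrt{\eta_1}\hat a_1+\sqrt{1-\eta_1}\hat a_2$) and $\eta_2=\frac13$ ($\hat b=\sqrt{\eta_2}\hat c+\sqrt{1-\eta_2}\hat a_3$, $\hat e=\sqrt{1-\eta_2}\hat c-\sqrt{\eta_2}\hat a_3$). For coherent inputs $|X_1\rangle,|X_2\rangle,|X_3\rangle$ the receiver obtains the coherent state $\big|\sqrt{1/6}\,X_1+\sqrt{1/6}\,X_2+\sqrt{4/6}\,X_3\big\rangle$ and the warden obtains $\big|\sqrt{1/3}\,(X_1+X_2-X_3)\big\rangle$. The channel is used $n$ times independently. $M_1,M_2$ are independent and uniform on $\{1,\dots,\lfloor2^{nR_s}\rfloor\}$, $s=1,2$. A code consists of encoders $m_1\mapsto x_1^n$, $m_2\mapsto x_2^n$, $(m_1,m_2)\mapsto x_3^n$ in $\mathbb C^n$ (every codeword $x_t^n=(x_{t,1},\dots,x_{t,n})$ satisfying the photon-number constraint $\frac1n\sum_{i=1}^n|x_{t,i}|^2\le N_t$, for $t=1,2,3$, and transmitted as the product coherent state $|x_{t,1}\rangle\otimes\cdots\otimes|x_{t,n}\rangle$) and a decoding POVM on the receiver's $n$ modes. The no-communication state at the warden is $\rho_0^{\otimes n}$ with $\rho_0=|0\rangle\langle0|$.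 A pair $(R_1,R_2)$ is achievable if there is a sequence of codes with average error probability tending to $0$ and $\lim_{n\to\infty}\|\tau_{E^n}-\rho_0^{\otimes n}\|_1=0$, where $\tau_{E^n}$ is the warden's output state averaged over the messages. $\mathcal C_{\text{CC-BMAC}}$ is the closure of the set of achievable pairs. *)

theory Defs
  imports "HOL-Analysis.Analysis"
begin

section \<open>Single-mode states and coherent states\<close>

text \<open>
  A vector of the single-mode Fock space is given by its amplitudes in the number basis.
\<close>

definition vacuum :: "nat \<Rightarrow> complex" where
  "vacuum k = (if k = 0 then 1 else 0)"

definition annihilate :: "(nat \<Rightarrow> complex) \<Rightarrow> nat \<Rightarrow> complex" where
  "annihilate \<psi> k = of_real (sqrt (real (Suc k))) * \<psi> (Suc k)"

definition create :: "(nat \<Rightarrow> complex) \<Rightarrow> nat \<Rightarrow> complex" where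
  "create \<psi> k = (case k of 0 \<Rightarrow> 0 | Suc j \<Rightarrow> of_real (sqrt (real (Suc j))) * \<psi> j)"

text \<open>
  The operator exponential \<open>exp (\<alpha> a\<^sup>\<dagger> - \<alpha>\<^sup>* a)\<close> is taken as its power series, evaluated
  amplitude by amplitude. Vectors with finitely many nonzero amplitudes, the vacuum in particular,
  are analytic vectors of the exponent, so that on them the series converges to the value of the
  unitary displacement operator; it is only applied to the vacuum below.
\<close>

definition displacement :: "complex \<Rightarrow> (nat \<Rightarrow> complex) \<Rightarrow> nat \<Rightarrow> complex" where
  "displacement \<alpha> \<psi> k =
     (\<Sum>m. ((\<lambda>\<phi> j. \<alpha> * create \<phi> j - cnj \<alpha> * annihilate \<phi> j) ^^ m) \<psi> k / fact m)"

definition coherent :: "complex \<Rightarrow> nat \<Rightarrow> complex" where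
  "coherent \<alpha> = displacement \<alpha> vacuum"


section \<open>The Fock space of \<open>n\<close> modes\<close>

text \<open>
  The number basis of \<open>n\<close> modes is indexed by the lists of length \<open>n\<close> of occupation numbers.
\<close>

type_synonym ket = "nat list \<Rightarrow> complex"
type_synonym operator = "ket \<Rightarrow> ket"

definition fock :: "nat \<Rightarrow> ket set" where
  "fock n = {\<psi>. (\<forall>k. length k \<noteq> n \<longrightarrow> \<psi> k = 0) \<and> (\<lambda>k. (cmod (\<psi> k))\<^sup>2) summable_on UNIV}"

definition braket :: "ket \<Rightarrow> ket \<Rightarrow> complex" where
  "braket \<phi> \<psi> = (\<Sum>\<^sub>\<infinity>k. cnj (\<phi> k) * \<psi> k)"

definition ket_norm :: "ket \<Rightarrow> real" where
  "ket_norm \<psi> = sqrt (\<Sum>\<^sub>\<infinity>k. (cmod (\<psi> k))\<^sup>2)"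

definition basis_ket :: "nat list \<Rightarrow> ket" where
  "basis_ket k j = (if j = k then 1 else 0)"

definition tensor_ket :: "nat \<Rightarrow> (nat \<Rightarrow> nat \<Rightarrow> complex) \<Rightarrow> ket" where
  "tensor_ket n \<phi> k = (if length k = n then \<Prod>i<n. \<phi> i (k ! i) else 0)"


section \<open>Operators on the \<open>n\<close>-mode Fock space\<close>

text \<open>
  An operator matters only through its values on \<^term>\<open>fock n\<close>. The operators selected by a
  definite description are made unique as functions by requiring them to be
  \<^const>\<open>extensional\<close>.
\<close>

definition bounded_op :: "nat \<Rightarrow> operator \<Rightarrow> bool" where
  "bounded_op n T \<longleftrightarrow>
     (\<forall>\<psi>\<in>fock n. T \<psi> \<in> fock n) \<and>
     (\<forall>\<psi>\<in>fock n. \<forall>\<phi>\<in>fock n. \<forall>a b.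
        T (\<lambda>k. a * \<psi> k + b * \<phi> k) = (\<lambda>k. a * T \<psi> k + b * T \<phi> k)) \<and>
     (\<exists>C. \<forall>\<psi>\<in>fock n. ket_norm (T \<psi>) \<le> C * ket_norm \<psi>)"

definition positive_op :: "nat \<Rightarrow> operator \<Rightarrow> bool" where
  "positive_op n T \<longleftrightarrow> bounded_op n T \<and> (\<forall>\<psi>\<in>fock n. braket \<psi> (T \<psi>) \<in> \<real>\<^sub>\<ge>\<^sub>0)"

definition op_adjoint :: "nat \<Rightarrow> operator \<Rightarrow> operator" where
  "op_adjoint n T = (THE A. A \<in> extensional (fock n) \<and> bounded_op n A \<and>
     (\<forall>\<phi>\<in>fock n. \<forall>\<psi>\<in>fock n. braket (A \<phi>) \<psi> = braket \<phi> (T \<psi>)))"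

text \<open>The absolute value \<open>\<bar>T\<bar>\<close>, the positive square root of \<open>T\<^sup>\<dagger> T\<close>.\<close>

definition op_abs :: "nat \<Rightarrow> operator \<Rightarrow> operator" where
  "op_abs n T = (THE S. S \<in> extensional (fock n) \<and> positive_op n S \<and>
     (\<forall>\<psi>\<in>fock n. S (S \<psi>) = op_adjoint n T (T \<psi>)))"

definition op_trace :: "nat \<Rightarrow> operator \<Rightarrow> complex" where
  "op_trace n T = (\<Sum>\<^sub>\<infinity>k\<in>{k. length k = n}. T (basis_ket k) k)"

text \<open>
  Meaningful for trace-class operators only: a divergent \<^const>\<open>infsum\<close> is 0. Below it is applied
  to operators of finite rank.
\<close>

definition trace_norm :: "nat \<Rightarrow> operator \<Rightarrow> real" where
  "trace_norm n T = Re (op_trace n (op_abs n T))"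

definition pure_state :: "ket \<Rightarrow> operator" where
  "pure_state \<psi> \<xi> = (\<lambda>k. braket \<psi> \<xi> * \<psi> k)"

definition is_povm :: "nat \<Rightarrow> 'i set \<Rightarrow> ('i \<Rightarrow> operator) \<Rightarrow> bool" where
  "is_povm n I \<Lambda> \<longleftrightarrow> finite I \<and> (\<forall>i\<in>I. positive_op n (\<Lambda> i)) \<and>
     (\<forall>\<psi>\<in>fock n. (\<lambda>k. \<Sum>i\<in>I. \<Lambda> i \<psi> k) = \<psi>)"


section \<open>The channel\<close>

text \<open>
  On coherent inputs the linear relations between the modes act on the coherent amplitudes, and
  the outputs are again coherent states.
\<close>

definition receiver_amp :: "complex \<Rightarrow> complex \<Rightarrow> complex \<Rightarrow> complex" where
  "receiver_amp x1 x2 x3 =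
     of_real (sqrt (1/6)) * x1 + of_real (sqrt (1/6)) * x2 + of_real (sqrt (2/3)) * x3"

definition warden_amp :: "complex \<Rightarrow> complex \<Rightarrow> complex \<Rightarrow> complex" where
  "warden_amp x1 x2 x3 =
     of_real (sqrt (1/3)) * x1 + of_real (sqrt (1/3)) * x2 - of_real (sqrt (1/3)) * x3"

lemma beam_splitters:
  fixes x1 x2 x3 :: complex and \<eta>1 \<eta>2 :: real
  defines "\<eta>1 \<equiv> 1/2" and "\<eta>2 \<equiv> 1/3"
  defines "c \<equiv> of_real (sqrt \<eta>1) * x1 + of_real (sqrt (1 - \<eta>1)) * x2"
  shows "receiver_amp x1 x2 x3 = of_real (sqrt \<eta>2) * c + of_real (sqrt (1 - \<eta>2)) * x3"
    and "warden_amp x1 x2 x3 = of_real (sqrt (1 - \<eta>2)) * c - of_real (sqrt \<eta>2) * x3"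
proof -
  have 1: "sqrt (1/6) = sqrt (1/3) * sqrt (1/2)" "sqrt (1/3) = sqrt (2/3) * sqrt (1/2)"
    by (simp_all flip: real_sqrt_mult)
  show "receiver_amp x1 x2 x3 = of_real (sqrt \<eta>2) * c + of_real (sqrt (1 - \<eta>2)) * x3"
    unfolding receiver_amp_def c_def \<eta>1_def \<eta>2_def 1(1) by (simp add: algebra_simps)
  have 2: "complex_of_real (sqrt (1/3)) = of_real (sqrt (2/3)) * of_real (sqrt (1/2))"
    by (simp only: 1(2) of_real_mult)
  show "warden_amp x1 x2 x3 = of_real (sqrt (1 - \<eta>2)) * c - of_real (sqrt \<eta>2) * x3"
    unfolding warden_amp_def c_def \<eta>1_def \<eta>2_def using 2 by (simp add: algebra_simps)
qed


section \<open>Codes and the covert capacity region\<close>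

text \<open>
  A codeword is a function of the time index \<open>i < n\<close>; its values at other indices are irrelevant.
\<close>

record code =
  enc1 :: "nat \<Rightarrow> nat \<Rightarrow> complex"
  enc2 :: "nat \<Rightarrow> nat \<Rightarrow> complex"
  enc3 :: "nat \<Rightarrow> nat \<Rightarrow> nat \<Rightarrow> complex"
  dec :: "nat \<times> nat \<Rightarrow> operator"

definition num_messages :: "nat \<Rightarrow> real \<Rightarrow> nat" where
  "num_messages n R = nat \<lfloor>2 powr (real n * R)\<rfloor>"

definition messages :: "nat \<Rightarrow> real \<Rightarrow> real \<Rightarrow> (nat \<times> nat) set" where
  "messages n R1 R2 = {1..num_messages n R1} \<times> {1..num_messages n R2}"

definition power_constraint :: "nat \<Rightarrow> real \<Rightarrow> (nat \<Rightarrow> complex) \<Rightarrow> bool" where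
  "power_constraint n N x \<longleftrightarrow> (1 / real n) * (\<Sum>i<n. (cmod (x i))\<^sup>2) \<le> N"

definition is_code :: "real \<Rightarrow> real \<Rightarrow> real \<Rightarrow> nat \<Rightarrow> real \<Rightarrow> real \<Rightarrow> code \<Rightarrow> bool" where
  "is_code N1 N2 N3 n R1 R2 C \<longleftrightarrow>
     (\<forall>m1\<in>{1..num_messages n R1}. power_constraint n N1 (enc1 C m1)) \<and>
     (\<forall>m2\<in>{1..num_messages n R2}. power_constraint n N2 (enc2 C m2)) \<and>
     (\<forall>(m1, m2)\<in>messages n R1 R2. power_constraint n N3 (enc3 C m1 m2)) \<and>
     is_povm n (messages n R1 R2) (dec C)"

definition receiver_state :: "nat \<Rightarrow> code \<Rightarrow> nat \<times> nat \<Rightarrow> operator" where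
  "receiver_state n C = (\<lambda>(m1, m2). pure_state (tensor_ket n (\<lambda>i.
     coherent (receiver_amp (enc1 C m1 i) (enc2 C m2 i) (enc3 C m1 m2 i)))))"

definition warden_state :: "nat \<Rightarrow> code \<Rightarrow> nat \<times> nat \<Rightarrow> operator" where
  "warden_state n C = (\<lambda>(m1, m2). pure_state (tensor_ket n (\<lambda>i.
     coherent (warden_amp (enc1 C m1 i) (enc2 C m2 i) (enc3 C m1 m2 i)))))"

definition error_prob :: "nat \<Rightarrow> real \<Rightarrow> real \<Rightarrow> code \<Rightarrow> real" where
  "error_prob n R1 R2 C = (\<Sum>m\<in>messages n R1 R2.
     1 - Re (op_trace n (dec C m \<circ> receiver_state n C m))) / real (card (messages n R1 R2))"

definition warden_avg_state :: "nat \<Rightarrow> real \<Rightarrow> real \<Rightarrow> code \<Rightarrow> operator" where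
  "warden_avg_state n R1 R2 C = (\<lambda>\<xi> k.
     (\<Sum>m\<in>messages n R1 R2. warden_state n C m \<xi> k) / of_nat (card (messages n R1 R2)))"

definition innocent_state :: "nat \<Rightarrow> operator" where
  "innocent_state n = pure_state (tensor_ket n (\<lambda>_. vacuum))"

definition achievable :: "real \<Rightarrow> real \<Rightarrow> real \<Rightarrow> real \<times> real \<Rightarrow> bool" where
  "achievable N1 N2 N3 = (\<lambda>(R1, R2). 0 \<le> R1 \<and> 0 \<le> R2 \<and>
     (\<exists>C :: nat \<Rightarrow> code.
        (\<forall>n>0. is_code N1 N2 N3 n R1 R2 (C n)) \<and>
        (\<lambda>n. error_prob n R1 R2 (C n)) \<longlonglongrightarrow> 0 \<and>
        (\<lambda>n. trace_norm n (\<lambda>\<xi> k. warden_avg_state n R1 R2 (C n) \<xi> k - innocent_state n \<xi> k))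
          \<longlonglongrightarrow> 0))"

definition covert_capacity_region :: "real \<Rightarrow> real \<Rightarrow> real \<Rightarrow> (real \<times> real) set" where
  "covert_capacity_region N1 N2 N3 = closure {R. achievable N1 N2 N3 R}"

definition g :: "real \<Rightarrow> real" where
  "g N = (if N > 0 then (N + 1) * log 2 (N + 1) - N * log 2 N else 0)"

end

theory Submission
  imports Defs "HOL-Probability.Probability" "HOL-Computational_Algebra.Fundamental_Theorem_Algebra"
    "HOL-Library.Function_Algebras" "HOL-Real_Asymp.Real_Asymp"
begin

text \<open>
  The helper sends \<open>x\<^sub>3 = x\<^sub>1 + x\<^sub>2\<close>. Then the amplitude at the warden is 0 and the receiver obtains
  the coherent states of amplitude \<open>sqrt (3/2) (x\<^sub>1 + x\<^sub>2)\<close>. Codewords violating their power constraint are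
  replaced by the vacuum, and so is the helper's word when the sum violates the helper's constraint;
  the warden sees the vacuum except on these last message pairs, so the trace distance is at most
  twice their fraction.

  The codewords are drawn from complex Gaussian distributions, whose coherent states average to
  thermal states of entropy \<open>g\<close> per mode. The receiver tests the message pairs one after the other. The
  candidate \<open>(x, y)\<close> is tested by the projection \<open>e\<close> of \<open>|x + y\<rangle>\<close> onto the number states
  typical for the first user, displaced by \<open>y\<close>; in the analysis, the transmitted state is replaced by
  its projection onto the typical number states of the second user, displaced by \<open>x\<close>, followed by the projection
  onto the typical number states of the sum. The three projections bound the mean overlap of the
  test of a wrong candidate with the transmitted state when, respectively, only the
  first message, only the second, or both are wrong, by \<open>2 powr - n c\<close> for every \<open>c\<close> below \<open>g P\<close>, \<open>g Q\<close> and \<open>g (P + Q)\<close>.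
  Covertness forces no further loss: since \<open>g\<close> is increasing and subadditive, every rate pair of
  the region admits powers \<open>P\<close>, \<open>Q\<close> meeting all constraints strictly.
\<close>

section \<open>Vectors of the Fock space\<close>

text \<open>Three kinds of wrong candidates must be controlled by one pair of vectors, although the
  typical projections do not commute. What makes this possible is the position of each cut. Averaged
  over the candidate's own \<open>x'\<close>, the test is a thermal state cut to \<open>J1\<close>;
  averaged over the sent \<open>y\<close>, the smoothed state is one cut to \<open>J2\<close>;
  averaged over both sent words, it is the outermost cut \<open>J3\<close> that counts. In each
  average the remaining cuts only shorten vectors or are removed by monotonicity.

  Coherent states are pure, so the tests have rank one and everything is estimated in amplitudes.
  Norms then enter the error linearly; a <= t + a^2 / t trades them for squares, whose Gaussian
  means are explicit.

  The factor 3/2 is (sqrt(1/6) + sqrt(2/3))^2, the gain from the helper adding in phase.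

  \<open>trace_norm\<close> rests on definite descriptions, so existence and uniqueness of adjoint
  and absolute value have to be proved. The operators concerned are finite combinations of pure
  states, which reduces this to finite-dimensional spectral theory inside an infinite-dimensional
  space.\<close>

lemma fock_eq_0: "\<psi> \<in> fock n \<Longrightarrow> length k \<noteq> n \<Longrightarrow> \<psi> k = 0"
  by (simp add: fock_def)

lemma summable_cnj_mult:
  fixes \<phi> \<psi> :: ket
  assumes "(\<lambda>k. (cmod (\<phi> k))\<^sup>2) summable_on UNIV" "(\<lambda>k. (cmod (\<psi> k))\<^sup>2) summable_on UNIV"
  shows "(\<lambda>k. cnj (\<phi> k) * \<psi> k) summable_on UNIV"
proof (rule abs_summable_summable)
  have "(\<lambda>k. (cmod (\<phi> k))\<^sup>2 + (cmod (\<psi> k))\<^sup>2) summable_on UNIV"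
    using assms by (rule summable_on_add)
  then show "(\<lambda>k. norm (cnj (\<phi> k) * \<psi> k)) summable_on UNIV"
  proof (rule summable_on_comparison_test)
    fix k
    have "0 \<le> cmod (\<phi> k) * cmod (\<psi> k)" by simp
    then show "norm (cnj (\<phi> k) * \<psi> k) \<le> (cmod (\<phi> k))\<^sup>2 + (cmod (\<psi> k))\<^sup>2"
      using sum_squares_bound[of "cmod (\<phi> k)" "cmod (\<psi> k)"]
      unfolding norm_mult complex_mod_cnj mult.assoc by linarith
  qed simp
qed

lemma fock_lincomb:
  assumes "\<phi> \<in> fock n" "\<psi> \<in> fock n"
  shows "(\<lambda>k. a * \<phi> k + b * \<psi> k) \<in> fock n"
proof -
  have 1: "(\<lambda>k. 2 * (cmod a)\<^sup>2 * (cmod (\<phi> k))\<^sup>2 + 2 * (cmod b)\<^sup>2 * (cmod (\<psi> k))\<^sup>2) summable_on UNIV"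
    using assms by (intro summable_on_add summable_on_cmult_right) (auto simp: fock_def)
  have "(\<lambda>k. (cmod (a * \<phi> k + b * \<psi> k))\<^sup>2) summable_on UNIV"
  proof (rule summable_on_comparison_test[OF 1])
    fix k
    have "(cmod (a * \<phi> k + b * \<psi> k))\<^sup>2 \<le> (cmod a * cmod (\<phi> k) + cmod b * cmod (\<psi> k))\<^sup>2"
      by (intro power_mono) (auto simp flip: norm_mult intro: norm_triangle_ineq)
    also have "\<dots> \<le> 2 * (cmod a * cmod (\<phi> k))\<^sup>2 + 2 * (cmod b * cmod (\<psi> k))\<^sup>2"
      using zero_le_power2[of "cmod a * cmod (\<phi> k) - cmod b * cmod (\<psi> k)"]
      by (simp add: power2_eq_square algebra_simps)
    finally show "(cmod (a * \<phi> k + b * \<psi> k))\<^sup>2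
        \<le> 2 * (cmod a)\<^sup>2 * (cmod (\<phi> k))\<^sup>2 + 2 * (cmod b)\<^sup>2 * (cmod (\<psi> k))\<^sup>2"
      by (simp add: power_mult_distrib)
  qed simp
  with assms show ?thesis by (auto simp: fock_def)
qed

lemma fock_zero: "(\<lambda>k. 0) \<in> fock n"
  by (simp add: fock_def)

lemma fock_scale: "\<psi> \<in> fock n \<Longrightarrow> (\<lambda>k. a * \<psi> k) \<in> fock n"
  using fock_lincomb[of \<psi> n \<psi> a 0] by simp

lemma fock_add: "\<phi> \<in> fock n \<Longrightarrow> \<psi> \<in> fock n \<Longrightarrow> (\<lambda>k. \<phi> k + \<psi> k) \<in> fock n"
  using fock_lincomb[of \<phi> n \<psi> 1 1] by simp

lemma fock_diff: "\<phi> \<in> fock n \<Longrightarrow> \<psi> \<in> fock n \<Longrightarrow> (\<lambda>k. \<phi> k - \<psi> k) \<in> fock n"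
  using fock_lincomb[of \<phi> n \<psi> 1 "-1"] by simp

lemma fock_sum:
  assumes "\<And>i. i \<in> I \<Longrightarrow> v i \<in> fock n"
  shows "(\<lambda>k. \<Sum>i\<in>I. c i * v i k) \<in> fock n"
  using assms
proof (induction I rule: infinite_finite_induct)
  case (insert i I)
  then show ?case
    using fock_add[of "\<lambda>k. c i * v i k" n "\<lambda>k. \<Sum>i\<in>I. c i * v i k"] fock_scale[of "v i" n "c i"]
    by simp
qed (simp_all add: fock_zero)

lemma fock_restrict:
  assumes "\<psi> \<in> fock n"
  shows "(\<lambda>k. if k \<in> A then \<psi> k else 0) \<in> fock n"
proof -
  have "(\<lambda>k. (cmod (if k \<in> A then \<psi> k else 0))\<^sup>2) summable_on UNIV"
    by (rule summable_on_comparison_test[where f="\<lambda>k. (cmod (\<psi> k))\<^sup>2"])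
       (use assms in \<open>auto simp: fock_def\<close>)
  then show ?thesis using assms by (auto simp: fock_def)
qed

lemma summable_braket:
  "\<phi> \<in> fock n \<Longrightarrow> \<psi> \<in> fock n \<Longrightarrow> (\<lambda>k. cnj (\<phi> k) * \<psi> k) summable_on UNIV"
  by (rule summable_cnj_mult) (auto simp: fock_def)

lemma braket_cnj: "cnj (braket \<phi> \<psi>) = braket \<psi> \<phi>"
  unfolding braket_def infsum_cnj[symmetric] by (simp add: mult.commute)

lemma braket_lincomb_right:
  assumes "\<xi> \<in> fock n" "\<phi> \<in> fock n" "\<psi> \<in> fock n"
  shows "braket \<xi> (\<lambda>k. a * \<phi> k + b * \<psi> k) = a * braket \<xi> \<phi> + b * braket \<xi> \<psi>"
proof -
  have "braket \<xi> (\<lambda>k. a * \<phi> k + b * \<psi> k) =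
      (\<Sum>\<^sub>\<infinity>k. a * (cnj (\<xi> k) * \<phi> k) + b * (cnj (\<xi> k) * \<psi> k))"
    unfolding braket_def by (intro infsum_cong) (simp add: algebra_simps)
  also have "\<dots> = (\<Sum>\<^sub>\<infinity>k. a * (cnj (\<xi> k) * \<phi> k)) + (\<Sum>\<^sub>\<infinity>k. b * (cnj (\<xi> k) * \<psi> k))"
    using assms by (intro infsum_add summable_on_cmult_right summable_braket)
  also have "\<dots> = a * braket \<xi> \<phi> + b * braket \<xi> \<psi>"
    unfolding braket_def by (simp add: infsum_cmult_right')
  finally show ?thesis .
qed

lemma braket_lincomb_left:
  assumes "\<xi> \<in> fock n" "\<phi> \<in> fock n" "\<psi> \<in> fock n"
  shows "braket (\<lambda>k. a * \<phi> k + b * \<psi> k) \<xi> = cnj a * braket \<phi> \<xi> + cnj b * braket \<psi> \<xi>"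
  using arg_cong[OF braket_lincomb_right[OF assms, of a b], of cnj] by (simp add: braket_cnj)

lemma braket_zero [simp]: "braket \<xi> (\<lambda>k. 0) = 0" "braket (\<lambda>k. 0) \<xi> = 0"
  by (simp_all add: braket_def)

lemma braket_scale_right: "braket \<xi> (\<lambda>k. a * \<phi> k) = a * braket \<xi> \<phi>"
proof -
  have "braket \<xi> (\<lambda>k. a * \<phi> k) = (\<Sum>\<^sub>\<infinity>k. a * (cnj (\<xi> k) * \<phi> k))"
    unfolding braket_def by (intro infsum_cong) (simp add: algebra_simps)
  then show ?thesis by (simp add: infsum_cmult_right' braket_def)
qed

lemma braket_scale_left: "braket (\<lambda>k. a * \<phi> k) \<xi> = cnj a * braket \<phi> \<xi>"
  using arg_cong[OF braket_scale_right[of \<xi> a \<phi>], of cnj] by (simp add: braket_cnj)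

lemma braket_diff_right:
  "\<xi> \<in> fock n \<Longrightarrow> \<phi> \<in> fock n \<Longrightarrow> \<psi> \<in> fock n \<Longrightarrow>
    braket \<xi> (\<lambda>k. \<phi> k - \<psi> k) = braket \<xi> \<phi> - braket \<xi> \<psi>"
  using braket_lincomb_right[of \<xi> n \<phi> \<psi> 1 "-1"] by simp

lemma braket_diff_left:
  "\<xi> \<in> fock n \<Longrightarrow> \<phi> \<in> fock n \<Longrightarrow> \<psi> \<in> fock n \<Longrightarrow>
    braket (\<lambda>k. \<phi> k - \<psi> k) \<xi> = braket \<phi> \<xi> - braket \<psi> \<xi>"
  using braket_lincomb_left[of \<xi> n \<phi> \<psi> 1 "-1"] by simp

lemma braket_sum_right:
  assumes "\<xi> \<in> fock n" "\<And>i. i \<in> I \<Longrightarrow> v i \<in> fock n"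
  shows "braket \<xi> (\<lambda>k. \<Sum>i\<in>I. c i * v i k) = (\<Sum>i\<in>I. c i * braket \<xi> (v i))"
  using assms(2)
proof (induction I rule: infinite_finite_induct)
  case (insert i I)
  have "(\<lambda>k. \<Sum>i\<in>I. c i * v i k) \<in> fock n" using insert.prems by (intro fock_sum) auto
  with braket_lincomb_right[of \<xi> n "v i" "\<lambda>k. \<Sum>i\<in>I. c i * v i k" "c i" 1] insert assms(1)
  show ?case by simp
qed simp_all

lemma braket_sum_left:
  assumes "\<xi> \<in> fock n" "\<And>i. i \<in> I \<Longrightarrow> v i \<in> fock n"
  shows "braket (\<lambda>k. \<Sum>i\<in>I. c i * v i k) \<xi> = (\<Sum>i\<in>I. cnj (c i) * braket (v i) \<xi>)"
  using arg_cong[where f=cnj, OF braket_sum_right[of \<xi> n I v c, OF assms]]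
  by (simp add: braket_cnj)

lemma ket_norm_nonneg [simp]: "0 \<le> ket_norm \<psi>"
  by (simp add: ket_norm_def infsum_nonneg)

lemma ket_norm_zero [simp]: "ket_norm (\<lambda>k. 0) = 0"
  by (simp add: ket_norm_def)

lemma ket_norm_power2: "(ket_norm \<psi>)\<^sup>2 = (\<Sum>\<^sub>\<infinity>k. (cmod (\<psi> k))\<^sup>2)"
  by (simp add: ket_norm_def infsum_nonneg)

lemma braket_self: "braket \<psi> \<psi> = of_real ((ket_norm \<psi>)\<^sup>2)"
proof -
  have "braket \<psi> \<psi> = (\<Sum>\<^sub>\<infinity>k. complex_of_real ((cmod (\<psi> k))\<^sup>2))"
    unfolding braket_def complex_norm_square by (simp add: mult.commute)
  also have "\<dots> = of_real (\<Sum>\<^sub>\<infinity>k. (cmod (\<psi> k))\<^sup>2)"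
  proof (cases "(\<lambda>k. (cmod (\<psi> k))\<^sup>2) summable_on UNIV")
    case True
    then show ?thesis by (intro infsumI has_sum_of_real has_sum_infsum)
  next
    \<comment> \<open>For a non-summable \<open>\<psi>\<close> both sides are 0, the default value
      of \<open>infsum\<close>.\<close>
    case False
    moreover from this have "\<not> (\<lambda>k. complex_of_real ((cmod (\<psi> k))\<^sup>2)) summable_on UNIV"
      using summable_on_Re by fastforce
    ultimately show ?thesis using infsum_not_exists by (metis of_real_0)
  qed
  finally show ?thesis by (simp only: ket_norm_power2)
qed

lemma ket_norm_eq_0:
  assumes "\<psi> \<in> fock n" "ket_norm \<psi> = 0"
  shows "\<psi> = (\<lambda>k. 0)"
proof
  fix k
  have "(cmod (\<psi> k))\<^sup>2 = 0"
    by (rule nonneg_infsum_le_0D[where A=UNIV and f="\<lambda>k. (cmod (\<psi> k))\<^sup>2"])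
       (use assms in \<open>auto simp: fock_def simp flip: ket_norm_power2\<close>)
  then show "\<psi> k = 0" by simp
qed

lemma ket_norm_scale: "ket_norm (\<lambda>k. a * \<psi> k) = cmod a * ket_norm \<psi>"
  by (simp add: ket_norm_def norm_mult power_mult_distrib infsum_cmult_right' real_sqrt_mult)

lemma ket_norm_lincomb_power2:
  assumes "\<phi> \<in> fock n" "\<psi> \<in> fock n"
  shows "(ket_norm (\<lambda>k. \<phi> k - a * \<psi> k))\<^sup>2 =
    (ket_norm \<phi>)\<^sup>2 - 2 * Re (cnj a * braket \<psi> \<phi>) + (cmod a)\<^sup>2 * (ket_norm \<psi>)\<^sup>2"
proof -
  let ?\<xi> = "\<lambda>k. a * \<psi> k"
  have f: "?\<xi> \<in> fock n" using assms by (intro fock_scale)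
  have d: "(\<lambda>k. \<phi> k - ?\<xi> k) \<in> fock n" using assms(1) f by (rule fock_diff)
  have "complex_of_real ((ket_norm (\<lambda>k. \<phi> k - a * \<psi> k))\<^sup>2) =
      braket \<phi> \<phi> - braket \<phi> ?\<xi> - (braket ?\<xi> \<phi> - braket ?\<xi> ?\<xi>)"
    unfolding braket_self[symmetric]
    by (simp add: braket_diff_left[OF d assms(1) f] braket_diff_right[OF assms(1) assms(1) f] braket_diff_right[OF f assms(1) f])
  also have "\<dots> = of_real ((ket_norm \<phi>)\<^sup>2 - 2 * Re (cnj a * braket \<psi> \<phi>) + (cmod a)\<^sup>2 * (ket_norm \<psi>)\<^sup>2)"
    unfolding braket_scale_left braket_scale_right braket_self braket_cnj[of \<psi> \<phi>, symmetric]
    by (simp add: complex_eq_iff cmod_power2 algebra_simps flip: of_real_power) (simp add: power2_eq_square)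
  finally show ?thesis by (simp only: of_real_eq_iff)
qed

lemma Cauchy_Schwarz_braket:
  assumes "\<phi> \<in> fock n" "\<psi> \<in> fock n"
  shows "cmod (braket \<phi> \<psi>) \<le> ket_norm \<phi> * ket_norm \<psi>"
proof (cases "ket_norm \<phi> = 0")
  case True
  then show ?thesis using ket_norm_eq_0[OF assms(1)] by simp
next
  case False
  define a where "a = braket \<phi> \<psi> / of_real ((ket_norm \<phi>)\<^sup>2)"
  have pos: "(ket_norm \<phi>)\<^sup>2 > 0" using False by simp
  have "0 \<le> (ket_norm (\<lambda>k. \<psi> k - a * \<phi> k))\<^sup>2" by simp
  also have "\<dots> = (ket_norm \<psi>)\<^sup>2 - 2 * Re (cnj a * braket \<phi> \<psi>) + (cmod a)\<^sup>2 * (ket_norm \<phi>)\<^sup>2"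
    by (rule ket_norm_lincomb_power2[OF assms(2,1)])
  also have "Re (cnj a * braket \<phi> \<psi>) = (cmod (braket \<phi> \<psi>))\<^sup>2 / (ket_norm \<phi>)\<^sup>2"
    unfolding a_def by (simp add: cmod_power2 add_divide_distrib flip: power2_eq_square of_real_power)
  also have "(cmod a)\<^sup>2 * (ket_norm \<phi>)\<^sup>2 = (cmod (braket \<phi> \<psi>))\<^sup>2 / (ket_norm \<phi>)\<^sup>2"
    unfolding a_def using pos by (simp add: norm_divide power_divide norm_power) (simp add: power2_eq_square power4_eq_xxxx)
  finally have "(cmod (braket \<phi> \<psi>))\<^sup>2 \<le> (ket_norm \<phi> * ket_norm \<psi>)\<^sup>2"
    using pos by (simp add: field_simps power_mult_distrib)
  then show ?thesis by (rule power2_le_imp_le) simp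
qed

lemma ket_norm_triangle:
  assumes "\<phi> \<in> fock n" "\<psi> \<in> fock n"
  shows "ket_norm (\<lambda>k. \<phi> k + \<psi> k) \<le> ket_norm \<phi> + ket_norm \<psi>"
proof (rule power2_le_imp_le)
  have "(ket_norm (\<lambda>k. \<phi> k + \<psi> k))\<^sup>2 = (ket_norm \<phi>)\<^sup>2 + 2 * Re (braket \<psi> \<phi>) + (ket_norm \<psi>)\<^sup>2"
    using ket_norm_lincomb_power2[OF assms, of "-1"] by simp
  also have "Re (braket \<psi> \<phi>) \<le> ket_norm \<phi> * ket_norm \<psi>"
    using Cauchy_Schwarz_braket[OF assms(2,1)] complex_Re_le_cmod[of "braket \<psi> \<phi>"] by (simp add: mult.commute)
  finally show "(ket_norm (\<lambda>k. \<phi> k + \<psi> k))\<^sup>2 \<le> (ket_norm \<phi> + ket_norm \<psi>)\<^sup>2"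
    by (simp add: power2_sum)
qed simp

lemma ket_norm_triangle_diff:
  assumes "\<phi> \<in> fock n" "\<psi> \<in> fock n"
  shows "ket_norm \<phi> \<le> ket_norm (\<lambda>k. \<phi> k - \<psi> k) + ket_norm \<psi>"
  using ket_norm_triangle[OF fock_diff[OF assms] assms(2)] by simp

lemma ket_norm_minus_commute: "ket_norm (\<lambda>k. \<phi> k - \<psi> k) = ket_norm (\<lambda>k. \<psi> k - \<phi> k)"
  by (simp add: ket_norm_def norm_minus_commute)

section \<open>Orthonormal families of kets\<close>

definition orthonormal_kets :: "nat \<Rightarrow> 'i set \<Rightarrow> ('i \<Rightarrow> ket) \<Rightarrow> bool" where
  "orthonormal_kets n I v \<longleftrightarrow> (\<forall>i\<in>I. v i \<in> fock n) \<and>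
     (\<forall>i\<in>I. \<forall>j\<in>I. braket (v i) (v j) = (if i = j then 1 else 0))"

lemma orthonormal_ketsD:
  assumes "orthonormal_kets n I v"
  shows "i \<in> I \<Longrightarrow> v i \<in> fock n"
    and "i \<in> I \<Longrightarrow> j \<in> I \<Longrightarrow> braket (v i) (v j) = (if i = j then 1 else 0)"
  using assms by (auto simp: orthonormal_kets_def)

lemma orthonormal_kets_coefficient:
  assumes "orthonormal_kets n I v" "finite I" "i \<in> I"
  shows "braket (v i) (\<lambda>k. \<Sum>j\<in>I. c j * v j k) = c i"
proof -
  have "braket (v i) (\<lambda>k. \<Sum>j\<in>I. c j * v j k) = (\<Sum>j\<in>I. c j * braket (v i) (v j))"
    by (rule braket_sum_right) (use assms in \<open>auto dest: orthonormal_ketsD\<close>)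
  also have "\<dots> = (\<Sum>j\<in>I. if j = i then c i else 0)"
    using assms by (intro sum.cong) (auto simp: orthonormal_ketsD)
  finally show ?thesis using assms by simp
qed

lemma orthonormal_kets_ket_norm:
  assumes "orthonormal_kets n I v" "finite I"
  shows "(ket_norm (\<lambda>k. \<Sum>j\<in>I. c j * v j k))\<^sup>2 = (\<Sum>j\<in>I. (cmod (c j))\<^sup>2)"
proof -
  have "complex_of_real ((ket_norm (\<lambda>k. \<Sum>j\<in>I. c j * v j k))\<^sup>2) =
      (\<Sum>i\<in>I. cnj (c i) * braket (v i) (\<lambda>k. \<Sum>j\<in>I. c j * v j k))"
    unfolding braket_self[symmetric]
    by (rule braket_sum_left) (use assms in \<open>auto intro: fock_sum dest: orthonormal_ketsD\<close>)
  also have "\<dots> = (\<Sum>i\<in>I. of_real ((cmod (c i))\<^sup>2))"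
    using assms
    unfolding complex_norm_square
    by (intro sum.cong) (simp_all add: orthonormal_kets_coefficient mult.commute)
  finally show ?thesis by (simp flip: of_real_sum of_real_power)
qed

text \<open>Pythagoras for the truncated expansion. As an equality it also measures, later on, how
  far a coherent state is from its typical part.\<close>

lemma orthonormal_kets_residual:
  assumes "orthonormal_kets n I v" "finite I" "\<psi> \<in> fock n"
  shows "(ket_norm (\<lambda>k. \<psi> k - (\<Sum>j\<in>I. braket (v j) \<psi> * v j k)))\<^sup>2 =
    (ket_norm \<psi>)\<^sup>2 - (\<Sum>j\<in>I. (cmod (braket (v j) \<psi>))\<^sup>2)"
proof -
  let ?\<xi> = "\<lambda>k. \<Sum>j\<in>I. braket (v j) \<psi> * v j k"
  have f: "?\<xi> \<in> fock n" using assms by (intro fock_sum) (auto dest: orthonormal_ketsD)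
  have "braket ?\<xi> \<psi> = (\<Sum>i\<in>I. of_real ((cmod (braket (v i) \<psi>))\<^sup>2))"
    using assms unfolding complex_norm_square
    by (subst braket_sum_left[of _ n]) (auto dest: orthonormal_ketsD intro!: sum.cong)
  then show ?thesis
    using ket_norm_lincomb_power2[OF assms(3) f, of 1] orthonormal_kets_ket_norm[OF assms(1,2), of "\<lambda>j. braket (v j) \<psi>"]
    by simp
qed

lemma Bessel_braket:
  assumes "orthonormal_kets n I v" "finite I" "\<psi> \<in> fock n"
  shows "(\<Sum>j\<in>I. (cmod (braket (v j) \<psi>))\<^sup>2) \<le> (ket_norm \<psi>)\<^sup>2"
  using orthonormal_kets_residual[OF assms]
    zero_le_power2[of "ket_norm (\<lambda>k. \<psi> k - (\<Sum>j\<in>I. braket (v j) \<psi> * v j k))"] by linarith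

lemma ket_norm_restrict_le:
  assumes "\<psi> \<in> fock n"
  shows "(ket_norm (\<lambda>k. if k \<in> A then \<psi> k else 0))\<^sup>2 \<le> (ket_norm \<psi>)\<^sup>2"
  unfolding ket_norm_power2
  by (rule infsum_mono) (use assms fock_restrict[OF assms] in \<open>auto simp: fock_def\<close>)

section \<open>Sequential decoding\<close>

lemma pure_state_fock: "e \<in> fock n \<Longrightarrow> pure_state e \<psi> \<in> fock n"
  unfolding pure_state_def by (rule fock_scale)

text \<open>This is 1 - |e><e|, a projection exactly when \<open>ket_norm e\<close> is 0 or 1. The
  value 0 is kept throughout as the test that never accepts.\<close>

definition reject :: "ket \<Rightarrow> operator" where
  "reject e \<psi> = (\<lambda>k. \<psi> k - pure_state e \<psi> k)"

lemma reject_fock: "e \<in> fock n \<Longrightarrow> \<psi> \<in> fock n \<Longrightarrow> reject e \<psi> \<in> fock n"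
  unfolding reject_def by (intro fock_diff pure_state_fock)

lemma pure_state_lincomb:
  assumes "e \<in> fock n" "\<phi> \<in> fock n" "\<psi> \<in> fock n"
  shows "pure_state e (\<lambda>k. a * \<phi> k + b * \<psi> k) = (\<lambda>k. a * pure_state e \<phi> k + b * pure_state e \<psi> k)"
  unfolding pure_state_def braket_lincomb_right[OF assms] by (simp add: algebra_simps)

lemma reject_lincomb:
  assumes "e \<in> fock n" "\<phi> \<in> fock n" "\<psi> \<in> fock n"
  shows "reject e (\<lambda>k. a * \<phi> k + b * \<psi> k) = (\<lambda>k. a * reject e \<phi> k + b * reject e \<psi> k)"
  unfolding reject_def pure_state_lincomb[OF assms] by (simp add: algebra_simps)

lemma braket_pure_state: "braket \<phi> (pure_state e \<psi>) = braket e \<psi> * braket \<phi> e"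
  unfolding pure_state_def by (rule braket_scale_right)

lemma braket_reject:
  assumes "e \<in> fock n" "\<phi> \<in> fock n" "\<psi> \<in> fock n"
  shows "braket \<phi> (reject e \<psi>) = braket \<phi> \<psi> - braket e \<psi> * braket \<phi> e"
  unfolding reject_def using assms
  by (simp add: braket_diff_right[OF _ _ pure_state_fock] braket_pure_state)

lemma braket_reject_left:
  assumes "e \<in> fock n" "\<phi> \<in> fock n" "\<psi> \<in> fock n"
  shows "braket (reject e \<phi>) \<psi> = braket \<phi> (reject e \<psi>)"
  using arg_cong[where f=cnj, OF braket_reject[OF assms(1,3,2)]]
  by (simp add: braket_cnj braket_reject[OF assms])

lemma ket_norm_reject:
  assumes "e \<in> fock n" "ket_norm e \<in> {0, 1}" "\<psi> \<in> fock n"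
  shows "(ket_norm (reject e \<psi>))\<^sup>2 = (ket_norm \<psi>)\<^sup>2 - (cmod (braket e \<psi>))\<^sup>2"
proof (cases "ket_norm e = 0")
  case True
  then show ?thesis
    using ket_norm_eq_0[OF assms(1)] by (simp add: reject_def pure_state_def)
next
  case False
  then have "ket_norm e = 1" using assms by simp
  moreover have "Re (cnj (braket e \<psi>) * braket e \<psi>) = (cmod (braket e \<psi>))\<^sup>2"
    by (simp add: cmod_power2 flip: power2_eq_square)
  ultimately show ?thesis
    using ket_norm_lincomb_power2[OF assms(3,1), of "braket e \<psi>"]
    unfolding reject_def pure_state_def by simp
qed

lemma reject_reject:
  assumes "e \<in> fock n" "ket_norm e \<in> {0, 1}" "\<psi> \<in> fock n"
  shows "reject e (reject e \<psi>) = reject e \<psi>"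
proof -
  have "braket e (reject e \<psi>) = 0"
  proof (cases "ket_norm e = 0")
    case False
    then show ?thesis using assms by (simp add: braket_reject braket_self)
  qed (use ket_norm_eq_0[OF assms(1)] in simp)
  then show ?thesis
    unfolding reject_def[of e "reject e \<psi>"] pure_state_def by simp
qed

primrec survive :: "(nat \<Rightarrow> ket) \<Rightarrow> nat \<Rightarrow> operator" where
  "survive e 0 = (\<lambda>\<psi>. \<psi>)"
| "survive e (Suc j) = (\<lambda>\<psi>. reject (e j) (survive e j \<psi>))"

text \<open>The self-adjoint factors of \<open>survive\<close>, multiplied in the reverse order,
  hence its adjoint.\<close>

primrec survive_adj :: "(nat \<Rightarrow> ket) \<Rightarrow> nat \<Rightarrow> operator" where
  "survive_adj e 0 = (\<lambda>\<psi>. \<psi>)"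
| "survive_adj e (Suc j) = (\<lambda>\<psi>. survive_adj e j (reject (e j) \<psi>))"

context
  fixes n :: nat and e :: "nat \<Rightarrow> ket"
  assumes e: "\<And>j. e j \<in> fock n" "\<And>j. ket_norm (e j) \<in> {0, 1}"
begin

lemma survive_fock: "\<psi> \<in> fock n \<Longrightarrow> survive e j \<psi> \<in> fock n"
  by (induction j) (auto intro: reject_fock e)

lemma survive_adj_fock: "\<psi> \<in> fock n \<Longrightarrow> survive_adj e j \<psi> \<in> fock n"
  by (induction j arbitrary: \<psi>) (auto intro: reject_fock e)

lemma survive_lincomb:
  "\<phi> \<in> fock n \<Longrightarrow> \<psi> \<in> fock n \<Longrightarrow>
    survive e j (\<lambda>k. a * \<phi> k + b * \<psi> k) = (\<lambda>k. a * survive e j \<phi> k + b * survive e j \<psi> k)"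
  by (induction j) (simp_all add: reject_lincomb[OF e(1)] survive_fock)

lemma survive_adj_lincomb:
  "\<phi> \<in> fock n \<Longrightarrow> \<psi> \<in> fock n \<Longrightarrow>
    survive_adj e j (\<lambda>k. a * \<phi> k + b * \<psi> k) =
      (\<lambda>k. a * survive_adj e j \<phi> k + b * survive_adj e j \<psi> k)"
  by (induction j arbitrary: \<phi> \<psi>) (simp_all add: reject_lincomb[OF e(1)] reject_fock[OF e(1)])

lemma braket_survive:
  "\<phi> \<in> fock n \<Longrightarrow> \<psi> \<in> fock n \<Longrightarrow> braket (survive e j \<phi>) \<psi> = braket \<phi> (survive_adj e j \<psi>)"
proof (induction j arbitrary: \<psi>)
  case (Suc j)
  then show ?case
    using braket_reject_left[OF e(1) survive_fock[OF Suc.prems(1)] Suc.prems(2)]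
    by (simp add: reject_fock[OF e(1)])
qed simp

lemma ket_norm_reject_le: "\<psi> \<in> fock n \<Longrightarrow> ket_norm (reject (e j) \<psi>) \<le> ket_norm \<psi>"
  by (rule power2_le_imp_le) (simp_all add: ket_norm_reject[OF e])

lemma ket_norm_pure_state_le:
  assumes "\<psi> \<in> fock n"
  shows "ket_norm (pure_state (e j) \<psi>) \<le> ket_norm \<psi>"
proof -
  have 1: "ket_norm (e j) \<le> 1" using e(2)[of j] by auto
  have "ket_norm (pure_state (e j) \<psi>) = cmod (braket (e j) \<psi>) * ket_norm (e j)"
    unfolding pure_state_def by (rule ket_norm_scale)
  also have "\<dots> \<le> (ket_norm (e j) * ket_norm \<psi>) * ket_norm (e j)"
    by (intro mult_right_mono Cauchy_Schwarz_braket[OF e(1) assms]) simp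
  also have "\<dots> \<le> (1 * ket_norm \<psi>) * 1"
    by (intro mult_mono 1) auto
  finally show ?thesis by simp
qed

lemma ket_norm_survive_le: "\<psi> \<in> fock n \<Longrightarrow> ket_norm (survive e j \<psi>) \<le> ket_norm \<psi>"
proof (induction j)
  case (Suc j)
  then show ?case using ket_norm_reject_le[OF survive_fock, of \<psi> j j] by simp
qed simp

lemma ket_norm_survive_adj_le: "\<psi> \<in> fock n \<Longrightarrow> ket_norm (survive_adj e j \<psi>) \<le> ket_norm \<psi>"
proof (induction j arbitrary: \<psi>)
  case (Suc j)
  then show ?case using ket_norm_reject_le[of \<psi> j] Suc.IH[OF reject_fock[OF e(1), of \<psi> j]] by simp
qed simp

text \<open>A projective rejection lowers the squared norm by exactly the squared amplitude of
  acceptance, so the acceptance probabilities telescope.\<close>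

lemma sum_survive_power2:
  assumes "\<psi> \<in> fock n"
  shows "(\<Sum>i<j. (cmod (braket (e i) (survive e i \<psi>)))\<^sup>2) = (ket_norm \<psi>)\<^sup>2 - (ket_norm (survive e j \<psi>))\<^sup>2"
  by (induction j) (simp_all add: ket_norm_reject[OF e survive_fock[OF assms]])

lemma braket_survive_telescope:
  assumes "\<psi> \<in> fock n"
  shows "braket \<psi> \<psi> - braket \<psi> (survive e j \<psi>) =
    (\<Sum>i<j. braket (e i) (survive e i \<psi>) * braket \<psi> (e i))"
proof (induction j)
  case (Suc j)
  then show ?case
    using braket_reject[OF e(1) assms survive_fock[OF assms], of j j] by (simp add: algebra_simps)
qed simp

text \<open>The gentle-measurement estimate behind sequential decoding: by Cauchy--Schwarz, a vector
  almost orthogonal to all earlier tests (jointly) almost survives them.\<close>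

lemma survive_overlap:
  assumes "\<psi> \<in> fock n"
  shows "cmod (braket \<psi> \<psi> - braket \<psi> (survive e j \<psi>)) \<le>
    sqrt (\<Sum>i<j. (cmod (braket (e i) \<psi>))\<^sup>2) * ket_norm \<psi>"
proof -
  have "cmod (braket \<psi> \<psi> - braket \<psi> (survive e j \<psi>)) \<le>
      (\<Sum>i<j. cmod (braket (e i) (survive e i \<psi>)) * cmod (braket (e i) \<psi>))"
    unfolding braket_survive_telescope[OF assms]
    by (intro sum_norm_le) (simp add: norm_mult flip: braket_cnj[of "e _" \<psi>])
  also have "\<dots> \<le> L2_set (\<lambda>i. cmod (braket (e i) (survive e i \<psi>))) {..<j} *
      L2_set (\<lambda>i. cmod (braket (e i) \<psi>)) {..<j}"
    using L2_set_mult_ineq[of "\<lambda>i. cmod (braket (e i) (survive e i \<psi>))" "\<lambda>i. cmod (braket (e i) \<psi>)" "{..<j}"]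
    by simp
  also have "\<dots> \<le> ket_norm \<psi> * L2_set (\<lambda>i. cmod (braket (e i) \<psi>)) {..<j}"
    unfolding L2_set_def sum_survive_power2[OF assms]
    by (intro mult_right_mono) (auto intro: real_le_lsqrt sum_nonneg)
  finally show ?thesis by (simp add: L2_set_def mult.commute)
qed

text \<open>The overlaps with the earlier tests are under control not for the sent
  \<open>\<phi>\<close> but for a nearby \<open>\<psi>\<close>, so the estimate is made for
  \<open>\<psi>\<close>. Their distance enters three times: in the norm of \<open>\<psi>\<close>, in
  the rejection by test \<open>j\<close>, and when the accepted amplitude is carried back to
  \<open>\<phi>\<close>.\<close>

lemma detect_amplitude:
  assumes "\<phi> \<in> fock n" "\<psi> \<in> fock n" "ket_norm \<phi> = 1"
  shows "cmod (braket (e j) (survive e j \<phi>)) \<ge>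
    1 - 3 * ket_norm (\<lambda>k. \<phi> k - \<psi> k) - sqrt (\<Sum>i<j. (cmod (braket (e i) \<psi>))\<^sup>2) - ket_norm (reject (e j) \<phi>)"
proof -
  define \<delta> where "\<delta> = ket_norm (\<lambda>k. \<phi> k - \<psi> k)"
  define T where "T = sqrt (\<Sum>i<j. (cmod (braket (e i) \<psi>))\<^sup>2)"
  define \<theta> where "\<theta> = survive e j \<psi>"
  define a where "a = cmod (braket (e j) \<theta>)"
  have \<theta>: "\<theta> \<in> fock n" "ket_norm \<theta> \<le> ket_norm \<psi>"
    unfolding \<theta>_def using assms by (auto intro: survive_fock ket_norm_survive_le)
  have d: "(\<lambda>k. \<phi> k - \<psi> k) \<in> fock n" "(\<lambda>k. \<psi> k - \<phi> k) \<in> fock n"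
    using assms by (auto intro: fock_diff)
  have e1: "ket_norm (e j) \<le> 1" using e(2)[of j] by auto
  have T0: "0 \<le> T" unfolding T_def by (simp add: sum_nonneg)
  have \<psi>: "ket_norm \<psi> \<ge> 1 - \<delta>"
    using ket_norm_triangle_diff[OF assms(1,2)] assms(3) by (simp add: \<delta>_def)
  have \<kappa>: "ket_norm (reject (e j) \<psi>) \<le> ket_norm (reject (e j) \<phi>) + \<delta>"
  proof -
    have "reject (e j) (\<lambda>k. \<psi> k - \<phi> k) = (\<lambda>k. reject (e j) \<psi> k - reject (e j) \<phi> k)"
      using reject_lincomb[OF e(1)[of j] assms(2,1), of 1 "-1"] by simp
    then have "ket_norm (reject (e j) \<psi>) \<le>
        ket_norm (reject (e j) (\<lambda>k. \<psi> k - \<phi> k)) + ket_norm (reject (e j) \<phi>)"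
      using ket_norm_triangle_diff[OF reject_fock[OF e(1) assms(2)] reject_fock[OF e(1) assms(1)]] by simp
    also have "ket_norm (reject (e j) (\<lambda>k. \<psi> k - \<phi> k)) \<le> \<delta>"
      using ket_norm_reject_le[OF d(2)] by (simp add: \<delta>_def ket_norm_minus_commute[of \<phi>])
    finally show ?thesis by simp
  qed
  have "(ket_norm \<psi>)\<^sup>2 = cmod (braket \<psi> \<psi>)" by (simp add: braket_self norm_power)
  \<comment> \<open>The vector \<open>\<theta>\<close> is inserted and the identity then split into
    |e><e| and its complement. The three terms are the loss in earlier tests, the rejection by test
    \<open>j\<close> and the acceptance by it.\<close>
  also have "braket \<psi> \<psi> = (braket \<psi> \<psi> - braket \<psi> \<theta>) + braket (reject (e j) \<psi>) \<theta> + braket (e j) \<theta> * braket \<psi> (e j)"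
    by (simp add: braket_reject_left[OF e(1) assms(2) \<theta>(1)] braket_reject[OF e(1) assms(2) \<theta>(1)])
  also have "cmod \<dots> \<le> cmod (braket \<psi> \<psi> - braket \<psi> \<theta>) + cmod (braket (reject (e j) \<psi>) \<theta>) + cmod (braket (e j) \<theta> * braket \<psi> (e j))"
    by (intro norm_triangle_mono norm_triangle_ineq order_refl)
  also have "cmod (braket \<psi> \<psi> - braket \<psi> \<theta>) \<le> T * ket_norm \<psi>"
    using survive_overlap[OF assms(2), of j] by (simp add: \<theta>_def T_def)
  also have "cmod (braket (reject (e j) \<psi>) \<theta>) \<le> (ket_norm (reject (e j) \<phi>) + \<delta>) * ket_norm \<psi>"
    by (rule order_trans[OF Cauchy_Schwarz_braket[OF reject_fock[OF e(1) assms(2)] \<theta>(1)] mult_mono])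
       (use \<theta>(2) \<kappa> in \<open>auto simp: \<delta>_def\<close>)
  also have "cmod (braket (e j) \<theta> * braket \<psi> (e j)) \<le> a * ket_norm \<psi>"
    using Cauchy_Schwarz_braket[OF assms(2) e(1), of j] mult_left_mono[OF e1 ket_norm_nonneg[of \<psi>]]
    by (auto simp: a_def norm_mult intro!: mult_left_mono)
  finally have *: "ket_norm \<psi> * ket_norm \<psi> \<le> (T + (ket_norm (reject (e j) \<phi>) + \<delta>) + a) * ket_norm \<psi>"
    by (simp add: power2_eq_square algebra_simps)
  have "0 \<le> a" "0 \<le> \<delta>" by (simp_all add: a_def \<delta>_def)
  have "ket_norm \<psi> \<le> T + (ket_norm (reject (e j) \<phi>) + \<delta>) + a"
  proof (cases "ket_norm \<psi> = 0")
    case True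
    then show ?thesis using \<open>0 \<le> a\<close> \<open>0 \<le> \<delta>\<close> T0 by simp
  next
    case False
    then have "ket_norm \<psi> > 0" using ket_norm_nonneg[of \<psi>] by linarith
    with * show ?thesis by simp
  qed
  moreover have "a \<le> cmod (braket (e j) (survive e j \<phi>)) + \<delta>"
  proof -
    have "survive e j (\<lambda>k. \<psi> k - \<phi> k) = (\<lambda>k. \<theta> k - survive e j \<phi> k)"
      using survive_lincomb[OF assms(2,1), of j 1 "-1"] by (simp add: \<theta>_def)
    then have "braket (e j) \<theta> = braket (e j) (survive e j (\<lambda>k. \<psi> k - \<phi> k)) + braket (e j) (survive e j \<phi>)"
      by (simp add: braket_diff_right[OF e(1) \<theta>(1) survive_fock[OF assms(1)]])
    moreover have "cmod (braket (e j) (survive e j (\<lambda>k. \<psi> k - \<phi> k))) \<le> 1 * \<delta>"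
      using ket_norm_survive_le[OF d(2), of j] e1
      by (intro order_trans[OF Cauchy_Schwarz_braket[OF e(1) survive_fock[OF d(2)]] mult_mono])
         (auto simp: \<delta>_def ket_norm_minus_commute[of \<phi>])
    ultimately show ?thesis
      unfolding a_def using norm_triangle_ineq by (smt (verit))
  qed
  ultimately show ?thesis using \<psi> unfolding \<delta>_def[symmetric] T_def[symmetric] by linarith
qed

text \<open>The effect of the event that the tests before \<open>j\<close> reject and test
  \<open>j\<close> accepts.\<close>

definition test_op :: "nat \<Rightarrow> operator" where
  "test_op j \<psi> = survive_adj e j (pure_state (e j) (survive e j \<psi>))"

lemma test_op_fock: "\<psi> \<in> fock n \<Longrightarrow> test_op j \<psi> \<in> fock n"
  unfolding test_op_def by (intro survive_adj_fock pure_state_fock e)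

lemma test_op_lincomb:
  "\<phi> \<in> fock n \<Longrightarrow> \<psi> \<in> fock n \<Longrightarrow>
    test_op j (\<lambda>k. a * \<phi> k + b * \<psi> k) = (\<lambda>k. a * test_op j \<phi> k + b * test_op j \<psi> k)"
  unfolding test_op_def
  by (simp add: survive_lincomb survive_adj_lincomb pure_state_lincomb[OF e(1)] survive_fock
      pure_state_fock[OF e(1)])

lemma ket_norm_test_op_le:
  assumes "\<psi> \<in> fock n" shows "ket_norm (test_op j \<psi>) \<le> ket_norm \<psi>"
  unfolding test_op_def
  using ket_norm_survive_adj_le[OF pure_state_fock[OF e(1)], of j j "survive e j \<psi>"]
    ket_norm_pure_state_le[OF survive_fock[OF assms], of j j] ket_norm_survive_le[OF assms, of j]
  by linarith

lemma braket_test_op: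
  assumes "\<psi> \<in> fock n"
  shows "braket \<psi> (test_op j \<psi>) = of_real ((cmod (braket (e j) (survive e j \<psi>)))\<^sup>2)"
  unfolding test_op_def complex_norm_square
  using braket_survive[OF assms pure_state_fock[OF e(1)], of j j "survive e j \<psi>"]
  by (simp add: braket_pure_state braket_cnj)

text \<open>\<open>pure_state e\<close> and \<open>reject e\<close> are complementary projections,
  so what has survived \<open>M\<close> tests splits into acceptance by test \<open>M\<close> and
  survival of one more test.\<close>

lemma sum_test_op:
  assumes "\<psi> \<in> fock n"
  shows "(\<lambda>k. (\<Sum>j<M. test_op j \<psi> k) + survive_adj e M (survive e M \<psi>) k) = \<psi>"
proof (induction M)
  case (Suc M)
  let ?\<theta> = "survive e M \<psi>"
  have \<theta>: "?\<theta> \<in> fock n" using assms by (rule survive_fock)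
  have "survive_adj e M ?\<theta> = survive_adj e M (\<lambda>k. 1 * pure_state (e M) ?\<theta> k + 1 * reject (e M) ?\<theta> k)"
    by (simp add: reject_def)
  also have "\<dots> = (\<lambda>k. test_op M \<psi> k + survive_adj e M (reject (e M) ?\<theta>) k)"
    by (subst survive_adj_lincomb) (auto simp: test_op_def intro: pure_state_fock reject_fock e \<theta>)
  finally have "survive_adj e M ?\<theta> k = test_op M \<psi> k + survive_adj e M (reject (e M) ?\<theta>) k" for k
    by (simp add: fun_eq_iff)
  then show ?case
    using Suc by (simp add: reject_reject[OF e \<theta>] add.assoc)
qed simp

end

lemma bounded_op_I:
  assumes "\<And>\<psi>. \<psi> \<in> fock n \<Longrightarrow> T \<psi> \<in> fock n"
    and "\<And>\<phi> \<psi> a b. \<phi> \<in> fock n \<Longrightarrow> \<psi> \<in> fock n \<Longrightarrow>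
      T (\<lambda>k. a * \<phi> k + b * \<psi> k) = (\<lambda>k. a * T \<phi> k + b * T \<psi> k)"
    and "\<And>\<psi>. \<psi> \<in> fock n \<Longrightarrow> ket_norm (T \<psi>) \<le> C * ket_norm \<psi>"
  shows "bounded_op n T"
  unfolding bounded_op_def using assms by blast

text \<open>The tests \<open>s\<close> come unnormalised, and \<open>\<psi>\<close> stands for the
  smoothed states. The coefficients 6, 4, 4 are twice those of the amplitude bound 3, 2, 2, since 1
  - a^2 <= 2 (1 - a).\<close>

lemma sequential_decoder:
  fixes s \<phi> \<psi> :: "nat \<Rightarrow> ket"
  assumes M: "M \<ge> 1"
    and s: "\<And>j. s j \<in> fock n" and \<phi>: "\<And>j. \<phi> j \<in> fock n" "\<And>j. ket_norm (\<phi> j) = 1"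
    and \<psi>: "\<And>j. \<psi> j \<in> fock n"
  obtains \<Lambda> where "is_povm n {..<M} \<Lambda>"
    and "\<And>j. j < M \<Longrightarrow> 1 - Re (braket (\<phi> j) (\<Lambda> j (\<phi> j))) \<le>
      6 * ket_norm (\<lambda>k. \<phi> j k - \<psi> j k) + 4 * ket_norm (\<lambda>k. \<phi> j k - s j k) +
      4 * sqrt (\<Sum>i\<in>{..<M} - {j}. (cmod (braket (s i) (\<psi> j)))\<^sup>2)"
proof -
  \<comment> \<open>From norm 1/2 on, normalising enlarges amplitudes by at most 2. Below it the
    test is dropped, which is affordable because \<open>s j\<close> is then at distance more than
    1/2 from the unit vector \<open>\<phi> j\<close>.\<close>
  define e where "e j = (if ket_norm (s j) < 1/2 then (\<lambda>k. 0) else (\<lambda>k. of_real (1 / ket_norm (s j)) * s j k))" for j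
  have e: "e j \<in> fock n" "ket_norm (e j) \<in> {0, 1}" for j
  proof -
    show "e j \<in> fock n" unfolding e_def by (auto simp del: of_real_divide intro: fock_scale s fock_zero)
    show "ket_norm (e j) \<in> {0, 1}"
    proof (cases "ket_norm (s j) < 1/2")
      case False
      then have "ket_norm (s j) > 0" by linarith
      then have "ket_norm (e j) = 1"
        unfolding e_def using False ket_norm_scale[of "of_real (1 / ket_norm (s j))" "s j"]
        by (simp add: norm_divide)
      then show ?thesis by simp
    qed (simp add: e_def)
  qed
  define rest where "rest \<psi> = survive_adj e M (survive e M \<psi>)" for \<psi>
  have rest: "rest \<xi> \<in> fock n" "ket_norm (rest \<xi>) \<le> ket_norm \<xi>"
    "braket \<xi> (rest \<xi>) = of_real ((ket_norm (survive e M \<xi>))\<^sup>2)" if "\<xi> \<in> fock n" for \<xi>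
  proof -
    note f = survive_fock[of e n, OF e that, of M]
    show "rest \<xi> \<in> fock n" unfolding rest_def by (intro survive_adj_fock[of e n] e f)
    show "ket_norm (rest \<xi>) \<le> ket_norm \<xi>"
      unfolding rest_def
      using ket_norm_survive_adj_le[of e n, OF e f, of M] ket_norm_survive_le[of e n, OF e that, of M] by linarith
    show "braket \<xi> (rest \<xi>) = of_real ((ket_norm (survive e M \<xi>))\<^sup>2)"
      unfolding rest_def braket_self[symmetric] using braket_survive[of e n, OF e that f, of M] by simp
  qed
  have rest_lin: "rest (\<lambda>k. a * \<xi> k + b * \<zeta> k) = (\<lambda>k. a * rest \<xi> k + b * rest \<zeta> k)"
    if "\<xi> \<in> fock n" "\<zeta> \<in> fock n" for \<xi> \<zeta> a b
    unfolding rest_def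
    by (simp add: survive_lincomb[of e n, OF e that]
        survive_adj_lincomb[of e n, OF e survive_fock[of e n, OF e that(1)] survive_fock[of e n, OF e that(2)]])
  \<comment> \<open>The outcomes have to be messages, so the event that no test accepts is given to
    message 0; this can only raise the success probability of that message.\<close>
  define \<Lambda> where "\<Lambda> j \<psi> = (\<lambda>k. test_op e j \<psi> k + (if j = 0 then 1 else 0) * rest \<psi> k)" for j :: nat and \<psi>
  have t: "test_op e j \<xi> \<in> fock n" if "\<xi> \<in> fock n" for \<xi> j
    using test_op_fock[of e n, OF e that] .
  have \<Lambda>_braket: "braket \<xi> (\<Lambda> j \<xi>) = of_real ((cmod (braket (e j) (survive e j \<xi>)))\<^sup>2 +
      (if j = 0 then 1 else 0) * (ket_norm (survive e M \<xi>))\<^sup>2)" if "\<xi> \<in> fock n" for j \<xi>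
    unfolding \<Lambda>_def using braket_lincomb_right[OF that t[OF that] rest(1)[OF that], of 1 j "if j = 0 then 1 else 0"]
    by (auto simp: braket_test_op[of e n, OF e that] rest(3)[OF that])
  show thesis
  proof (rule that[of \<Lambda>])
    show "is_povm n {..<M} \<Lambda>"
      unfolding is_povm_def
    proof (intro conjI ballI)
      fix j
      have "bounded_op n (\<Lambda> j)"
      proof (rule bounded_op_I[where C=2])
        fix \<xi> assume \<xi>: "\<xi> \<in> fock n"
        have f: "(\<lambda>k. (if j = 0 then 1 else 0) * rest \<xi> k) \<in> fock n" by (intro fock_scale rest \<xi>)
        show "\<Lambda> j \<xi> \<in> fock n" unfolding \<Lambda>_def by (intro fock_add t \<xi> f)
        have "ket_norm (\<lambda>k. (if j = 0 then 1 else 0) * rest \<xi> k) \<le> ket_norm \<xi>"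
          using rest(2)[OF \<xi>] by auto
        then show "ket_norm (\<Lambda> j \<xi>) \<le> 2 * ket_norm \<xi>"
          unfolding \<Lambda>_def using ket_norm_triangle[OF t[OF \<xi>] f, of j] ket_norm_test_op_le[of e n, OF e \<xi>, of j]
          by linarith
        fix \<zeta> a b assume \<zeta>: "\<zeta> \<in> fock n"
        show "\<Lambda> j (\<lambda>k. a * \<xi> k + b * \<zeta> k) = (\<lambda>k. a * \<Lambda> j \<xi> k + b * \<Lambda> j \<zeta> k)"
          unfolding \<Lambda>_def by (simp add: test_op_lincomb[of e n, OF e \<xi> \<zeta>] rest_lin[OF \<xi> \<zeta>] algebra_simps)
      qed
      moreover have "braket \<xi> (\<Lambda> j \<xi>) \<in> \<real>\<^sub>\<ge>\<^sub>0" if "\<xi> \<in> fock n" for \<xi>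
        unfolding \<Lambda>_braket[OF that] nonneg_Reals_of_real_iff by simp
      ultimately show "positive_op n (\<Lambda> j)" unfolding positive_op_def by blast
    next
      fix \<xi> assume \<xi>: "\<xi> \<in> fock n"
      have "(\<Sum>j<M. (if j = 0 then 1 else 0) * rest \<xi> k) = rest \<xi> k" for k
      proof -
        have "(\<Sum>j<M. (if j = 0 then 1 else 0) * rest \<xi> k) = (\<Sum>j<M. if j = 0 then rest \<xi> k else 0)"
          by (intro sum.cong) auto
        then show ?thesis using M by simp
      qed
      then show "(\<lambda>k. \<Sum>i<M. \<Lambda> i \<xi> k) = \<xi>"
        unfolding \<Lambda>_def sum.distrib
        using sum_test_op[of e n, OF e \<xi>, of M] by (simp add: rest_def)
    qed simp
  next
    fix j assume "j < M"
    define \<delta> where "\<delta> = ket_norm (\<lambda>k. \<phi> j k - \<psi> j k)"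
    define \<eta> where "\<eta> = ket_norm (\<lambda>k. \<phi> j k - s j k)"
    define \<tau> where "\<tau> = (\<Sum>i\<in>{..<M} - {j}. (cmod (braket (s i) (\<psi> j)))\<^sup>2)"
    define a where "a = cmod (braket (e j) (survive e j (\<phi> j)))"
    have "(\<Sum>i<j. (cmod (braket (e i) (\<psi> j)))\<^sup>2) \<le> (\<Sum>i<j. 4 * (cmod (braket (s i) (\<psi> j)))\<^sup>2)"
    proof (rule sum_mono)
      fix i
      show "(cmod (braket (e i) (\<psi> j)))\<^sup>2 \<le> 4 * (cmod (braket (s i) (\<psi> j)))\<^sup>2"
      proof (cases "ket_norm (s i) < 1/2")
        case False
        then have "1 / ket_norm (s i) \<le> 2" "1 / ket_norm (s i) \<ge> 0" by (auto simp: field_simps)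
        then have "(1 / ket_norm (s i))\<^sup>2 \<le> 2\<^sup>2" by (intro power_mono)
        moreover have "(cmod (braket (e i) (\<psi> j)))\<^sup>2 = (1 / ket_norm (s i))\<^sup>2 * (cmod (braket (s i) (\<psi> j)))\<^sup>2"
          unfolding e_def using False
          by (simp add: braket_scale_left norm_mult norm_divide power_mult_distrib power_divide del: of_real_divide)
        ultimately show ?thesis by (simp add: mult_right_mono)
      qed (simp add: e_def)
    qed
    also have "\<dots> \<le> 4 * \<tau>"
      unfolding \<tau>_def sum_distrib_left[symmetric] using \<open>j < M\<close>
      by (intro mult_left_mono sum_mono2) auto
    finally have T: "sqrt (\<Sum>i<j. (cmod (braket (e i) (\<psi> j)))\<^sup>2) \<le> 2 * sqrt \<tau>"
      using real_sqrt_le_mono real_sqrt_mult[of 4 \<tau>] by fastforce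
    have "ket_norm (reject (e j) (\<phi> j)) \<le> 2 * \<eta>"
    proof (cases "ket_norm (s j) < 1/2")
      case True
      then have "reject (e j) (\<phi> j) = \<phi> j" by (simp add: e_def reject_def pure_state_def)
      moreover have "1 \<le> \<eta> + ket_norm (s j)"
        using ket_norm_triangle_diff[OF \<phi>(1) s, of j j] \<phi>(2)[of j] by (simp add: \<eta>_def)
      ultimately show ?thesis using True \<phi>(2)[of j] by simp
    next
      case False
      define c where "c = complex_of_real (ket_norm (s j))"
      have "c \<noteq> 0" using False by (auto simp: c_def)
      then have sj: "s j = (\<lambda>k. c * e j k)" using False by (simp add: e_def c_def)
      have "ket_norm (e j) \<noteq> 0" using sj ket_norm_scale[of c "e j"] False by auto
      then have ej: "ket_norm (e j) = 1" using e(2)[of j] by simp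
      \<comment> \<open>Rejection leaves the distance of \<open>\<phi> j\<close> from the line
        through \<open>e j\<close>, and \<open>s j\<close> lies on this line.\<close>
      define z where "z = braket (e j) (\<phi> j)"
      have "0 \<le> (cmod (z - c))\<^sup>2" by simp
      also have "\<dots> = (cmod z)\<^sup>2 - 2 * Re (cnj c * z) + (cmod c)\<^sup>2"
        unfolding cmod_power2 by (simp add: algebra_simps power2_eq_square)
      finally have "(ket_norm (reject (e j) (\<phi> j)))\<^sup>2 \<le> \<eta>\<^sup>2"
        unfolding \<eta>_def sj using ket_norm_reject[OF e \<phi>(1), of j j] ket_norm_lincomb_power2[OF \<phi>(1) e(1), of j c j]
        by (simp add: ej z_def)
      then have "ket_norm (reject (e j) (\<phi> j)) \<le> \<eta>" by (rule power2_le_imp_le) (simp add: \<eta>_def)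
      moreover have "0 \<le> \<eta>" by (simp add: \<eta>_def)
      ultimately show ?thesis by linarith
    qed
    then have a: "a \<ge> 1 - 3 * \<delta> - 2 * sqrt \<tau> - 2 * \<eta>"
      using detect_amplitude[of e n, OF e \<phi>(1) \<psi> \<phi>(2), of j j j] T unfolding a_def \<delta>_def by linarith
    have "Re (braket (\<phi> j) (\<Lambda> j (\<phi> j))) \<ge> a\<^sup>2"
      unfolding \<Lambda>_braket[OF \<phi>(1)] a_def by simp
    moreover have "a\<^sup>2 \<ge> 2 * a - 1" using zero_le_power2[of "a - 1"] by (simp add: power2_eq_square algebra_simps)
    ultimately show "1 - Re (braket (\<phi> j) (\<Lambda> j (\<phi> j))) \<le> 6 * \<delta> + 4 * \<eta> + 4 * sqrt \<tau>"
      using a by linarith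
  qed
qed

section \<open>Spectral decomposition and trace norm of finite-rank operators\<close>

text \<open>Linear dependence is taken in the space of all kets; the spectral argument works with
  finite spans inside it.\<close>

interpretation ket: vector_space "\<lambda>(c::complex) (\<psi>::ket) k. c * \<psi> k"
  by unfold_locales (auto simp: fun_eq_iff algebra_simps)

lemma sum_fun_eq: "(\<Sum>i\<in>I. f i) = (\<lambda>k. \<Sum>i\<in>I. f i k)"
  by (induction I rule: infinite_finite_induct) (auto simp: fun_eq_iff)

locale symmetric_op =
  fixes n :: nat and T :: operator
  assumes fock: "\<psi> \<in> fock n \<Longrightarrow> T \<psi> \<in> fock n"
    and lincomb: "\<phi> \<in> fock n \<Longrightarrow> \<psi> \<in> fock n \<Longrightarrow>
      T (\<lambda>k. a * \<phi> k + b * \<psi> k) = (\<lambda>k. a * T \<phi> k + b * T \<psi> k)"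
    and symmetric: "\<phi> \<in> fock n \<Longrightarrow> \<psi> \<in> fock n \<Longrightarrow> braket (T \<phi>) \<psi> = braket \<phi> (T \<psi>)"
begin

lemma zero: "T (\<lambda>k. 0) = (\<lambda>k. 0)"
  using lincomb[OF fock_zero fock_zero, of 0 0] by simp

lemma scale: "\<psi> \<in> fock n \<Longrightarrow> T (\<lambda>k. a * \<psi> k) = (\<lambda>k. a * T \<psi> k)"
  using lincomb[of \<psi> \<psi> a 0] by simp

lemma sum:
  "(\<And>i. i \<in> I \<Longrightarrow> v i \<in> fock n) \<Longrightarrow> T (\<lambda>k. \<Sum>i\<in>I. c i * v i k) = (\<lambda>k. \<Sum>i\<in>I. c i * T (v i) k)"
proof (induction I rule: infinite_finite_induct)
  case (insert i I)
  have "(\<lambda>k. \<Sum>i\<in>I. c i * v i k) \<in> fock n" using insert.prems by (intro fock_sum) auto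
  with lincomb[of "v i" "\<lambda>k. \<Sum>i\<in>I. c i * v i k" "c i" 1] insert show ?case by simp
qed (simp_all add: zero)

lemma funpow_fock: "\<psi> \<in> fock n \<Longrightarrow> (T ^^ i) \<psi> \<in> fock n"
  by (induction i) (auto intro: fock)

definition poly_op :: "complex poly \<Rightarrow> ket \<Rightarrow> ket" where
  "poly_op p u = (\<lambda>k. \<Sum>i\<le>degree p. coeff p i * (T ^^ i) u k)"

lemma poly_op_eq:
  assumes "degree p \<le> m"
  shows "poly_op p u k = (\<Sum>i\<le>m. coeff p i * (T ^^ i) u k)"
  unfolding poly_op_def using assms
  by (intro sum.mono_neutral_left) (auto simp: coeff_eq_0)

lemma poly_op_fock: "u \<in> fock n \<Longrightarrow> poly_op p u \<in> fock n"
  unfolding poly_op_def by (intro fock_sum funpow_fock)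

lemma poly_op_linear_factor:
  assumes "u \<in> fock n"
  shows "poly_op ([:-z, 1:] * q) u = (\<lambda>k. T (poly_op q u) k - z * poly_op q u k)"
proof
  fix k
  let ?m = "Suc (degree q)"
  have p: "[:-z, 1:] * q = pCons 0 q - smult z q" by simp
  have "degree ([:-z, 1:] * q) \<le> ?m"
    using degree_mult_le[of "[:-z, 1:]" q] by simp
  then have "poly_op ([:-z, 1:] * q) u k = (\<Sum>i\<le>?m. coeff ([:-z, 1:] * q) i * (T ^^ i) u k)"
    by (rule poly_op_eq)
  also have "\<dots> = (\<Sum>i\<le>?m. coeff (pCons 0 q) i * (T ^^ i) u k) - z * (\<Sum>i\<le>?m. coeff q i * (T ^^ i) u k)"
    unfolding p by (simp only: coeff_diff coeff_smult left_diff_distrib sum_subtractf sum_distrib_left mult.assoc)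
  also have "(\<Sum>i\<le>?m. coeff q i * (T ^^ i) u k) = poly_op q u k"
    by (rule poly_op_eq[symmetric]) simp
  also have "(\<Sum>i\<le>?m. coeff (pCons 0 q) i * (T ^^ i) u k) = (\<Sum>i\<le>degree q. coeff q i * T ((T ^^ i) u) k)"
    by (subst sum.atMost_Suc_shift) simp
  also have "\<dots> = T (poly_op q u) k"
    unfolding poly_op_def by (simp add: sum[OF funpow_fock[OF assms]])
  finally show "poly_op ([:-z, 1:] * q) u k = T (poly_op q u) k - z * poly_op q u k" .
qed

text \<open>More Krylov vectors than spanning vectors satisfy a linear relation, which is read as a
  polynomial. Dependence is a property of sets, so coinciding iterates get a polynomial of their
  own, a difference of two monomials.\<close>

lemma annihilating_poly:
  assumes "u \<in> fock n" "finite W" "\<And>i. (T ^^ i) u \<in> ket.span W"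
  shows "\<exists>p. p \<noteq> 0 \<and> poly_op p u = (\<lambda>k. 0)"
proof (cases "inj_on (\<lambda>i. (T ^^ i) u) {..card W}")
  case False
  then obtain i j where ij: "i \<noteq> j" "(T ^^ i) u = (T ^^ j) u" unfolding inj_on_def by blast
  define p :: "complex poly" where "p = monom 1 i - monom 1 j"
  have "coeff p i \<noteq> 0" using ij by (simp add: p_def)
  then have "p \<noteq> 0" by auto
  moreover have "poly_op p u k = 0" for k
  proof -
    have "degree p \<le> max i j"
      unfolding p_def by (intro degree_diff_le) (auto simp: degree_monom_eq)
    then have "poly_op p u k = (\<Sum>l\<le>max i j. coeff p l * (T ^^ l) u k)" by (rule poly_op_eq)
    also have "\<dots> = (\<Sum>l\<le>max i j. (if l = i then (T ^^ l) u k else 0) - (if l = j then (T ^^ l) u k else 0))"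
      by (intro sum.cong) (auto simp: p_def)
    also have "\<dots> = 0" using ij(2) by (simp add: sum_subtractf)
    finally show ?thesis .
  qed
  ultimately show ?thesis by blast
next
  case True
  define S where "S = (\<lambda>i. (T ^^ i) u) ` {..card W}"
  have "card S = Suc (card W)" unfolding S_def by (simp add: card_image[OF True])
  moreover have "S \<subseteq> ket.span W" using assms(3) by (auto simp: S_def)
  ultimately have "ket.dependent S" using ket.independent_span_bound[OF assms(2), of S] by auto
  then obtain c v where c: "v \<in> S" "c v \<noteq> 0" "(\<Sum>v\<in>S. (\<lambda>k. c v * v k)) = 0"
    using ket.dependent_finite[of S] by (auto simp: S_def)
  define p where "p = (\<Sum>i\<le>card W. monom (c ((T ^^ i) u)) i)"
  have coeff: "coeff p i = (if i \<le> card W then c ((T ^^ i) u) else 0)" for i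
    by (simp add: p_def coeff_sum)
  have "p \<noteq> 0"
  proof
    assume "p = 0"
    then have "c ((T ^^ i) u) = 0" if "i \<le> card W" for i using coeff[of i] that by simp
    with c(1,2) show False by (auto simp: S_def)
  qed
  moreover have "poly_op p u k = 0" for k
  proof -
    have "degree p \<le> card W" by (rule degree_le) (simp add: coeff)
    then have "poly_op p u k = (\<Sum>i\<le>card W. c ((T ^^ i) u) * (T ^^ i) u k)"
      by (subst poly_op_eq) (auto simp: coeff)
    also have "\<dots> = (\<Sum>v\<in>S. c v * v k)" unfolding S_def by (simp add: sum.reindex[OF True])
    also have "\<dots> = (\<Sum>v\<in>S. (\<lambda>k. c v * v k)) k" by (simp add: sum_fun_eq)
    finally show ?thesis by (simp add: c(3))
  qed
  ultimately show ?thesis by blast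
qed

text \<open>Split a root \<open>z\<close> off an annihilating polynomial of least degree. By
  minimality the cofactor does not annihilate \<open>u\<close>, and what it yields is killed by T -
  z.\<close>

lemma krylov_eigenvector:
  assumes "u \<in> fock n" "u \<noteq> (\<lambda>k. 0)" "finite W" "\<And>i. (T ^^ i) u \<in> ket.span W"
  obtains q z where "poly_op q u \<noteq> (\<lambda>k. 0)" "T (poly_op q u) = (\<lambda>k. z * poly_op q u k)"
proof -
  define p where "p = arg_min degree (\<lambda>p. p \<noteq> 0 \<and> poly_op p u = (\<lambda>k. 0))"
  have p: "p \<noteq> 0" "poly_op p u = (\<lambda>k. 0)"
    and min: "\<And>q. degree q < degree p \<Longrightarrow> \<not> (q \<noteq> 0 \<and> poly_op q u = (\<lambda>k. 0))"
    using arg_min_natI[of "\<lambda>p. p \<noteq> 0 \<and> poly_op p u = (\<lambda>k. 0)" _ degree]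
      annihilating_poly[OF assms(1,3,4)] arg_min_nat_le[of "\<lambda>p. p \<noteq> 0 \<and> poly_op p u = (\<lambda>k. 0)" _ degree]
    unfolding p_def by (auto simp: not_less[symmetric])
  have "degree p \<noteq> 0"
  proof
    assume "degree p = 0"
    then have "poly_op p u = (\<lambda>k. coeff p 0 * u k)" "coeff p 0 \<noteq> 0"
      using p(1) by (auto simp: poly_op_def leading_coeff_0_iff[symmetric] simp del: leading_coeff_0_iff)
    with p(2) assms(2) show False by (auto simp: fun_eq_iff)
  qed
  then have "\<not> constant (poly p)" by (simp add: constant_degree)
  then obtain z where "poly p z = 0" using fundamental_theorem_of_algebra by blast
  then obtain q where q: "p = [:-z, 1:] * q" by (auto simp: poly_eq_0_iff_dvd elim: dvdE)
  then have "q \<noteq> 0" using p(1) by auto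
  then have "degree q < degree p" unfolding q by (subst degree_mult_eq) auto
  with min \<open>q \<noteq> 0\<close> have "poly_op q u \<noteq> (\<lambda>k. 0)" by blast
  moreover have "T (poly_op q u) = (\<lambda>k. z * poly_op q u k)"
    using p(2) poly_op_linear_factor[OF assms(1), of z q] unfolding q by (simp add: fun_eq_iff)
  ultimately show thesis by (rule that)
qed

text \<open>The Krylov vectors start at \<open>T \<psi>\<close>, so the eigenvector found lies in
  the range of \<open>T\<close>. If its eigenvalue were 0, symmetry would make it orthogonal to
  itself. Symmetry also makes the eigenvalue real.\<close>

lemma nonzero_eigenvector:
  assumes W: "finite W" "\<And>\<psi>. \<psi> \<in> fock n \<Longrightarrow> T \<psi> \<in> ket.span W"
    and "\<psi> \<in> fock n" "T \<psi> \<noteq> (\<lambda>k. 0)"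
  obtains v l where "v \<in> fock n" "ket_norm v = 1" "l \<noteq> 0" "T v = (\<lambda>k. complex_of_real l * v k)"
proof -
  let ?u = "T \<psi>"
  have u: "?u \<in> fock n" using assms by (simp add: fock)
  have sp: "(T ^^ i) ?u \<in> ket.span W" for i
    using W(2)[OF funpow_fock[OF assms(3)]] by (metis comp_apply funpow_Suc_right funpow.simps(2))
  obtain q z where q: "poly_op q ?u \<noteq> (\<lambda>k. 0)" "T (poly_op q ?u) = (\<lambda>k. z * poly_op q ?u k)"
    using krylov_eigenvector[OF u assms(4) W(1) sp] .
  define \<phi> where "\<phi> = poly_op q ?u"
  have \<phi>: "\<phi> \<in> fock n" "T \<phi> = (\<lambda>k. z * \<phi> k)" using q u by (auto simp: \<phi>_def poly_op_fock)
  define r where "r = ket_norm \<phi>"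
  have r: "r > 0" using ket_norm_eq_0[OF \<phi>(1)] q(1) ket_norm_nonneg[of \<phi>]
    unfolding r_def \<phi>_def[symmetric] by (metis less_eq_real_def)
  have \<phi>T: "\<phi> = T (poly_op q \<psi>)"
  proof -
    have "\<phi> = (\<lambda>k. \<Sum>i\<le>degree q. coeff q i * T ((T ^^ i) \<psi>) k)"
      unfolding \<phi>_def poly_op_def by (simp add: funpow_swap1)
    then show ?thesis unfolding poly_op_def by (simp add: sum[OF funpow_fock[OF assms(3)]])
  qed
  have "cnj z * braket \<phi> \<phi> = z * braket \<phi> \<phi>"
    using symmetric[OF \<phi>(1) \<phi>(1)] unfolding \<phi>(2) by (simp add: braket_scale_left braket_scale_right)
  then have "cnj z = z" using r by (simp add: braket_self r_def)
  then have z: "z = of_real (Re z)" by (metis Reals_cnj_iff of_real_Re)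
  have "Re z \<noteq> 0"
  proof
    assume "Re z = 0"
    then have "T \<phi> = (\<lambda>k. 0)" using \<phi>(2) z by simp
    then have "braket \<phi> \<phi> = 0"
      using symmetric[OF \<phi>(1) poly_op_fock[OF assms(3), of q]] \<phi>T by simp
    with r show False by (simp add: braket_self r_def)
  qed
  define v where "v = (\<lambda>k. of_real (1 / r) * \<phi> k)"
  show thesis
  proof (rule that)
    show "v \<in> fock n" unfolding v_def by (rule fock_scale[OF \<phi>(1)])
    show "ket_norm v = 1"
      unfolding v_def ket_norm_scale using r by (simp add: norm_divide r_def del: of_real_divide)
    show "Re z \<noteq> 0" by fact
    show "T v = (\<lambda>k. complex_of_real (Re z) * v k)"
      unfolding v_def scale[OF \<phi>(1)] \<phi>(2) z[symmetric] by (simp add: mult_ac)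
  qed
qed

end

lemma card_orthonormal_le:
  assumes "orthonormal_kets n {..<m::nat} v" "finite W" "\<And>i. i < m \<Longrightarrow> v i \<in> ket.span W"
  shows "m \<le> card W"
proof -
  have inj: "inj_on v {..<m}"
  proof (rule inj_onI)
    fix i j assume "i \<in> {..<m}" "j \<in> {..<m}" "v i = v j"
    then show "i = j"
      using orthonormal_ketsD(2)[OF assms(1), of i j] orthonormal_ketsD(2)[OF assms(1), of i i] by (auto split: if_splits)
  qed
  have "\<not> ket.dependent (v ` {..<m})"
  proof
    assume "ket.dependent (v ` {..<m})"
    then obtain c where c: "\<exists>w\<in>v ` {..<m}. c w \<noteq> 0" "(\<Sum>w\<in>v ` {..<m}. (\<lambda>k. c w * w k)) = 0"
      by (subst (asm) ket.dependent_finite) auto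
    have "(\<lambda>k. \<Sum>i<m. c (v i) * v i k) = (\<lambda>k. 0)"
      using c(2) by (simp add: sum.reindex[OF inj] sum_fun_eq zero_fun_def)
    then have "c (v i) = 0" if "i < m" for i
      using orthonormal_kets_coefficient[OF assms(1), of i "\<lambda>i. c (v i)"] that by simp
    with c(1) show False by auto
  qed
  then show ?thesis
    using ket.independent_span_bound[OF assms(2), of "v ` {..<m}"] assms(3) card_image[OF inj] by auto
qed

text \<open>Orthogonality of the vectors is not built in: the same form describes a given
  combination of pure states and its spectral decomposition.\<close>

definition diag_op :: "'i set \<Rightarrow> ('i \<Rightarrow> real) \<Rightarrow> ('i \<Rightarrow> ket) \<Rightarrow> operator" where
  "diag_op I l v \<psi> = (\<lambda>k. \<Sum>i\<in>I. (of_real (l i) * braket (v i) \<psi>) * v i k)"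

context
  fixes n :: nat and I :: "'i set" and v :: "'i \<Rightarrow> ket"
  assumes v: "\<And>i. i \<in> I \<Longrightarrow> v i \<in> fock n"
begin

lemma diag_op_fock: "diag_op I l v \<psi> \<in> fock n"
  unfolding diag_op_def by (rule fock_sum) (simp add: v)

lemma diag_op_lincomb:
  assumes "\<phi> \<in> fock n" "\<psi> \<in> fock n"
  shows "diag_op I l v (\<lambda>k. a * \<phi> k + b * \<psi> k) = (\<lambda>k. a * diag_op I l v \<phi> k + b * diag_op I l v \<psi> k)"
proof
  fix k
  have "(\<Sum>i\<in>I. of_real (l i) * braket (v i) (\<lambda>k. a * \<phi> k + b * \<psi> k) * v i k) =
      (\<Sum>i\<in>I. a * (of_real (l i) * braket (v i) \<phi> * v i k) + b * (of_real (l i) * braket (v i) \<psi> * v i k))"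
    by (intro sum.cong) (simp_all add: braket_lincomb_right[OF v assms] algebra_simps)
  then show "diag_op I l v (\<lambda>k. a * \<phi> k + b * \<psi> k) k = a * diag_op I l v \<phi> k + b * diag_op I l v \<psi> k"
    by (simp add: diag_op_def sum.distrib sum_distrib_left)
qed

lemma braket_diag_op:
  "\<phi> \<in> fock n \<Longrightarrow> braket \<phi> (diag_op I l v \<psi>) = (\<Sum>i\<in>I. of_real (l i) * braket (v i) \<psi> * braket \<phi> (v i))"
  unfolding diag_op_def by (rule braket_sum_right[where n=n]) (simp_all add: v)

lemma diag_op_symmetric: "symmetric_op n (diag_op I l v)"
proof
  fix \<phi> \<psi> assume "\<phi> \<in> fock n" "\<psi> \<in> fock n"
  then show "braket (diag_op I l v \<phi>) \<psi> = braket \<phi> (diag_op I l v \<psi>)"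
    using braket_diag_op[of \<phi> l \<psi>] arg_cong[where f=cnj, OF braket_diag_op[of \<psi> l \<phi>]]
    by (simp add: braket_cnj mult_ac)
qed (simp_all add: diag_op_fock diag_op_lincomb)

lemma diag_op_bounded:
  assumes "finite I" "\<And>i. i \<in> I \<Longrightarrow> ket_norm (v i) \<le> 1"
  shows "bounded_op n (diag_op I l v)"
proof (rule bounded_op_I[where C="\<Sum>i\<in>I. \<bar>l i\<bar>"])
  fix \<psi> assume \<psi>: "\<psi> \<in> fock n"
  have "ket_norm (diag_op J l v \<psi>) \<le> (\<Sum>j\<in>J. \<bar>l j\<bar>) * ket_norm \<psi>" if "finite J" "J \<subseteq> I" for J
    using that unfolding diag_op_def
  proof (induction J rule: finite_induct)
    case (insert i J)
    then have i: "i \<in> I" and J: "J \<subseteq> I" by auto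
    let ?f = "\<lambda>k. (of_real (l i) * braket (v i) \<psi>) * v i k"
    let ?g = "\<lambda>k. \<Sum>j\<in>J. (of_real (l j) * braket (v j) \<psi>) * v j k"
    have f: "?f \<in> fock n" "?g \<in> fock n"
      using J v i by (auto intro!: fock_sum intro: fock_scale)
    have "ket_norm ?f = \<bar>l i\<bar> * (cmod (braket (v i) \<psi>) * ket_norm (v i))"
      unfolding ket_norm_scale by (simp add: norm_mult)
    also have "\<dots> \<le> \<bar>l i\<bar> * ((1 * ket_norm \<psi>) * 1)"
      using assms(2)[OF i]
      by (intro mult_left_mono mult_mono order_trans[OF Cauchy_Schwarz_braket[OF v[OF i] \<psi>] mult_right_mono]) auto
    finally have "ket_norm ?f \<le> \<bar>l i\<bar> * ket_norm \<psi>" by simp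
    then have "ket_norm (\<lambda>k. ?f k + ?g k) \<le> \<bar>l i\<bar> * ket_norm \<psi> + (\<Sum>j\<in>J. \<bar>l j\<bar>) * ket_norm \<psi>"
      using insert.IH[OF J] ket_norm_triangle[OF f] by linarith
    then show ?case using insert.hyps by (simp add: distrib_right)
  qed simp
  then show "ket_norm (diag_op I l v \<psi>) \<le> (\<Sum>i\<in>I. \<bar>l i\<bar>) * ket_norm \<psi>" using assms(1) by simp
qed (simp_all add: diag_op_fock diag_op_lincomb)

lemma diag_op_span: "diag_op I l v \<psi> \<in> ket.span (v ` I)"
proof -
  have "diag_op I l v \<psi> = (\<Sum>i\<in>I. (\<lambda>k. (of_real (l i) * braket (v i) \<psi>) * v i k))"
    by (simp add: diag_op_def sum_fun_eq)
  also have "\<dots> \<in> ket.span (v ` I)" by (intro ket.span_sum ket.span_scale ket.span_base) auto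
  finally show ?thesis .
qed

end

lemma ket_norm_orthonormal: "orthonormal_kets n I v \<Longrightarrow> i \<in> I \<Longrightarrow> ket_norm (v i) = 1"
  using orthonormal_ketsD(2)[of n I v i i] ket_norm_nonneg[of "v i"]
  by (auto simp: braket_self power2_eq_1_iff simp flip: of_real_power)

lemma diag_op_orthonormal:
  assumes "orthonormal_kets n I v" "finite I" "i \<in> I"
  shows "diag_op I l v (v i) = (\<lambda>k. of_real (l i) * v i k)"
proof
  fix k
  have "diag_op I l v (v i) k = (\<Sum>j\<in>I. if j = i then of_real (l i) * v i k else 0)"
    unfolding diag_op_def using assms by (intro sum.cong) (auto simp: orthonormal_ketsD(2)[OF assms(1)])
  then show "diag_op I l v (v i) k = of_real (l i) * v i k" using assms by simp
qed

text \<open>A maximal orthonormal family of eigenvectors with nonzero eigenvalues exists because it lies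
  in the finite-dimensional range; what remains of the operator has no eigenvector left.\<close>

lemma (in symmetric_op) spectral_decomposition:
  assumes W: "finite W" "\<And>\<psi>. \<psi> \<in> fock n \<Longrightarrow> T \<psi> \<in> ket.span W"
  obtains m v l where "orthonormal_kets n {..<m::nat} v"
    and "\<And>\<psi>. \<psi> \<in> fock n \<Longrightarrow> T \<psi> = diag_op {..<m} l v \<psi>"
proof -
  define E where "E m v l \<longleftrightarrow> orthonormal_kets n {..<m} v \<and>
    (\<forall>i<m. l i \<noteq> 0 \<and> T (v i) = (\<lambda>k. complex_of_real (l i) * v i k))" for m :: nat and v l
  have span: "v i \<in> ket.span W" if "E m v l" "i < m" for m v l i
  proof -
    have f: "v i \<in> fock n" and "l i \<noteq> 0" and T: "T (v i) = (\<lambda>k. complex_of_real (l i) * v i k)"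
      using that by (auto simp: E_def orthonormal_kets_def)
    then have "v i = (\<lambda>k. of_real (1 / l i) * T (v i) k)" by simp
    also have "\<dots> \<in> ket.span W" by (rule ket.span_scale[OF W(2)[OF f]])
    finally show ?thesis .
  qed
  have bound: "m \<le> card W" if "E m v l" for m v l
    using card_orthonormal_le[of n m v W] span[OF that] W(1) that by (auto simp: E_def)
  have "E 0 (\<lambda>_ _. 0) (\<lambda>_. 0)" by (simp add: E_def orthonormal_kets_def)
  then obtain m where m: "\<exists>v l. E m v l" "\<And>m'. \<exists>v l. E m' v l \<Longrightarrow> m' \<le> m"
    using ex_has_greatest_nat[of "\<lambda>m. \<exists>v l. E m v l" 0 "\<lambda>m. m" "Suc (card W)"] bound
    by (metis less_Suc_eq_le)
  then obtain v l where E: "E m v l" by blast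
  then have on: "orthonormal_kets n {..<m} v" and l: "\<And>i. i < m \<Longrightarrow> l i \<noteq> 0"
    and ev: "\<And>i. i < m \<Longrightarrow> T (v i) = (\<lambda>k. complex_of_real (l i) * v i k)" by (auto simp: E_def)
  have v: "v i \<in> fock n" if "i < m" for i using orthonormal_ketsD(1)[OF on] that by simp
  define P where "P = diag_op {..<m} l v"
  define T' where "T' \<psi> = (\<lambda>k. T \<psi> k - P \<psi> k)" for \<psi>
  interpret P: symmetric_op n P unfolding P_def by (rule diag_op_symmetric) (simp add: v)
  interpret T': symmetric_op n T'
  proof
    fix \<phi> \<psi> a b assume \<psi>: "\<psi> \<in> fock n"
    show "T' \<psi> \<in> fock n" unfolding T'_def by (intro fock_diff fock P.fock \<psi>)
    assume \<phi>: "\<phi> \<in> fock n"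
    show "T' (\<lambda>k. a * \<phi> k + b * \<psi> k) = (\<lambda>k. a * T' \<phi> k + b * T' \<psi> k)"
      unfolding T'_def lincomb[OF \<phi> \<psi>] P.lincomb[OF \<phi> \<psi>] by (simp add: algebra_simps)
    show "braket (T' \<phi>) \<psi> = braket \<phi> (T' \<psi>)"
      unfolding T'_def
      by (simp add: braket_diff_left[OF \<psi> fock[OF \<phi>] P.fock[OF \<phi>]]
          braket_diff_right[OF \<phi> fock[OF \<psi>] P.fock[OF \<psi>]] symmetric[OF \<phi> \<psi>] P.symmetric[OF \<phi> \<psi>])
  qed
  have T'v: "T' (v i) = (\<lambda>k. 0)" if "i < m" for i
    unfolding T'_def P_def ev[OF that] using diag_op_orthonormal[OF on, of i] that by simp
  have T'0: "T' \<psi> = (\<lambda>k. 0)" if \<psi>: "\<psi> \<in> fock n" for \<psi>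
  proof (rule ccontr)
    assume "T' \<psi> \<noteq> (\<lambda>k. 0)"
    moreover have "T' \<phi> \<in> ket.span W" if "\<phi> \<in> fock n" for \<phi>
    proof -
      have "P \<phi> = (\<Sum>i<m. (\<lambda>k. (of_real (l i) * braket (v i) \<phi>) * v i k))"
        by (simp add: P_def diag_op_def sum_fun_eq)
      also have "\<dots> \<in> ket.span W" by (intro ket.span_sum ket.span_scale span[OF E]) simp
      finally have "T \<phi> - P \<phi> \<in> ket.span W" by (intro ket.span_diff W(2) that)
      then show ?thesis by (simp add: T'_def fun_diff_def)
    qed
    ultimately obtain w z where w: "w \<in> fock n" "ket_norm w = 1" "z \<noteq> 0" "T' w = (\<lambda>k. complex_of_real z * w k)"
      using T'.nonzero_eigenvector[OF W(1) _ \<psi>] by metis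
    \<comment> \<open>The remainder annihilates every \<open>v i\<close>, so by symmetry its
      eigenvector \<open>w\<close> is orthogonal to all of them and would extend the maximal
      family.\<close>
    have wv: "braket (v i) w = 0" if "i < m" for i
    proof -
      have "of_real z * braket (v i) w = braket (v i) (T' w)" by (simp add: w(4) braket_scale_right)
      also have "\<dots> = 0" using T'.symmetric[OF v[OF that] w(1)] by (simp add: T'v[OF that])
      finally show ?thesis using w(3) by simp
    qed
    moreover have "braket w (v i) = 0" if "i < m" for i
      using wv[OF that] braket_cnj[of "v i" w] by simp
    moreover have "P w = (\<lambda>k. 0)" unfolding P_def diag_op_def using wv by simp
    then have "T w = (\<lambda>k. complex_of_real z * w k)" using w(4) by (simp add: T'_def)
    ultimately have "E (Suc m) (v(m := w)) (l(m := z))"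
      using E w unfolding E_def orthonormal_kets_def
      by (auto simp: less_Suc_eq braket_self[of w])
    then show False using m(2)[of "Suc m"] by auto
  qed
  then have "T \<psi> = P \<psi>" if "\<psi> \<in> fock n" for \<psi>
    using T'0[OF that] by (auto simp: T'_def fun_eq_iff)
  with on show thesis
    by (intro that[of m v l]) (auto simp: P_def)
qed

section \<open>Adjoint, absolute value and trace norm\<close>

lemma fock_eqI:
  assumes "\<phi> \<in> fock n" "\<psi> \<in> fock n" "\<And>\<xi>. \<xi> \<in> fock n \<Longrightarrow> braket \<phi> \<xi> = braket \<psi> \<xi>"
  shows "\<phi> = \<psi>"
proof -
  have d: "(\<lambda>k. \<phi> k - \<psi> k) \<in> fock n" using assms by (intro fock_diff)
  have "braket (\<lambda>k. \<phi> k - \<psi> k) (\<lambda>k. \<phi> k - \<psi> k) = 0"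
    unfolding braket_diff_left[OF d assms(1,2)] using assms(3)[OF d] by simp
  then have "(\<lambda>k. \<phi> k - \<psi> k) = (\<lambda>k. 0)" by (intro ket_norm_eq_0[OF d]) (simp add: braket_self)
  then show ?thesis by (simp add: fun_eq_iff)
qed

lemma bounded_opD:
  assumes "bounded_op n T"
  shows "\<psi> \<in> fock n \<Longrightarrow> T \<psi> \<in> fock n"
    and "\<phi> \<in> fock n \<Longrightarrow> \<psi> \<in> fock n \<Longrightarrow>
      T (\<lambda>k. a * \<phi> k + b * \<psi> k) = (\<lambda>k. a * T \<phi> k + b * T \<psi> k)"
  using assms unfolding bounded_op_def by blast+

lemma bounded_op_cong:
  assumes "\<And>\<psi>. \<psi> \<in> fock n \<Longrightarrow> S \<psi> = T \<psi>"
  shows "bounded_op n S \<longleftrightarrow> bounded_op n T"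
  unfolding bounded_op_def using assms by (simp add: fock_lincomb cong: ball_cong)

text \<open>\<open>positive_op\<close> speaks only of the quadratic form. Polarisation with the
  coefficients 1 and i recovers symmetry from the reality of its values.\<close>

lemma positive_op_symmetric:
  assumes "positive_op n S"
  shows "symmetric_op n S"
proof
  have b: "bounded_op n S" and p: "\<And>\<psi>. \<psi> \<in> fock n \<Longrightarrow> braket \<psi> (S \<psi>) \<in> \<real>"
    using assms nonneg_Reals_subset_Reals unfolding positive_op_def by auto
  fix \<phi> \<psi> a c assume \<psi>: "\<psi> \<in> fock n"
  show S\<psi>: "S \<psi> \<in> fock n" by (rule bounded_opD(1)[OF b \<psi>])
  assume \<phi>: "\<phi> \<in> fock n"
  show "S (\<lambda>k. a * \<phi> k + c * \<psi> k) = (\<lambda>k. a * S \<phi> k + c * S \<psi> k)"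
    by (rule bounded_opD(2)[OF b \<phi> \<psi>])
  have S\<phi>: "S \<phi> \<in> fock n" by (rule bounded_opD(1)[OF b \<phi>])
  define x y where "x = braket \<phi> (S \<psi>)" and "y = braket \<psi> (S \<phi>)"
  have expand: "c * x + cnj c * y \<in> \<real>" for c
  proof -
    have f: "(\<lambda>k. 1 * \<phi> k + c * \<psi> k) \<in> fock n" by (intro fock_lincomb \<phi> \<psi>)
    have "braket (\<lambda>k. 1 * \<phi> k + c * \<psi> k) (S (\<lambda>k. 1 * \<phi> k + c * \<psi> k)) =
        (braket \<phi> (S \<phi>) + cnj c * c * braket \<psi> (S \<psi>)) + (c * x + cnj c * y)"
      unfolding bounded_opD(2)[OF b \<phi> \<psi>] x_def y_def
      using S\<phi> S\<psi> \<phi> \<psi>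
      by (simp only: braket_lincomb_left[OF fock_lincomb] braket_lincomb_right)
         (simp add: algebra_simps)
    moreover have "cnj c * c \<in> \<real>" by (simp add: complex_is_Real_iff)
    then have "braket \<phi> (S \<phi>) + cnj c * c * braket \<psi> (S \<psi>) \<in> \<real>"
      by (intro Reals_add Reals_mult[of "cnj c * c"] p \<phi> \<psi>)
    ultimately show ?thesis using p[OF f] by (metis Reals_diff add_diff_cancel_left')
  qed
  have "Im (x + y) = 0" "Re (x - y) = 0"
    using expand[of 1] expand[of \<i>] by (auto simp: complex_is_Real_iff)
  then have "x = cnj y" by (auto simp: complex_eq_iff)
  then show "braket (S \<phi>) \<psi> = braket \<phi> (S \<psi>)" by (simp add: x_def y_def braket_cnj)
qed

text \<open>Resolves the definite description: extensionality fixes the values outside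
  \<open>fock n\<close>, nondegeneracy of the inner product those inside.\<close>

lemma op_adjoint_symmetric:
  assumes "symmetric_op n T" "bounded_op n T" "\<psi> \<in> fock n"
  shows "op_adjoint n T \<psi> = T \<psi>"
proof -
  interpret symmetric_op n T by fact
  have "op_adjoint n T = restrict T (fock n)"
    unfolding op_adjoint_def
  proof (rule the_equality)
    show "restrict T (fock n) \<in> extensional (fock n) \<and> bounded_op n (restrict T (fock n)) \<and>
        (\<forall>\<phi>\<in>fock n. \<forall>\<psi>\<in>fock n. braket (restrict T (fock n) \<phi>) \<psi> = braket \<phi> (T \<psi>))"
      using assms(2) bounded_op_cong[of n "restrict T (fock n)" T] by (auto simp: symmetric)
  next
    fix A assume A: "A \<in> extensional (fock n) \<and> bounded_op n A \<and>
        (\<forall>\<phi>\<in>fock n. \<forall>\<psi>\<in>fock n. braket (A \<phi>) \<psi> = braket \<phi> (T \<psi>))"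
    show "A = restrict T (fock n)"
    proof (rule extensionalityI[of _ "fock n"])
      fix \<phi> assume \<phi>: "\<phi> \<in> fock n"
      show "A \<phi> = restrict T (fock n) \<phi>"
        by (rule fock_eqI[of _ n]) (use A \<phi> bounded_opD(1) in \<open>auto simp: symmetric fock\<close>)
    qed (use A in auto)
  qed
  with assms(3) show ?thesis by simp
qed

text \<open>The content is the uniqueness of the positive root \<open>R\<close>. For nonzero
  \<open>l i\<close> the defect w = R (v i) - |l i| v i satisfies R w = - |l i| w, which positivity
  allows only for w = 0. Where \<open>T\<close> vanishes, so does R^2, and by symmetry so does
  \<open>R\<close>.\<close>

lemma op_abs_diag_op:
  fixes l :: "nat \<Rightarrow> real"
  assumes on: "orthonormal_kets n {..<m} v" and bounded: "bounded_op n T"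
    and TD: "\<And>\<psi>. \<psi> \<in> fock n \<Longrightarrow> T \<psi> = diag_op {..<m} l v \<psi>"
    and \<psi>: "\<psi> \<in> fock n"
  shows "op_abs n T \<psi> = diag_op {..<m} (\<lambda>i. \<bar>l i\<bar>) v \<psi>"
proof -
  have v: "v i \<in> fock n" if "i \<in> {..<m}" for i using orthonormal_ketsD(1)[OF on] that by simp
  define D where "D l' = diag_op {..<m} l' v" for l'
  interpret D: symmetric_op n "D l'" for l' unfolding D_def by (rule diag_op_symmetric[OF v])
  have D_fock: "D l \<psi> \<in> fock n" for l \<psi> unfolding D_def by (rule diag_op_fock[OF v])
  have D_coeff: "braket (v i) (D l \<psi>) = of_real (l i) * braket (v i) \<psi>" if "i < m" for i l \<psi>
    unfolding D_def diag_op_def using orthonormal_kets_coefficient[OF on, of i] that by simp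
  have D_bounded: "bounded_op n (D l)" for l
    unfolding D_def using ket_norm_orthonormal[OF on] by (intro diag_op_bounded v) auto
  have TD': "T \<psi> = D l \<psi>" if "\<psi> \<in> fock n" for \<psi> unfolding D_def by (rule TD[OF that])
  have T_sym: "symmetric_op n T"
    by unfold_locales (simp_all add: TD' D_fock D.lincomb D.symmetric fock_lincomb)
  define S where "S = D (\<lambda>i. \<bar>l i\<bar>)"
  have SS: "S (S \<psi>) = op_adjoint n T (T \<psi>)" if "\<psi> \<in> fock n" for \<psi>
  proof -
    have "op_adjoint n T (T \<psi>) = D l (D l \<psi>)"
      using that by (simp add: op_adjoint_symmetric[OF T_sym bounded] TD' D_fock)
    moreover have "D l' (D l' \<psi>) = (\<lambda>k. \<Sum>i<m. (of_real ((l' i)\<^sup>2) * braket (v i) \<psi>) * v i k)" for l'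
      unfolding D_def[of l'] diag_op_def[of _ _ _ "diag_op {..<m} l' v \<psi>"]
      unfolding D_def[symmetric] by (intro ext sum.cong) (simp_all add: D_coeff power2_eq_square)
    ultimately show ?thesis by (simp add: S_def flip: of_real_power)
  qed
  have "op_abs n T = restrict S (fock n)"
    unfolding op_abs_def
  proof (rule the_equality)
    have "braket \<psi> (S \<psi>) \<in> \<real>\<^sub>\<ge>\<^sub>0" if "\<psi> \<in> fock n" for \<psi>
    proof -
      have "braket \<psi> (S \<psi>) = of_real (\<Sum>i<m. \<bar>l i\<bar> * (cmod (braket (v i) \<psi>))\<^sup>2)"
        unfolding S_def D_def of_real_sum of_real_mult complex_norm_square
        using v that by (subst braket_diag_op[where n=n]) (simp_all add: braket_cnj mult.assoc)
      moreover have "(\<Sum>i<m. \<bar>l i\<bar> * (cmod (braket (v i) \<psi>))\<^sup>2) \<ge> 0" by (simp add: sum_nonneg)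
      ultimately show ?thesis by (simp only: nonneg_Reals_of_real_iff)
    qed
    then show "restrict S (fock n) \<in> extensional (fock n) \<and> positive_op n (restrict S (fock n)) \<and>
        (\<forall>\<psi>\<in>fock n. restrict S (fock n) (restrict S (fock n) \<psi>) = op_adjoint n T (T \<psi>))"
      using D_bounded[of "\<lambda>i. \<bar>l i\<bar>"] bounded_op_cong[of n "restrict S (fock n)" S] SS D_fock
      by (auto simp: positive_op_def S_def)
  next
    fix R assume R: "R \<in> extensional (fock n) \<and> positive_op n R \<and> (\<forall>\<psi>\<in>fock n. R (R \<psi>) = op_adjoint n T (T \<psi>))"
    then interpret R: symmetric_op n R using positive_op_symmetric by blast
    have RR: "R (R \<psi>) = D l (D l \<psi>)" if "\<psi> \<in> fock n" for \<psi>
      using R that by (simp add: op_adjoint_symmetric[OF T_sym bounded] TD' D_fock)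
    have vanish: "R \<psi> = (\<lambda>k. 0)" if \<psi>: "\<psi> \<in> fock n" and "D l \<psi> = (\<lambda>k. 0)" for \<psi>
    proof -
      have "R (R \<psi>) = (\<lambda>k. 0)" unfolding RR[OF \<psi>] that(2) by (rule D.zero)
      then have "braket (R \<psi>) (R \<psi>) = 0" using R.symmetric[OF \<psi> R.fock[OF \<psi>]] by simp
      then show ?thesis by (intro ket_norm_eq_0[OF R.fock[OF \<psi>]]) (simp add: braket_self)
    qed
    have Rv: "R (v i) = (\<lambda>k. of_real \<bar>l i\<bar> * v i k)" if i: "i < m" for i
    proof -
      have vi: "v i \<in> fock n" using v i by simp
      have Dv: "D l (v i) = (\<lambda>k. of_real (l i) * v i k)" for l
        unfolding D_def using i by (intro diag_op_orthonormal[OF on]) auto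
      show ?thesis
      proof (cases "l i = 0")
        case True
        then show ?thesis using vanish[OF vi] Dv by simp
      next
        case False
        define w where "w = (\<lambda>k. R (v i) k - of_real \<bar>l i\<bar> * v i k)"
        have w: "w \<in> fock n" unfolding w_def by (intro fock_diff R.fock fock_scale vi)
        have DD: "D l (D l (v i)) = (\<lambda>k. of_real ((l i)\<^sup>2) * v i k)"
          by (simp add: Dv D.scale[OF vi] power2_eq_square)
        have "R w = (\<lambda>k. R (R (v i)) k - of_real \<bar>l i\<bar> * R (v i) k)"
          using R.lincomb[OF R.fock[OF vi] vi, of 1 "- of_real \<bar>l i\<bar>"] by (simp add: w_def)
        also have "\<dots> = (\<lambda>k. - of_real \<bar>l i\<bar> * w k)"
          unfolding RR[OF vi] DD w_def
          by (auto simp: fun_eq_iff algebra_simps power2_eq_square simp flip: of_real_mult)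
        finally have Rw: "R w = (\<lambda>k. - of_real \<bar>l i\<bar> * w k)" .
        have "braket w (R w) = of_real (- \<bar>l i\<bar> * (ket_norm w)\<^sup>2)"
          unfolding Rw braket_scale_right braket_self by simp
        moreover have "braket w (R w) \<in> \<real>\<^sub>\<ge>\<^sub>0" using R w by (simp add: positive_op_def)
        ultimately have "- \<bar>l i\<bar> * (ket_norm w)\<^sup>2 \<ge> 0" by (simp only: nonneg_Reals_of_real_iff)
        then have "ket_norm w = 0" using False by (simp add: mult_le_0_iff)
        then have "w = (\<lambda>k. 0)" by (rule ket_norm_eq_0[OF w])
        then show ?thesis by (simp add: w_def fun_eq_iff)
      qed
    qed
    show "R = restrict S (fock n)"
    proof (rule extensionalityI[of _ "fock n"])
      fix \<psi> assume \<psi>: "\<psi> \<in> fock n"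
      \<comment> \<open>The orthogonal projection of \<open>\<psi>\<close> onto the span of the
        eigenvectors; \<open>R\<close> kills the rest of \<open>\<psi>\<close>.\<close>
      define \<zeta> where "\<zeta> = D (\<lambda>_. 1) \<psi>"
      have \<zeta>: "\<zeta> \<in> fock n" by (simp add: \<zeta>_def D_fock)
      have d: "(\<lambda>k. \<psi> k - \<zeta> k) \<in> fock n" by (intro fock_diff \<psi> \<zeta>)
      have "D l (\<lambda>k. \<psi> k - \<zeta> k) = (\<lambda>k. 0)"
        unfolding D_def[of l] diag_op_def using v \<psi>
        by (intro ext sum.neutral) (auto simp: \<zeta>_def D_coeff braket_diff_right[OF v \<psi> D_fock])
      then have "R (\<lambda>k. \<psi> k - \<zeta> k) = (\<lambda>k. 0)" by (rule vanish[OF d])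
      then have "R \<psi> = R \<zeta>"
        using R.lincomb[OF \<psi> \<zeta>, of 1 "-1"] by (simp add: fun_eq_iff)
      also have "\<dots> = (\<lambda>k. \<Sum>i<m. (1 * braket (v i) \<psi>) * R (v i) k)"
        unfolding \<zeta>_def D_def diag_op_def using R.sum[of "{..<m}" v "\<lambda>i. 1 * braket (v i) \<psi>"] v by simp
      also have "\<dots> = S \<psi>"
        unfolding S_def D_def diag_op_def by (intro ext sum.cong) (simp_all add: Rv)
      finally show "R \<psi> = restrict S (fock n) \<psi>" using \<psi> by simp
    qed (use R in auto)
  qed
  then show ?thesis using \<psi> by (simp add: S_def D_def)
qed

lemma has_sum_sum:
  fixes f :: "'i \<Rightarrow> 'k \<Rightarrow> 'b::topological_comm_monoid_add"
  assumes "\<And>i. i \<in> I \<Longrightarrow> (f i has_sum s i) A"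
  shows "((\<lambda>k. \<Sum>i\<in>I. f i k) has_sum (\<Sum>i\<in>I. s i)) A"
  using assms by (induction I rule: infinite_finite_induct) (auto intro: has_sum_add)

lemma basis_ket_fock: "length k = n \<Longrightarrow> basis_ket k \<in> fock n"
proof -
  assume k: "length k = n"
  have "(\<lambda>j. (cmod (basis_ket k j))\<^sup>2) summable_on UNIV"
    by (rule finite_nonzero_values_imp_summable_on)
       (rule finite_subset[of _ "{k}"], auto simp: basis_ket_def)
  then show ?thesis using k by (auto simp: fock_def basis_ket_def)
qed

lemma braket_basis_ket: "braket \<psi> (basis_ket k) = cnj (\<psi> k)"
proof -
  have "braket \<psi> (basis_ket k) = (\<Sum>\<^sub>\<infinity>j\<in>{k}. cnj (\<psi> j) * basis_ket k j)"
    unfolding braket_def by (rule infsum_cong_neutral) (auto simp: basis_ket_def)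
  then show ?thesis by (simp add: basis_ket_def)
qed

lemma infsum_length_eq_braket:
  assumes "\<phi> \<in> fock n"
  shows "(\<Sum>\<^sub>\<infinity>k\<in>{k. length k = n}. cnj (\<phi> k) * \<psi> k) = braket \<phi> \<psi>"
  unfolding braket_def by (rule infsum_cong_neutral) (use assms in \<open>auto simp: fock_eq_0\<close>)

text \<open>The trace norm is the sum of the |l i| over a spectral decomposition. Each
  \<open>l i\<close> combines the \<open>a j\<close> with the weights |<v i|w j>|^2, and by Bessel
  every \<open>a j\<close> has total weight at most 1.\<close>

lemma trace_norm_le:
  fixes a :: "'j \<Rightarrow> real"
  assumes "finite J" "\<And>j. j \<in> J \<Longrightarrow> w j \<in> fock n" "\<And>j. j \<in> J \<Longrightarrow> ket_norm (w j) \<le> 1"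
  shows "0 \<le> trace_norm n (\<lambda>\<xi> k. \<Sum>j\<in>J. of_real (a j) * pure_state (w j) \<xi> k)"
    and "trace_norm n (\<lambda>\<xi> k. \<Sum>j\<in>J. of_real (a j) * pure_state (w j) \<xi> k) \<le> (\<Sum>j\<in>J. \<bar>a j\<bar>)"
proof -
  define T where "T = (\<lambda>\<xi> k. \<Sum>j\<in>J. of_real (a j) * pure_state (w j) \<xi> k)"
  have T: "T = diag_op J a w" by (simp add: T_def diag_op_def pure_state_def mult.assoc fun_eq_iff)
  interpret symmetric_op n T unfolding T by (rule diag_op_symmetric[OF assms(2)])
  have bounded: "bounded_op n T" unfolding T by (rule diag_op_bounded[OF assms(2,1,3)])
  obtain m v l where on: "orthonormal_kets n {..<m::nat} v"
    and Tl: "\<And>\<psi>. \<psi> \<in> fock n \<Longrightarrow> T \<psi> = diag_op {..<m} l v \<psi>"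
    using spectral_decomposition[of "w ` J"] diag_op_span[of J w n] assms unfolding T by (metis finite_imageI)
  have v: "v i \<in> fock n" if "i \<in> {..<m}" for i using orthonormal_ketsD(1)[OF on] that by simp
  have "op_trace n (op_abs n T) = (\<Sum>\<^sub>\<infinity>k\<in>{k. length k = n}. \<Sum>i<m. of_real \<bar>l i\<bar> * (cnj (v i k) * v i k))"
    unfolding op_trace_def
    by (intro infsum_cong) (simp add: op_abs_diag_op[OF on bounded Tl] basis_ket_fock diag_op_def braket_basis_ket mult.assoc)
  also have "\<dots> = (\<Sum>i<m. \<Sum>\<^sub>\<infinity>k\<in>{k. length k = n}. of_real \<bar>l i\<bar> * (cnj (v i k) * v i k))"
    using v by (intro infsumI has_sum_sum has_sum_infsum summable_on_cmult_right
        summable_on_subset_banach[OF summable_braket]) auto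
  also have "\<dots> = (\<Sum>i<m. of_real \<bar>l i\<bar>)"
    by (intro sum.cong) (simp_all add: infsum_cmult_right' infsum_length_eq_braket v orthonormal_ketsD(2)[OF on])
  finally have tn: "trace_norm n T = (\<Sum>i<m. \<bar>l i\<bar>)" unfolding trace_norm_def by (simp flip: of_real_sum)
  then show "0 \<le> trace_norm n (\<lambda>\<xi> k. \<Sum>j\<in>J. of_real (a j) * pure_state (w j) \<xi> k)"
    unfolding T_def by (simp add: sum_nonneg)
  have "\<bar>l i\<bar> \<le> (\<Sum>j\<in>J. \<bar>a j\<bar> * (cmod (braket (v i) (w j)))\<^sup>2)" if i: "i < m" for i
  proof -
    have vi: "v i \<in> fock n" using v i by simp
    have "of_real (l i) = braket (v i) (T (v i))"
      unfolding Tl[OF vi] using i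
      by (simp add: diag_op_orthonormal[OF on] braket_scale_right orthonormal_ketsD(2)[OF on])
    also have "\<dots> = (\<Sum>j\<in>J. of_real (a j) * (braket (v i) (w j) * cnj (braket (v i) (w j))))"
      unfolding T using assms(2) vi by (subst braket_diag_op[where n=n]) (auto simp: braket_cnj mult_ac intro!: sum.cong)
    also have "\<dots> = of_real (\<Sum>j\<in>J. a j * (cmod (braket (v i) (w j)))\<^sup>2)"
      unfolding complex_norm_square[symmetric] by simp
    finally have "l i = (\<Sum>j\<in>J. a j * (cmod (braket (v i) (w j)))\<^sup>2)" by (simp only: of_real_eq_iff)
    then show ?thesis by (auto intro!: order_trans[OF sum_abs] simp: abs_mult)
  qed
  then have "(\<Sum>i<m. \<bar>l i\<bar>) \<le> (\<Sum>i<m. \<Sum>j\<in>J. \<bar>a j\<bar> * (cmod (braket (v i) (w j)))\<^sup>2)"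
    by (intro sum_mono) simp
  also have "\<dots> = (\<Sum>j\<in>J. \<bar>a j\<bar> * (\<Sum>i<m. (cmod (braket (v i) (w j)))\<^sup>2))"
    by (subst sum.swap) (simp add: sum_distrib_left)
  also have "\<dots> \<le> (\<Sum>j\<in>J. \<bar>a j\<bar> * 1)"
  proof (intro sum_mono mult_left_mono)
    fix j assume j: "j \<in> J"
    have "(\<Sum>i<m. (cmod (braket (v i) (w j)))\<^sup>2) \<le> (ket_norm (w j))\<^sup>2"
      using Bessel_braket[OF on] assms(2)[OF j] by simp
    also have "\<dots> \<le> 1" using assms(3)[OF j] by (simp add: power_le_one)
    finally show "(\<Sum>i<m. (cmod (braket (v i) (w j)))\<^sup>2) \<le> 1" .
  qed simp
  finally show "trace_norm n (\<lambda>\<xi> k. \<Sum>j\<in>J. of_real (a j) * pure_state (w j) \<xi> k) \<le> (\<Sum>j\<in>J. \<bar>a j\<bar>)"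
    using tn by (simp add: T_def)
qed

section \<open>Coherent states\<close>

definition coherent_amp :: "complex \<Rightarrow> nat \<Rightarrow> complex" where
  "coherent_amp x k = exp (- of_real ((cmod x)\<^sup>2 / 2)) * x ^ k / of_real (sqrt (fact k))"

definition displacement_gen :: "complex \<Rightarrow> (nat \<Rightarrow> complex) \<Rightarrow> nat \<Rightarrow> complex" where
  "displacement_gen \<alpha> \<phi> j = \<alpha> * create \<phi> j - cnj \<alpha> * annihilate \<phi> j"

text \<open>The \<open>m\<close>-th Taylor coefficient in \<open>t\<close> of \<open>exp (- t\<^sup>2\<bar>\<alpha>\<bar>\<^sup>2/2) (t\<alpha>)\<^sup>k / sqrt (k!)\<close>, times \<open>m!\<close>.\<close>

lemma displacement_gen_power_vacuum:
  "(displacement_gen \<alpha> ^^ m) vacuum k =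
    (if k \<le> m \<and> even (m - k) then
      \<alpha> ^ k / of_real (sqrt (fact k)) * (- of_real ((cmod \<alpha>)\<^sup>2 / 2)) ^ ((m - k) div 2) / fact ((m - k) div 2) * fact m
     else 0)"
proof (induction m arbitrary: k)
  case 0
  then show ?case by (auto simp: vacuum_def)
next
  case (Suc m)
  define b where "b = - complex_of_real ((cmod \<alpha>)\<^sup>2 / 2)"
  have \<alpha>: "cnj \<alpha> * \<alpha> = - 2 * b" unfolding b_def using complex_norm_square[of \<alpha>] by (simp add: mult.commute)
  define F where "F m k = (if k \<le> m \<and> even (m - k) then
      \<alpha> ^ k / of_real (sqrt (fact k)) * b ^ ((m - k) div 2) / fact ((m - k) div 2) * fact m else 0)" for m k
  have IH: "(displacement_gen \<alpha> ^^ m) vacuum k = F m k" for k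
    unfolding F_def b_def by (rule Suc.IH)
  have "F (Suc m) k = \<alpha> * (case k of 0 \<Rightarrow> 0 | Suc j \<Rightarrow> of_real (sqrt (real (Suc j))) * F m j)
      - cnj \<alpha> * (of_real (sqrt (real (Suc k))) * F m (Suc k))"
  proof (cases "k \<le> Suc m \<and> even (Suc m - k)")
    case False
    then have "\<not> (Suc k \<le> m \<and> even (m - Suc k))" by auto
    moreover have "\<not> (j \<le> m \<and> even (m - j))" if "k = Suc j" for j using False that by auto
    ultimately show ?thesis using False by (auto simp: F_def split: nat.split)
  next
    case True
    \<comment> \<open>Creation will contribute \<open>k\<close> and annihilation
      \<open>2 * r\<close> copies of the same expression, and k + 2 r = m + 1 is the factor that
      turns \<open>fact m\<close> into \<open>fact (Suc m)\<close>.\<close>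
    then obtain r where r: "Suc m = k + 2 * r" by (metis evenE le_add_diff_inverse)
    have sq: "complex_of_real (sqrt (fact (Suc j))) = of_real (sqrt (real (Suc j))) * of_real (sqrt (fact j))" for j
      by (simp add: real_sqrt_mult del: of_nat_Suc)
    have nz: "complex_of_real (sqrt (fact j)) \<noteq> 0" "complex_of_real (sqrt (real (Suc j))) \<noteq> 0" for j
      by (simp_all del: of_nat_Suc)
    have ss: "complex_of_real (sqrt (real j)) * of_real (sqrt (real j)) = of_nat j" for j
      by (simp flip: of_real_mult)
    have 1: "\<alpha> * (case k of 0 \<Rightarrow> 0 | Suc j \<Rightarrow> of_real (sqrt (real (Suc j))) * F m j) =
        of_nat k * (\<alpha> ^ k / of_real (sqrt (fact k)) * b ^ r / fact r * fact m)"
    proof (cases k)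
      case (Suc j)
      then have "m = j + 2 * r" using r by simp
      then have Fm: "F m j = \<alpha> ^ j / of_real (sqrt (fact j)) * b ^ r / fact r * fact m" by (simp add: F_def)
      have "complex_of_real (sqrt (real (Suc j))) / of_real (sqrt (fact j)) = of_nat (Suc j) / of_real (sqrt (fact (Suc j)))"
        unfolding sq ss[of "Suc j", symmetric] using nz[of j] by (simp add: field_simps del: of_nat_Suc)
      moreover have "of_real (sqrt (real (Suc j))) * F m j =
          (complex_of_real (sqrt (real (Suc j))) / of_real (sqrt (fact j))) * (\<alpha> ^ j * b ^ r / fact r * fact m)"
        unfolding Fm by simp
      ultimately have "of_real (sqrt (real (Suc j))) * F m j =
          (of_nat (Suc j) / of_real (sqrt (fact (Suc j)))) * (\<alpha> ^ j * b ^ r / fact r * fact m)"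
        by (simp only:)
      then show ?thesis unfolding Suc nat.case by (simp only: power_Suc) (simp add: mult_ac del: of_nat_Suc fact_Suc)
    qed simp
    have 2: "cnj \<alpha> * (of_real (sqrt (real (Suc k))) * F m (Suc k)) =
        - (2 * of_nat r * (\<alpha> ^ k / of_real (sqrt (fact k)) * b ^ r / fact r * fact m))"
    proof (cases r)
      case 0
      then have "\<not> Suc k \<le> m" using r by auto
      then show ?thesis using 0 by (simp add: F_def)
    next
      case (Suc q)
      then have "m = Suc k + 2 * q" using r by simp
      then have "F m (Suc k) = \<alpha> ^ Suc k / of_real (sqrt (fact (Suc k))) * b ^ q / fact q * fact m" by (simp add: F_def)
      then have "cnj \<alpha> * (of_real (sqrt (real (Suc k))) * F m (Suc k)) =
          (cnj \<alpha> * \<alpha>) * (\<alpha> ^ k / of_real (sqrt (fact k)) * (b ^ q / fact q) * fact m)"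
        unfolding sq using nz by (simp add: mult_ac del: of_nat_Suc fact_Suc)
      moreover have "b ^ q / fact q = of_nat r * b ^ q / fact r"
        unfolding Suc by (simp add: field_simps del: of_nat_Suc)
      ultimately have "cnj \<alpha> * (of_real (sqrt (real (Suc k))) * F m (Suc k)) =
          - 2 * b * (\<alpha> ^ k / of_real (sqrt (fact k)) * (of_nat r * b ^ q / fact r) * fact m)"
        unfolding \<alpha> by (simp only:)
      then show ?thesis using Suc by (simp add: mult_ac del: of_nat_Suc fact_Suc)
    qed
    have "F (Suc m) k = \<alpha> ^ k / of_real (sqrt (fact k)) * b ^ r / fact r * (of_nat (Suc m) * fact m)"
    proof -
      have "F (Suc m) k = \<alpha> ^ k / of_real (sqrt (fact k)) * b ^ r / fact r * fact (Suc m)"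
        unfolding r by (simp add: F_def del: fact_Suc)
      then show ?thesis by (simp only: fact_Suc of_nat_mult of_nat_fact)
    qed
    moreover have "(of_nat (Suc m) :: complex) = of_nat k + 2 * of_nat r" unfolding r by simp
    ultimately show ?thesis unfolding 1 2 by (simp add: algebra_simps add_divide_distrib del: of_nat_Suc)
  qed
  then show ?case
    unfolding funpow.simps comp_apply displacement_gen_def[of \<alpha> "(displacement_gen \<alpha> ^^ m) vacuum" k]
      create_def annihilate_def IH
    by (simp only: F_def b_def)
qed

text \<open>Number state \<open>k\<close> is reached from the vacuum only by the powers k + 2 r of
  the generator, and over these the closed form is the exponential series of - |\<alpha>|^2 /
  2.\<close>

lemma coherent_eq: "coherent \<alpha> = coherent_amp \<alpha>"
proof
  fix k
  define b where "b = - complex_of_real ((cmod \<alpha>)\<^sup>2 / 2)"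
  define c where "c = \<alpha> ^ k / complex_of_real (sqrt (fact k))"
  have "(\<lambda>r. c * (b ^ r /\<^sub>R fact r)) sums (c * exp b)"
    by (intro sums_mult exp_converges)
  moreover have V: "(displacement_gen \<alpha> ^^ (k + 2 * r)) vacuum k / fact (k + 2 * r) = c * (b ^ r /\<^sub>R fact r)" for r
    by (simp add: displacement_gen_power_vacuum c_def b_def scaleR_conv_of_real field_simps)
  ultimately have "(\<lambda>r. (displacement_gen \<alpha> ^^ (k + 2 * r)) vacuum k / fact (k + 2 * r)) sums (c * exp b)"
    by simp
  moreover have "(displacement_gen \<alpha> ^^ m) vacuum k / fact m = 0" if "m \<notin> range (\<lambda>r. k + 2 * r)" for m
  proof -
    have "\<not> (k \<le> m \<and> even (m - k))"
      using that by (metis evenE le_add_diff_inverse rangeI)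
    then show ?thesis by (simp only: displacement_gen_power_vacuum if_False div_0)
  qed
  ultimately have "(\<lambda>m. (displacement_gen \<alpha> ^^ m) vacuum k / fact m) sums (c * exp b)"
    by (subst (asm) sums_mono_reindex) (auto simp: strict_mono_def)
  then have "(\<Sum>m. (displacement_gen \<alpha> ^^ m) vacuum k / fact m) = c * exp b"
    by (rule sums_unique[symmetric])
  moreover have "displacement_gen \<alpha> = (\<lambda>\<phi> j. \<alpha> * create \<phi> j - cnj \<alpha> * annihilate \<phi> j)"
    by (simp add: fun_eq_iff displacement_gen_def)
  ultimately show "coherent \<alpha> k = coherent_amp \<alpha> k"
    unfolding coherent_def displacement_def by (simp add: coherent_amp_def c_def b_def)
qed


text \<open>\<open>exp (-\<bar>x\<bar>\<^sup>2/2) displace_num x k j / sqrt (k! j!)\<close> is the matrix element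
  \<open>\<langle>k|D(x)|j\<rangle>\<close> of the displacement operator.\<close>

fun displace_num :: "complex \<Rightarrow> nat \<Rightarrow> nat \<Rightarrow> complex" where
  "displace_num x 0 j = (- cnj x) ^ j"
| "displace_num x (Suc k) j = x * displace_num x k j + of_nat j * displace_num x k (j - 1)"

text \<open>Companion of the defining recursion, raising the column index instead of the row index.
  The truncated \<open>k - 1\<close> at 0 is harmless, its factor being 0 there.\<close>

lemma displace_num_Suc_right:
  "displace_num x k (Suc j) = of_nat k * displace_num x (k - 1) j - cnj x * displace_num x k j"
proof (induction k arbitrary: j)
  case (Suc k)
  have "of_nat k * displace_num x k j =
      of_nat k * (x * displace_num x (k - 1) j + of_nat j * displace_num x (k - 1) (j - 1))"
    by (cases k) simp_all
  moreover have "of_nat j * displace_num x k j =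
      of_nat j * (of_nat k * displace_num x (k - 1) (j - 1) - cnj x * displace_num x k (j - 1))"
    using Suc.IH[of "j - 1"] by (cases j) simp_all
  ultimately show ?case by (simp add: Suc.IH[of j] algebra_simps)
qed simp

text \<open>The row recursion at x and the column recursion at -x are conjugate to each other:
  D(x)^dagger = D(-x) in coordinates.\<close>

lemma displace_num_adjoint: "displace_num x k j = cnj (displace_num (- x) j k)"
proof (induction k arbitrary: j)
  case 0
  have "displace_num (- x) j 0 = (- x) ^ j" by (induction j) auto
  then show ?case by simp
next
  case (Suc k)
  then show ?case
    by (simp add: displace_num_Suc_right)
qed

text \<open>Crude, but geometric in \<open>k\<close> for fixed \<open>j\<close>, so that division by
  k! makes the Gram series converge absolutely.\<close>

lemma norm_displace_num_le: "cmod (displace_num x k j) \<le> (cmod x + real j) ^ k * (1 + cmod x) ^ j"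
proof (induction k arbitrary: j)
  case 0
  then show ?case by (simp add: norm_power power_mono)
next
  case (Suc k)
  have 1: "cmod (displace_num x k (j - 1)) \<le> (cmod x + real j) ^ k * (1 + cmod x) ^ j"
    by (rule order_trans[OF Suc.IH[of "j - 1"]])
       (intro mult_mono power_mono power_increasing; simp)
  have "cmod (displace_num x (Suc k) j) \<le> cmod x * cmod (displace_num x k j) + real j * cmod (displace_num x k (j - 1))"
    by (simp add: norm_mult order_trans[OF norm_triangle_ineq])
  also have "\<dots> \<le> cmod x * ((cmod x + real j) ^ k * (1 + cmod x) ^ j) + real j * ((cmod x + real j) ^ k * (1 + cmod x) ^ j)"
    by (intro add_mono mult_left_mono 1 Suc.IH) auto
  finally show ?case by (simp add: algebra_simps)
qed

text \<open>Multiplication by \<open>y\<close> shifts the series by one place and produces the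
  second term of the recursion. With a coherent amplitude for \<open>y\<close> this becomes the
  action of the displacement on |y>.\<close>

lemma displace_num_generating:
  "(\<lambda>j. y ^ j / fact j * displace_num x k j) sums (exp (- cnj x * y) * (x + y) ^ k)"
proof (induction k)
  case 0
  have "(\<lambda>j. (- cnj x * y) ^ j /\<^sub>R fact j) sums exp (- cnj x * y)" by (rule exp_converges)
  moreover have "(- cnj x * y) ^ j /\<^sub>R fact j = y ^ j / fact j * displace_num x 0 j" for j
    by (simp add: scaleR_conv_of_real power_mult_distrib[symmetric] field_simps)
  ultimately show ?case by simp
next
  case (Suc k)
  define c where "c = exp (- cnj x * y) * (x + y) ^ k"
  define f where "f j = y ^ j / fact j * (of_nat j * displace_num x k (j - 1))" for j
  have "(\<lambda>j. y * (y ^ j / fact j * displace_num x k j)) sums (y * c)"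
    unfolding c_def by (intro sums_mult Suc.IH)
  moreover have "y * (y ^ j / fact j * displace_num x k j) = f (Suc j)" for j
    unfolding f_def by (simp add: field_simps del: of_nat_Suc)
  ultimately have "(\<lambda>j. f (Suc j)) sums (y * c)" by simp
  then have "f sums (y * c)" using sums_Suc[of f "y * c"] by (simp add: f_def)
  moreover have "(\<lambda>j. x * (y ^ j / fact j * displace_num x k j)) sums (x * c)"
    unfolding c_def by (intro sums_mult Suc.IH)
  ultimately have "(\<lambda>j. x * (y ^ j / fact j * displace_num x k j) + f j) sums (x * c + y * c)"
    by (intro sums_add)
  then show ?case by (simp add: f_def c_def algebra_simps)
qed

lemma summable_displace_num:
  "summable (\<lambda>k. cmod (cnj (displace_num x k i) * displace_num x k j / fact k))"
proof (rule summable_comparison_test')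
  let ?r = "(cmod x + real i) * (cmod x + real j)" and ?c = "(1 + cmod x) ^ i * (1 + cmod x) ^ j"
  show "summable (\<lambda>k. ?c * (inverse (fact k) * ?r ^ k))" by (intro summable_mult summable_exp)
  fix k :: nat
  have "cmod (displace_num x k i) * cmod (displace_num x k j) \<le>
      ((cmod x + real i) ^ k * (1 + cmod x) ^ i) * ((cmod x + real j) ^ k * (1 + cmod x) ^ j)"
    by (intro mult_mono norm_displace_num_le) auto
  then have "cmod (displace_num x k i) * cmod (displace_num x k j) \<le> ?c * ?r ^ k"
    by (simp only: power_mult_distrib mult_ac)
  then have "inverse (fact k) * (cmod (displace_num x k i) * cmod (displace_num x k j)) \<le> inverse (fact k) * (?c * ?r ^ k)"
    by (rule mult_left_mono) simp
  then show "norm (cmod (cnj (displace_num x k i) * displace_num x k j / fact k)) \<le> ?c * (inverse (fact k) * ?r ^ k)"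
    by (simp only: norm_mult norm_divide divide_inverse mult_ac) (simp add: mult_ac norm_inverse)
qed

text \<open>The two recursions, shifted against each other in \<open>k\<close>, lower both indices
  at once: G i (j + 1) = i G (i - 1) j. In coordinates this says that the displacement is an
  isometry.\<close>

lemma displace_num_gram:
  "(\<Sum>k. cnj (displace_num x k i) * displace_num x k j / fact k) =
    (if i = j then exp (of_real ((cmod x)\<^sup>2)) * fact i else 0)"
proof -
  define G where "G i j = (\<Sum>k. cnj (displace_num x k i) * displace_num x k j / fact k)" for i j
  have summ: "summable (\<lambda>k. cnj (displace_num x k i) * displace_num x k j / fact k)" for i j
    by (rule summable_norm_cancel) (rule summable_displace_num)
  have sums: "(\<lambda>k. cnj (displace_num x k i) * displace_num x k j / fact k) sums G i j" for i j
    unfolding G_def by (rule summable_sums[OF summ])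
  have step: "G i (Suc j) = of_nat i * G (i - 1) j" for i j
  proof -
    \<comment> \<open>The row recursion yields \<open>h\<close> at \<open>k + 1\<close>; its term at
      0 vanishes, so the shifted series has the same sum.\<close>
    define h where "h k = cnj (displace_num x k i) * (of_nat k * displace_num x (k - 1) j) / fact k" for k
    have "(\<lambda>k. cnj x * (cnj (displace_num x k i) * displace_num x k j / fact k) +
        of_nat i * (cnj (displace_num x k (i - 1)) * displace_num x k j / fact k)) sums
        (cnj x * G i j + of_nat i * G (i - 1) j)"
      by (intro sums_add sums_mult sums)
    moreover have "cnj x * (cnj (displace_num x k i) * displace_num x k j / fact k) +
        of_nat i * (cnj (displace_num x k (i - 1)) * displace_num x k j / fact k) = h (Suc k)" for k
      unfolding h_def by (simp add: field_simps del: of_nat_Suc)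
    ultimately have "(\<lambda>k. h (Suc k)) sums (cnj x * G i j + of_nat i * G (i - 1) j)" by simp
    then have "h sums (cnj x * G i j + of_nat i * G (i - 1) j)"
      using sums_Suc[of h] by (simp add: h_def)
    then have "(\<lambda>k. h k - cnj x * (cnj (displace_num x k i) * displace_num x k j / fact k)) sums
        (cnj x * G i j + of_nat i * G (i - 1) j - cnj x * G i j)"
      by (intro sums_diff sums_mult sums)
    moreover have "h k - cnj x * (cnj (displace_num x k i) * displace_num x k j / fact k) =
        cnj (displace_num x k i) * displace_num x k (Suc j) / fact k" for k
      unfolding h_def displace_num_Suc_right by (simp add: field_simps)
    ultimately show ?thesis using sums_unique2[OF sums] by simp
  qed
  have G00: "G 0 0 = exp (of_real ((cmod x)\<^sup>2))"
  proof -
    have d: "displace_num x k 0 = x ^ k" for k by (induction k) auto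
    have "(\<lambda>k. of_real ((cmod x)\<^sup>2) ^ k /\<^sub>R fact k) sums exp (complex_of_real ((cmod x)\<^sup>2))"
      by (rule exp_converges)
    moreover have "of_real ((cmod x)\<^sup>2) ^ k /\<^sub>R fact k = cnj (displace_num x k 0) * displace_num x k 0 / fact k" for k
      unfolding d complex_norm_square by (simp add: power_mult_distrib scaleR_conv_of_real field_simps)
    ultimately show ?thesis using sums_unique2[OF sums[of 0 0]] by simp
  qed
  have G_cnj: "G i j = cnj (G j i)" for i j
  proof -
    have "(\<lambda>k. cnj (cnj (displace_num x k j) * displace_num x k i / fact k)) sums cnj (G j i)"
      using sums[of j i] by (simp only: sums_cnj)
    then show ?thesis using sums_unique2[OF sums[of i j]] by (simp add: mult.commute)
  qed
  have "G i j = (if i = j then exp (of_real ((cmod x)\<^sup>2)) * fact i else 0)"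
  proof (induction j arbitrary: i)
    case 0
    show ?case
    proof (cases i)
      case (Suc i')
      then have "G i 0 = cnj (G 0 (Suc i'))" using G_cnj by metis
      then show ?thesis using Suc step[of 0 i'] by simp
    qed (simp add: G00)
  next
    case (Suc j)
    then show ?case using step[of i j] by (cases i) (auto simp: algebra_simps)
  qed
  then show ?thesis by (simp add: G_def)
qed

definition displace_elem :: "complex \<Rightarrow> nat \<Rightarrow> nat \<Rightarrow> complex" where
  "displace_elem x k j = exp (- of_real ((cmod x)\<^sup>2 / 2)) * displace_num x k j / of_real (sqrt (fact k) * sqrt (fact j))"

lemma displace_elem_0: "displace_elem x k 0 = coherent_amp x k"
proof -
  have "displace_num x k 0 = x ^ k" by (induction k) auto
  then show ?thesis by (simp add: displace_elem_def coherent_amp_def)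
qed

lemma displace_elem_adjoint: "displace_elem x k j = cnj (displace_elem (- x) j k)"
  unfolding displace_elem_def displace_num_adjoint[of x k j] by (simp add: exp_cnj mult.commute)

lemma displace_elem_orthonormal:
  "((\<lambda>k. cnj (displace_elem x k i) * displace_elem x k j) has_sum (if i = j then 1 else 0)) UNIV"
  and displace_elem_abs_summable:
  "(\<lambda>k. norm (cnj (displace_elem x k i) * displace_elem x k j)) summable_on UNIV"
proof -
  define c where "c = exp (- of_real ((cmod x)\<^sup>2)) / complex_of_real (sqrt (fact i) * sqrt (fact j))"
  have eq: "cnj (displace_elem x k i) * displace_elem x k j =
      c * (cnj (displace_num x k i) * displace_num x k j / fact k)" for k
  proof -
    have e: "exp (- complex_of_real ((cmod x)\<^sup>2 / 2)) * exp (- of_real ((cmod x)\<^sup>2 / 2)) = exp (- of_real ((cmod x)\<^sup>2))"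
      by (simp flip: exp_add)
    have s: "complex_of_real (sqrt (fact k)) * of_real (sqrt (fact k)) = fact k"
      by (simp flip: of_real_mult)
    have "cnj (displace_elem x k i) * displace_elem x k j =
        (exp (- complex_of_real ((cmod x)\<^sup>2 / 2)) * exp (- of_real ((cmod x)\<^sup>2 / 2))) *
        (cnj (displace_num x k i) * displace_num x k j) /
        ((complex_of_real (sqrt (fact k)) * of_real (sqrt (fact k))) * of_real (sqrt (fact i) * sqrt (fact j)))"
      unfolding displace_elem_def by (simp add: exp_cnj mult_ac)
    then show ?thesis unfolding e s c_def by (simp add: mult_ac)
  qed
  have abs: "summable (\<lambda>k. norm (cnj (displace_elem x k i) * displace_elem x k j))"
    unfolding eq norm_mult[of c] by (intro summable_mult summable_displace_num)
  have "(\<lambda>k. cnj (displace_num x k i) * displace_num x k j / fact k) sums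
      (if i = j then exp (of_real ((cmod x)\<^sup>2)) * fact i else 0)"
    unfolding displace_num_gram[symmetric]
    by (rule summable_sums[OF summable_norm_cancel[OF summable_displace_num]])
  then have "(\<lambda>k. cnj (displace_elem x k i) * displace_elem x k j) sums
      (c * (if i = j then exp (of_real ((cmod x)\<^sup>2)) * fact i else 0))"
    unfolding eq by (rule sums_mult)
  also have "c * (if i = j then exp (of_real ((cmod x)\<^sup>2)) * fact i else 0) = (if i = j then 1 else 0)"
  proof -
    have "exp (- complex_of_real ((cmod x)\<^sup>2)) * exp (of_real ((cmod x)\<^sup>2)) = 1"
      by (simp flip: exp_add)
    moreover have "complex_of_real (sqrt (fact i)) * of_real (sqrt (fact i)) = fact i"
      by (simp flip: of_real_mult)
    ultimately show ?thesis by (auto simp: c_def)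
  qed
  finally show "((\<lambda>k. cnj (displace_elem x k i) * displace_elem x k j) has_sum (if i = j then 1 else 0)) UNIV"
    by (intro norm_summable_imp_has_sum abs)
  show "(\<lambda>k. norm (cnj (displace_elem x k i) * displace_elem x k j)) summable_on UNIV"
    using abs by (subst summable_on_UNIV_nonneg_real_iff) auto
qed

text \<open>\<open>D(x)|y\<rangle>\<close> is \<open>|x + y\<rangle>\<close> up to the phase \<open>exp (i Im (x y\<^sup>* ))\<close>.\<close>

definition displace_phase :: "complex \<Rightarrow> complex \<Rightarrow> complex" where
  "displace_phase x y = exp (\<i> * of_real (Im (x * cnj y)))"

lemma norm_displace_phase [simp]: "cmod (displace_phase x y) = 1"
  by (simp add: displace_phase_def)

lemma displace_elem_coherent:
  "((\<lambda>j. coherent_amp y j * displace_elem x k j) has_sum (displace_phase x y * coherent_amp (x + y) k)) UNIV"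
  and displace_elem_coherent_abs_summable:
  "(\<lambda>j. norm (coherent_amp y j * displace_elem x k j)) summable_on UNIV"
proof -
  define c where "c = exp (- complex_of_real ((cmod y)\<^sup>2 / 2)) * exp (- of_real ((cmod x)\<^sup>2 / 2)) / of_real (sqrt (fact k))"
  have eq: "coherent_amp y j * displace_elem x k j = c * (y ^ j / fact j * displace_num x k j)" for j
  proof -
    have s: "complex_of_real (sqrt (fact j)) * of_real (sqrt (fact j)) = fact j"
      by (simp flip: of_real_mult)
    show ?thesis unfolding coherent_amp_def displace_elem_def c_def s[symmetric] by (simp add: mult_ac)
  qed
  have "(\<lambda>j. coherent_amp y j * displace_elem x k j) sums (c * (exp (- cnj x * y) * (x + y) ^ k))"
    unfolding eq by (intro sums_mult displace_num_generating)
  also have "c * (exp (- cnj x * y) * (x + y) ^ k) = displace_phase x y * coherent_amp (x + y) k"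
  proof -
    have "- complex_of_real ((cmod y)\<^sup>2 / 2) + (- of_real ((cmod x)\<^sup>2 / 2)) + (- cnj x * y) =
        \<i> * of_real (Im (x * cnj y)) + (- of_real ((cmod (x + y))\<^sup>2 / 2))"
      unfolding cmod_power2 by (simp add: complex_eq_iff power2_eq_square algebra_simps) (simp add: field_simps)
    then have "exp (- complex_of_real ((cmod y)\<^sup>2 / 2)) * exp (- of_real ((cmod x)\<^sup>2 / 2)) * exp (- cnj x * y) =
        displace_phase x y * exp (- of_real ((cmod (x + y))\<^sup>2 / 2))"
      unfolding displace_phase_def exp_add[symmetric] by (rule arg_cong)
    then show ?thesis unfolding c_def coherent_amp_def by (simp add: field_simps)
  qed
  finally have s: "(\<lambda>j. coherent_amp y j * displace_elem x k j) sums (displace_phase x y * coherent_amp (x + y) k)" .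
  have abs: "summable (\<lambda>j. norm (coherent_amp y j * displace_elem x k j))"
  proof -
    have "cmod (coherent_amp y j * displace_elem x k j) = cmod c * cmod (y ^ j / fact j * displace_num x k j)" for j
      unfolding eq by (rule norm_mult)
    moreover have "summable (\<lambda>j. cmod (y ^ j / fact j * displace_num x k j))"
    proof (induction k)
      case 0
      have "cmod (y ^ j / fact j * displace_num x 0 j) = inverse (fact j) * (cmod x * cmod y) ^ j" for j
        by (simp add: norm_mult norm_divide norm_power power_mult_distrib field_simps)
      then show ?case using summable_exp[of "cmod x * cmod y"] by simp
    next
      case (Suc k)
      define f where "f j = y ^ j / fact j * (of_nat j * displace_num x k (j - 1))" for j
      have "f (Suc j) = y * (y ^ j / fact j * displace_num x k j)" for j
        unfolding f_def by (simp add: field_simps del: of_nat_Suc)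
      then have "cmod (f (Suc j)) = cmod y * cmod (y ^ j / fact j * displace_num x k j)" for j
        by (simp only: norm_mult)
      then have "summable (\<lambda>j. cmod (f (Suc j)))"
        using summable_mult[OF Suc.IH, of "cmod y"] by (simp only:)
      then have f: "summable (\<lambda>j. cmod (f j))" using summable_Suc_iff[of "\<lambda>j. cmod (f j)"] by simp
      show ?case
      proof (rule summable_comparison_test')
        show "summable (\<lambda>j. cmod x * cmod (y ^ j / fact j * displace_num x k j) + cmod (f j))"
          by (intro summable_add summable_mult Suc.IH f)
        fix j
        have "y ^ j / fact j * displace_num x (Suc k) j = x * (y ^ j / fact j * displace_num x k j) + f j"
          by (simp add: f_def algebra_simps)
        then show "norm (cmod (y ^ j / fact j * displace_num x (Suc k) j)) \<le>
            cmod x * cmod (y ^ j / fact j * displace_num x k j) + cmod (f j)"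
          by (simp add: norm_mult[symmetric] norm_triangle_ineq)
      qed
    qed
    ultimately show ?thesis by (simp add: summable_mult)
  qed
  show "((\<lambda>j. coherent_amp y j * displace_elem x k j) has_sum (displace_phase x y * coherent_amp (x + y) k)) UNIV"
    by (rule norm_summable_imp_has_sum[OF abs s])
  show "(\<lambda>j. norm (coherent_amp y j * displace_elem x k j)) summable_on UNIV"
    using abs by (subst summable_on_UNIV_nonneg_real_iff) auto
qed

section \<open>Displaced number states of several modes\<close>

text \<open>Induction on the number of modes, splitting off the last entry. Absolute summability is
  carried along because it licenses the passage to an iterated sum.\<close>

lemma has_sum_length_prod:
  fixes f :: "nat \<Rightarrow> 'a \<Rightarrow> 'b::{real_normed_field, banach}"
  assumes "\<And>i. i < n \<Longrightarrow> (f i has_sum s i) UNIV" "\<And>i. i < n \<Longrightarrow> (\<lambda>a. norm (f i a)) summable_on UNIV"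
  shows "((\<lambda>k. \<Prod>i<n. f i (k ! i)) has_sum (\<Prod>i<n. s i)) {k. length k = n}"
    and "(\<lambda>k. norm (\<Prod>i<n. f i (k ! i))) summable_on {k. length k = n}"
  using assms
proof (induction n)
  case 0
  { case 1 have "{k :: 'a list. length k = 0} = {[]}" by auto
    then show ?case by (simp add: has_sum_finiteI) }
  { case 2 have "{k :: 'a list. length k = 0} = {[]}" by auto
    then show ?case by simp }
next
  case (Suc n)
  let ?h = "\<lambda>(k, a). k @ [a]" and ?L = "{k :: 'a list. length k = n}"
  have bij: "bij_betw ?h (?L \<times> UNIV) {k. length k = Suc n}"
    by (rule bij_betwI[where g="\<lambda>k. (butlast k, last k)"])
       (auto simp: length_Suc_conv_rev)
  have eq: "(\<Prod>i<Suc n. f i (?h p ! i)) = (case p of (k, a) \<Rightarrow> (\<Prod>i<n. f i (k ! i)) * f n a)"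
    if "p \<in> ?L \<times> UNIV" for p
    using that by (auto simp: nth_append intro!: prod.cong)
  \<comment> \<open>Proved before case 1 and exported, since case 1 uses the absolute summability
    over the product set.\<close>
  { case 2
    have IH: "(\<lambda>k. norm (\<Prod>i<n. f i (k ! i))) summable_on ?L" using 2 by (intro Suc.IH) auto
    have n: "((\<lambda>a. norm (f n a)) has_sum (\<Sum>\<^sub>\<infinity>a. norm (f n a))) UNIV" using 2 by simp
    have "(\<lambda>p. norm (case p of (k, a) \<Rightarrow> (\<Prod>i<n. f i (k ! i)) * f n a)) summable_on ?L \<times> UNIV"
    proof (rule summable_on_SigmaI)
      fix k
      show "((\<lambda>a. norm (case (k, a) of (k, a) \<Rightarrow> (\<Prod>i<n. f i (k ! i)) * f n a)) has_sum
          (norm (\<Prod>i<n. f i (k ! i)) * (\<Sum>\<^sub>\<infinity>a. norm (f n a)))) UNIV"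
        using has_sum_cmult_right[OF n, of "norm (\<Prod>i<n. f i (k ! i))"] by (simp add: norm_mult)
    qed (auto intro: summable_on_cmult_left IH)
    then show ?case
      unfolding summable_on_reindex_bij_betw[OF bij, of "\<lambda>k. norm (\<Prod>i<Suc n. f i (k ! i))", symmetric]
      by (subst summable_on_cong[where g="\<lambda>p. norm (case p of (k, a) \<Rightarrow> (\<Prod>i<n. f i (k ! i)) * f n a)"])
         (simp_all only: eq)
    note abs = \<open>(\<lambda>p. norm (case p of (k, a) \<Rightarrow> (\<Prod>i<n. f i (k ! i)) * f n a)) summable_on ?L \<times> UNIV\<close> }
  note abs = this
  { case 1
    have IH: "((\<lambda>k. \<Prod>i<n. f i (k ! i)) has_sum (\<Prod>i<n. s i)) ?L" using 1 by (intro Suc.IH) auto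
    from 1 have "(\<lambda>p. norm (case p of (k, a) \<Rightarrow> (\<Prod>i<n. f i (k ! i)) * f n a)) summable_on ?L \<times> UNIV"
      by (rule abs)
    then have "(\<lambda>p. case p of (k, a) \<Rightarrow> (\<Prod>i<n. f i (k ! i)) * f n a) summable_on ?L \<times> UNIV"
      by (rule abs_summable_summable)
    then have "((\<lambda>p. case p of (k, a) \<Rightarrow> (\<Prod>i<n. f i (k ! i)) * f n a) has_sum ((\<Prod>i<n. s i) * s n)) (?L \<times> UNIV)"
    proof (rule has_sum_SigmaI[rotated 2])
      fix k
      show "((\<lambda>a. case (k, a) of (k, a) \<Rightarrow> (\<Prod>i<n. f i (k ! i)) * f n a) has_sum ((\<Prod>i<n. f i (k ! i)) * s n)) UNIV"
        using has_sum_cmult_right[OF 1(1)[of n]] by simp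
      show "((\<lambda>k. (\<Prod>i<n. f i (k ! i)) * s n) has_sum ((\<Prod>i<n. s i) * s n)) ?L"
        by (rule has_sum_cmult_left[OF IH])
    qed
    then have "((\<lambda>p. \<Prod>i<Suc n. f i (?h p ! i)) has_sum ((\<Prod>i<n. s i) * s n)) (?L \<times> UNIV)"
      by (subst has_sum_cong[where g="\<lambda>p. case p of (k, a) \<Rightarrow> (\<Prod>i<n. f i (k ! i)) * f n a"])
         (simp_all only: eq)
    then show ?case
      using has_sum_reindex_bij_betw[OF bij, of "\<lambda>k. \<Prod>i<Suc n. f i (k ! i)"] by simp }
qed

lemma tensor_ket_fock:
  assumes "\<And>i. i < n \<Longrightarrow> (\<lambda>k. norm (cnj (\<phi> i k) * \<phi> i k)) summable_on UNIV"
  shows "tensor_ket n \<phi> \<in> fock n"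
proof -
  have eq: "(cmod (\<Prod>i<n. \<phi> i (k ! i)))\<^sup>2 = norm (\<Prod>i<n. cnj (\<phi> i (k ! i)) * \<phi> i (k ! i))" for k
    by (simp add: norm_mult prod.distrib power2_eq_square flip: prod_norm)
  have "(\<lambda>k. norm (\<Prod>i<n. cnj (\<phi> i (k ! i)) * \<phi> i (k ! i))) summable_on {k. length k = n}"
    by (rule has_sum_length_prod(2)[where f="\<lambda>i k. cnj (\<phi> i k) * \<phi> i k", OF has_sum_infsum[OF abs_summable_summable]])
       (use assms in auto)
  then have "(\<lambda>k. (cmod (tensor_ket n \<phi> k))\<^sup>2) summable_on UNIV"
    by (subst summable_on_cong_neutral[where T="{k. length k = n}" and
          g="\<lambda>k. norm (\<Prod>i<n. cnj (\<phi> i (k ! i)) * \<phi> i (k ! i))"])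
       (auto simp: tensor_ket_def eq)
  then show ?thesis by (simp add: fock_def tensor_ket_def)
qed

lemma braket_tensor_ket:
  assumes "\<And>i. i < n \<Longrightarrow> ((\<lambda>k. cnj (\<phi> i k) * \<psi> i k) has_sum s i) UNIV"
    and "\<And>i. i < n \<Longrightarrow> (\<lambda>k. norm (cnj (\<phi> i k) * \<psi> i k)) summable_on UNIV"
  shows "braket (tensor_ket n \<phi>) (tensor_ket n \<psi>) = (\<Prod>i<n. s i)"
proof -
  have "braket (tensor_ket n \<phi>) (tensor_ket n \<psi>) =
      (\<Sum>\<^sub>\<infinity>k\<in>{k. length k = n}. \<Prod>i<n. cnj (\<phi> i (k ! i)) * \<psi> i (k ! i))"
    unfolding braket_def by (rule infsum_cong_neutral) (auto simp: tensor_ket_def prod.distrib)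
  also have "\<dots> = (\<Prod>i<n. s i)"
    using has_sum_length_prod(1)[where f="\<lambda>i k. cnj (\<phi> i k) * \<psi> i k", OF assms] by (rule infsumI)
  finally show ?thesis .
qed

definition coherent_ket :: "nat \<Rightarrow> (nat \<Rightarrow> complex) \<Rightarrow> ket" where
  "coherent_ket n x = tensor_ket n (\<lambda>i. coherent_amp (x i))"

definition displaced_ket :: "nat \<Rightarrow> (nat \<Rightarrow> complex) \<Rightarrow> nat list \<Rightarrow> ket" where
  "displaced_ket n x j = tensor_ket n (\<lambda>i k. displace_elem (x i) k (j ! i))"

lemma coherent_amp_abs_summable: "(\<lambda>k. norm (cnj (coherent_amp x k) * coherent_amp x k)) summable_on UNIV"
  using displace_elem_abs_summable[of x 0 0] by (simp add: displace_elem_0)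

lemma coherent_ket_fock: "coherent_ket n x \<in> fock n"
  unfolding coherent_ket_def by (intro tensor_ket_fock coherent_amp_abs_summable)

lemma ket_norm_coherent_ket [simp]: "ket_norm (coherent_ket n x) = 1"
proof -
  have "braket (coherent_ket n x) (coherent_ket n x) = (\<Prod>i<n. 1)"
    unfolding coherent_ket_def
    by (rule braket_tensor_ket)
       (use displace_elem_orthonormal[of _ 0 0] coherent_amp_abs_summable in \<open>auto simp: displace_elem_0\<close>)
  then have "(ket_norm (coherent_ket n x))\<^sup>2 = 1"
    by (simp add: braket_self flip: of_real_power)
  then show ?thesis using ket_norm_nonneg[of "coherent_ket n x"] by (auto simp: power2_eq_1_iff)
qed

lemma displaced_ket_orthonormal: "orthonormal_kets n {j. length j = n} (displaced_ket n x)"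
  unfolding orthonormal_kets_def
proof (intro conjI ballI)
  fix i j :: "nat list" assume "i \<in> {j. length j = n}" "j \<in> {j. length j = n}"
  then have "i = j \<longleftrightarrow> (\<forall>t<n. i ! t = j ! t)" by (auto simp: list_eq_iff_nth_eq)
  then have "(\<Prod>t<n. if i ! t = j ! t then 1 else 0) = (if i = j then 1 else 0 :: complex)" by auto
  moreover have "braket (displaced_ket n x i) (displaced_ket n x j) = (\<Prod>t<n. if i ! t = j ! t then 1 else 0)"
    unfolding displaced_ket_def by (rule braket_tensor_ket displace_elem_orthonormal displace_elem_abs_summable)+
  ultimately show "braket (displaced_ket n x i) (displaced_ket n x j) = (if i = j then 1 else 0)" by simp
qed (auto simp: displaced_ket_def intro: tensor_ket_fock displace_elem_abs_summable)

lemma displaced_ket_fock: "length j = n \<Longrightarrow> displaced_ket n x j \<in> fock n"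
  using orthonormal_ketsD(1)[OF displaced_ket_orthonormal] by simp

lemma displaced_ket_orthonormal_subset:
  "J \<subseteq> {j. length j = n} \<Longrightarrow> orthonormal_kets n J (displaced_ket n x)"
  using displaced_ket_orthonormal[of n x] unfolding orthonormal_kets_def by blast

definition displaced_phase :: "nat \<Rightarrow> (nat \<Rightarrow> complex) \<Rightarrow> (nat \<Rightarrow> complex) \<Rightarrow> complex" where
  "displaced_phase n x y = (\<Prod>i<n. displace_phase (- x i) (x i + y i))"

lemma norm_displaced_phase [simp]: "cmod (displaced_phase n x y) = 1"
  by (simp add: displaced_phase_def prod_norm[symmetric])

text \<open>The coefficients are matrix elements of D(x)^dagger = D(-x), which brings |x + y> back
  to |y> up to a phase.\<close>

lemma braket_displaced_coherent:
  assumes "length j = n"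
  shows "braket (displaced_ket n x j) (coherent_ket n (\<lambda>i. x i + y i)) = displaced_phase n x y * coherent_ket n y j"
proof -
  have "braket (displaced_ket n x j) (coherent_ket n (\<lambda>i. x i + y i)) =
      (\<Prod>i<n. displace_phase (- x i) (x i + y i) * coherent_amp (y i) (j ! i))"
    unfolding displaced_ket_def coherent_ket_def
  proof (rule braket_tensor_ket)
    fix i
    have eq: "cnj (displace_elem (x i) k (j ! i)) * coherent_amp (x i + y i) k =
        coherent_amp (x i + y i) k * displace_elem (- x i) (j ! i) k" for k
      using displace_elem_adjoint[of "- x i" "j ! i" k] by simp
    show "((\<lambda>k. cnj (displace_elem (x i) k (j ! i)) * coherent_amp (x i + y i) k) has_sum
        displace_phase (- x i) (x i + y i) * coherent_amp (y i) (j ! i)) UNIV"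
      unfolding eq using displace_elem_coherent[of "x i + y i" "- x i" "j ! i"] by simp
    show "(\<lambda>k. norm (cnj (displace_elem (x i) k (j ! i)) * coherent_amp (x i + y i) k)) summable_on UNIV"
      unfolding eq by (rule displace_elem_coherent_abs_summable)
  qed
  then show ?thesis
    using assms by (simp add: displaced_phase_def coherent_ket_def tensor_ket_def prod.distrib)
qed

text \<open>In the basis displaced by \<open>x\<close> the state |x + y> has the number amplitudes
  of |y> up to a common phase, so the truncation loss depends on \<open>y\<close> alone.\<close>

lemma coherent_residual:
  assumes "finite J" "J \<subseteq> {j. length j = n}"
  shows "(ket_norm (\<lambda>k. coherent_ket n (\<lambda>i. x i + y i) k -
      (\<Sum>j\<in>J. displaced_phase n x y * coherent_ket n y j * displaced_ket n x j k)))\<^sup>2 =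
    1 - (\<Sum>j\<in>J. (cmod (coherent_ket n y j))\<^sup>2)"
proof -
  have "(ket_norm (\<lambda>k. coherent_ket n (\<lambda>i. x i + y i) k -
      (\<Sum>j\<in>J. braket (displaced_ket n x j) (coherent_ket n (\<lambda>i. x i + y i)) * displaced_ket n x j k)))\<^sup>2 =
    (ket_norm (coherent_ket n (\<lambda>i. x i + y i)))\<^sup>2 -
    (\<Sum>j\<in>J. (cmod (braket (displaced_ket n x j) (coherent_ket n (\<lambda>i. x i + y i))))\<^sup>2)"
    by (rule orthonormal_kets_residual[OF displaced_ket_orthonormal_subset[OF assms(2)] assms(1) coherent_ket_fock])
  moreover have "braket (displaced_ket n x j) (coherent_ket n (\<lambda>i. x i + y i)) = displaced_phase n x y * coherent_ket n y j"
    if "j \<in> J" for j using that assms(2) by (intro braket_displaced_coherent) auto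
  ultimately show ?thesis by (simp add: norm_mult)
qed

lemma coherent_ket_has_sum: "((\<lambda>k. (cmod (coherent_ket n y k))\<^sup>2) has_sum 1) {k. length k = n}"
proof -
  have "((\<lambda>k. (cmod (coherent_ket n y k))\<^sup>2) has_sum (ket_norm (coherent_ket n y))\<^sup>2) UNIV"
    unfolding ket_norm_power2 using coherent_ket_fock[of n y] by (simp add: fock_def)
  then have "((\<lambda>k. (cmod (coherent_ket n y k))\<^sup>2) has_sum 1) UNIV" by simp
  then show ?thesis
    by (subst has_sum_cong_neutral[where T=UNIV and g="\<lambda>k. (cmod (coherent_ket n y k))\<^sup>2"])
       (auto simp: coherent_ket_def tensor_ket_def)
qed

section \<open>Gaussian amplitudes and thermal states\<close>

definition gauss :: "real \<Rightarrow> real measure" where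
  "gauss \<sigma> = density lborel (\<lambda>x. ennreal (normal_density 0 \<sigma> x))"

lemma sets_gauss [measurable_cong, simp]: "sets (gauss \<sigma>) = sets borel"
  by (simp add: gauss_def)

lemma space_gauss [simp]: "space (gauss \<sigma>) = UNIV"
  by (simp add: gauss_def)

lemma prob_space_gauss: "\<sigma> > 0 \<Longrightarrow> prob_space (gauss \<sigma>)"
  unfolding gauss_def by (rule prob_space_normal_density)

lemma integral_gauss:
  fixes f :: "real \<Rightarrow> 'a::{banach, second_countable_topology}"
  assumes "f \<in> borel_measurable borel"
  shows "integral\<^sup>L (gauss \<sigma>) f = (\<integral>x. normal_density 0 \<sigma> x *\<^sub>R f x \<partial>lborel)"
  unfolding gauss_def using assms by (intro integral_density) auto

lemma integrable_bounded_normal_density: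
  fixes f :: "real \<Rightarrow> 'a::{banach, second_countable_topology}"
  assumes "\<sigma> > 0" "f \<in> borel_measurable borel" "\<And>x. norm (f x) \<le> C"
  shows "integrable lborel (\<lambda>x. normal_density 0 \<sigma> x *\<^sub>R f x)"
proof (rule Bochner_Integration.integrable_bound)
  show "integrable lborel (\<lambda>x. C * normal_density 0 \<sigma> x)"
    using integrable_normal_density[OF assms(1)] by simp
  show "AE x in lborel. norm (normal_density 0 \<sigma> x *\<^sub>R f x) \<le> norm (C * normal_density 0 \<sigma> x)"
  proof (rule AE_I2)
    fix x
    have "norm (f x) \<le> \<bar>C\<bar>" using assms(3)[of x] by linarith
    then show "norm (normal_density 0 \<sigma> x *\<^sub>R f x) \<le> norm (C * normal_density 0 \<sigma> x)"
      by (simp add: abs_mult mult.commute[of "\<bar>C\<bar>"] mult_left_mono)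
  qed
qed (use assms(2) in measurable)

text \<open>Integration by parts against the density, whose derivative is - x / \<sigma>^2 times
  itself. Boundedness of \<open>h\<close> removes the boundary terms, and the other two bounds give
  integrability.\<close>

lemma stein_gauss:
  fixes h h' :: "real \<Rightarrow> complex"
  assumes \<sigma>: "\<sigma> > 0"
    and h: "\<And>x. (h has_vector_derivative h' x) (at x)" and h': "continuous_on UNIV h'"
    and bounded: "\<And>x. norm (h x) \<le> C" "\<And>x. norm (h' x) \<le> C" "\<And>x. norm (of_real x * h x) \<le> C"
  shows "integral\<^sup>L (gauss \<sigma>) h' = integral\<^sup>L (gauss \<sigma>) (\<lambda>x. of_real x * h x) / of_real (\<sigma>\<^sup>2)"
proof -
  let ?n = "normal_density 0 \<sigma>"
  have ch: "continuous_on UNIV h"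
    using h has_vector_derivative_continuous continuous_at_imp_continuous_on by blast
  note [measurable] = borel_measurable_continuous_onI[OF ch] borel_measurable_continuous_onI[OF h']
  define F where "F x = ?n x *\<^sub>R h x" for x
  define f where "f x = ?n x *\<^sub>R h' x - (?n x *\<^sub>R (of_real x * h x)) / of_real (\<sigma>\<^sup>2)" for x
  have dn: "(?n has_real_derivative (- x / \<sigma>\<^sup>2 * ?n x)) (at x)" for x
    unfolding normal_density_def using \<sigma> by (auto intro!: derivative_eq_intros simp: field_simps power2_eq_square)
  have F: "(F has_vector_derivative f x) (at x)" for x
    unfolding F_def f_def
    by (rule has_vector_derivative_eq_rhs[OF has_vector_derivative_scaleR[OF dn h]])
       (simp add: scaleR_conv_of_real field_simps)
  have i1: "integrable lborel (\<lambda>x. ?n x *\<^sub>R h' x)"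
    by (rule integrable_bounded_normal_density[OF \<sigma> _ bounded(2)]) simp
  have i2: "integrable lborel (\<lambda>x. ?n x *\<^sub>R (of_real x * h x))"
    by (rule integrable_bounded_normal_density[OF \<sigma> _ bounded(3)]) simp
  have int: "integrable lborel f" unfolding f_def by (intro Bochner_Integration.integrable_diff i1 integrable_divide i2)
  have cont_n: "continuous_on UNIV ?n" unfolding normal_density_def using \<sigma> by (intro continuous_intros) auto
  have lim: "(F \<longlongrightarrow> 0) G" if "(?n \<longlongrightarrow> 0) G" for G
  proof (rule Lim_null_comparison)
    show "((\<lambda>x. ?n x * C) \<longlongrightarrow> 0) G" by (rule tendsto_mult_left_zero[OF that])
    show "eventually (\<lambda>x. norm (F x) \<le> ?n x * C) G"
      by (rule always_eventually) (simp add: F_def bounded mult_left_mono)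
  qed
  have "(?n \<longlongrightarrow> 0) at_top" "(?n \<longlongrightarrow> 0) at_bot"
    unfolding normal_density_def using \<sigma> by real_asymp+
  then have FT: "(F \<longlongrightarrow> 0) at_top" and FB: "(F \<longlongrightarrow> 0) at_bot" by (auto intro: lim)
  have "(LBINT x=-\<infinity>..\<infinity>. f x) = 0 - 0"
  proof (rule interval_integral_FTC_integrable)
    show "((F \<circ> real_of_ereal) \<longlongrightarrow> 0) (at_right (- \<infinity>))"
      using FB by (simp add: at_right_MInf filterlim_def filtermap_filtermap comp_def)
    show "((F \<circ> real_of_ereal) \<longlongrightarrow> 0) (at_left \<infinity>)"
      using FT by (simp add: at_left_PInf filterlim_def filtermap_filtermap comp_def)
    show "isCont f x" for x
    proof -
      have "isCont h x" "isCont h' x" "isCont ?n x"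
        using ch h' cont_n by (simp_all add: continuous_on_eq_continuous_at)
      then show ?thesis unfolding f_def using \<sigma> by (intro continuous_intros) auto
    qed
  qed (use F int in \<open>auto simp: set_integrable_def einterval_def\<close>)
  then have "integral\<^sup>L lborel f = 0"
    by (simp add: interval_lebesgue_integral_def set_lebesgue_integral_def einterval_def)
  then have "(\<integral>x. ?n x *\<^sub>R h' x \<partial>lborel) - (\<integral>x. ?n x *\<^sub>R (of_real x * h x) \<partial>lborel) / of_real (\<sigma>\<^sup>2) = 0"
    unfolding f_def using i1 i2 by (subst (asm) Bochner_Integration.integral_diff) auto
  then show ?thesis by (simp add: integral_gauss)
qed

lemma gauss_convolution:
  assumes "\<sigma> > 0" "\<tau> > 0"
  shows "gauss \<sigma> \<star> gauss \<tau> = gauss (sqrt (\<sigma>\<^sup>2 + \<tau>\<^sup>2))"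
proof -
  interpret s: prob_space "gauss \<sigma>" by (rule prob_space_gauss[OF assms(1)])
  interpret t: prob_space "gauss \<tau>" by (rule prob_space_gauss[OF assms(2)])
  have "gauss \<sigma> \<star> gauss \<tau> = density lborel
      (\<lambda>x. \<integral>\<^sup>+y. ennreal (normal_density 0 \<sigma> (x - y)) * ennreal (normal_density 0 \<tau> y) \<partial>lborel)"
    unfolding gauss_def
    by (rule convolution_density) (use s.finite_measure_axioms t.finite_measure_axioms in \<open>auto simp: gauss_def\<close>)
  also have "\<dots> = gauss (sqrt (\<sigma>\<^sup>2 + \<tau>\<^sup>2))"
    using conv_normal_density_zero_mean[OF assms] by (simp add: gauss_def ennreal_mult'[symmetric])
  finally show ?thesis .
qed

text \<open>The exponential merely changes the variance to \<sigma>^2 / (1 - 2 s \<sigma>^2).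
  Positive \<open>s\<close> serves the Chernoff bounds, \<open>s = - 1\<close> the lowest moment of
  the coherent amplitudes.\<close>

lemma gauss_exp_moment:
  assumes "\<sigma> > 0" "2 * s * \<sigma>\<^sup>2 < 1"
  shows "(\<integral>\<^sup>+x. ennreal (exp (s * x\<^sup>2)) \<partial>gauss \<sigma>) = ennreal (1 / sqrt (1 - 2 * s * \<sigma>\<^sup>2))"
proof -
  define d where "d = 1 - 2 * s * \<sigma>\<^sup>2"
  have d: "d > 0" using assms by (simp add: d_def)
  define \<tau> where "\<tau> = \<sigma> / sqrt d"
  have \<tau>: "\<tau> > 0" using assms d by (simp add: \<tau>_def)
  have eq: "normal_density 0 \<sigma> x * exp (s * x\<^sup>2) = 1 / sqrt d * normal_density 0 \<tau> x" for x
  proof -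
    have "- x\<^sup>2 / (2 * \<sigma>\<^sup>2) + s * x\<^sup>2 = - x\<^sup>2 / (2 * \<tau>\<^sup>2)"
      using assms(1) d by (simp add: \<tau>_def power_divide d_def field_simps)
    then have "exp (- x\<^sup>2 / (2 * \<sigma>\<^sup>2)) * exp (s * x\<^sup>2) = exp (- x\<^sup>2 / (2 * \<tau>\<^sup>2))"
      by (simp flip: exp_add)
    moreover have "1 / sqrt (2 * pi * \<sigma>\<^sup>2) = 1 / sqrt d * (1 / sqrt (2 * pi * \<tau>\<^sup>2))"
      using assms(1) d by (simp add: \<tau>_def power_divide real_sqrt_mult real_sqrt_divide)
    ultimately show ?thesis unfolding normal_density_def by simp
  qed
  have "(\<integral>\<^sup>+x. ennreal (exp (s * x\<^sup>2)) \<partial>gauss \<sigma>) =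
      (\<integral>\<^sup>+x. ennreal (normal_density 0 \<sigma> x) * ennreal (exp (s * x\<^sup>2)) \<partial>lborel)"
    unfolding gauss_def by (subst nn_integral_density) auto
  also have "\<dots> = (\<integral>\<^sup>+x. ennreal (1 / sqrt d * normal_density 0 \<tau> x) \<partial>lborel)"
    by (simp only: ennreal_mult'[symmetric, OF normal_density_nonneg] eq)
  also have "\<dots> = ennreal (\<integral>x. 1 / sqrt d * normal_density 0 \<tau> x \<partial>lborel)"
    using \<tau> d by (intro nn_integral_eq_integral) auto
  also have "\<dots> = ennreal (1 / sqrt d)" using \<tau> by simp
  finally show ?thesis by (simp add: d_def)
qed

text \<open>Variance P/2 in each quadrature, so that |x|^2 has mean \<open>P\<close>.\<close>

definition complex_gauss :: "real \<Rightarrow> complex measure" where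
  "complex_gauss P = distr (gauss (sqrt (P / 2)) \<Otimes>\<^sub>M gauss (sqrt (P / 2))) borel
     (\<lambda>(a, b). of_real a + \<i> * of_real b)"

lemma sets_complex_gauss [measurable_cong, simp]: "sets (complex_gauss P) = sets borel"
  by (simp add: complex_gauss_def)

lemma space_complex_gauss [simp]: "space (complex_gauss P) = UNIV"
  by (simp add: complex_gauss_def)

context
  fixes P :: real
  assumes P: "P > 0"
begin

interpretation G: prob_space "gauss (sqrt (P / 2))"
  using P by (intro prob_space_gauss) simp

interpretation GG: pair_prob_space "gauss (sqrt (P / 2))" "gauss (sqrt (P / 2))" ..

lemma prob_space_complex_gauss: "prob_space (complex_gauss P)"
  unfolding complex_gauss_def by (rule GG.prob_space_distr) measurable

lemma nn_integral_complex_gauss: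
  assumes [measurable]: "f \<in> borel_measurable borel"
  shows "(\<integral>\<^sup>+x. f x \<partial>complex_gauss P) =
    (\<integral>\<^sup>+a. \<integral>\<^sup>+b. f (of_real a + \<i> * of_real b) \<partial>gauss (sqrt (P / 2)) \<partial>gauss (sqrt (P / 2)))"
  unfolding complex_gauss_def
  by (simp add: nn_integral_distr G.nn_integral_fst[symmetric] split_beta')

text \<open>Both orders of integration are provided, because the Stein identity is applied in one
  quadrature while the other is held fixed.\<close>

lemma integral_complex_gauss:
  fixes f :: "complex \<Rightarrow> complex"
  assumes [measurable]: "f \<in> borel_measurable borel" and bounded: "\<And>x. norm (f x) \<le> C"
  shows "(\<integral>x. f x \<partial>complex_gauss P) =
      (\<integral>a. \<integral>b. f (of_real a + \<i> * of_real b) \<partial>gauss (sqrt (P / 2)) \<partial>gauss (sqrt (P / 2)))"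
    and "(\<integral>x. f x \<partial>complex_gauss P) =
      (\<integral>b. \<integral>a. f (of_real a + \<i> * of_real b) \<partial>gauss (sqrt (P / 2)) \<partial>gauss (sqrt (P / 2)))"
proof -
  have int: "integrable (gauss (sqrt (P / 2)) \<Otimes>\<^sub>M gauss (sqrt (P / 2))) (\<lambda>(a, b). f (of_real a + \<i> * of_real b))"
    by (rule GG.integrable_const_bound[where B=C]) (auto simp: bounded split_beta')
  have 1: "(\<integral>x. f x \<partial>complex_gauss P) = (\<integral>p. (case p of (a, b) \<Rightarrow> f (of_real a + \<i> * of_real b)) \<partial>(gauss (sqrt (P / 2)) \<Otimes>\<^sub>M gauss (sqrt (P / 2))))"
    unfolding complex_gauss_def by (subst integral_distr) (auto simp: split_beta')
  show "(\<integral>x. f x \<partial>complex_gauss P) =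
      (\<integral>a. \<integral>b. f (of_real a + \<i> * of_real b) \<partial>gauss (sqrt (P / 2)) \<partial>gauss (sqrt (P / 2)))"
    unfolding 1 using GG.integral_fst'[OF int] by simp
  show "(\<integral>x. f x \<partial>complex_gauss P) =
      (\<integral>b. \<integral>a. f (of_real a + \<i> * of_real b) \<partial>gauss (sqrt (P / 2)) \<partial>gauss (sqrt (P / 2)))"
    unfolding 1 using GG.integral_snd[OF int] by simp
qed

lemma complex_gauss_exp_moment:
  assumes "s * P < 1"
  shows "(\<integral>\<^sup>+x. ennreal (exp (s * (cmod x)\<^sup>2)) \<partial>complex_gauss P) = ennreal (1 / (1 - s * P))"
proof -
  let ?\<sigma> = "sqrt (P / 2)"
  have g: "(\<integral>\<^sup>+a. ennreal (exp (s * a\<^sup>2)) \<partial>gauss ?\<sigma>) = ennreal (1 / sqrt (1 - s * P))"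
    using gauss_exp_moment[of ?\<sigma> s] P assms by simp
  have "(\<integral>\<^sup>+x. ennreal (exp (s * (cmod x)\<^sup>2)) \<partial>complex_gauss P) =
      (\<integral>\<^sup>+a. \<integral>\<^sup>+b. ennreal (exp (s * a\<^sup>2)) * ennreal (exp (s * b\<^sup>2)) \<partial>gauss ?\<sigma> \<partial>gauss ?\<sigma>)"
    by (subst nn_integral_complex_gauss)
       (auto simp: cmod_power2 distrib_left exp_add ennreal_mult)
  also have "\<dots> = ennreal (1 / sqrt (1 - s * P)) * ennreal (1 / sqrt (1 - s * P))"
    by (simp add: nn_integral_cmult nn_integral_multc g)
  also have "\<dots> = ennreal (1 / (1 - s * P))"
    using assms by (simp flip: ennreal_mult')
  finally show ?thesis .
qed

end

text \<open>The quadratures are independent, so the real convolution identity applies to each of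
  them separately.\<close>

lemma complex_gauss_convolution:
  assumes "P > 0" "Q > 0"
  shows "distr (complex_gauss P \<Otimes>\<^sub>M complex_gauss Q) borel (\<lambda>(x, y). x + y) = complex_gauss (P + Q)"
proof (rule measure_eqI)
  interpret P: prob_space "complex_gauss P" by (rule prob_space_complex_gauss[OF assms(1)])
  interpret Q: prob_space "complex_gauss Q" by (rule prob_space_complex_gauss[OF assms(2)])
  interpret p: prob_space "gauss (sqrt (P / 2))" using assms by (intro prob_space_gauss) simp
  interpret q: prob_space "gauss (sqrt (Q / 2))" using assms by (intro prob_space_gauss) simp
  interpret pq: pair_sigma_finite "gauss (sqrt (P / 2))" "gauss (sqrt (Q / 2))" ..
  let ?p = "gauss (sqrt (P / 2))" and ?q = "gauss (sqrt (Q / 2))" and ?r = "gauss (sqrt ((P + Q) / 2))"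
  have conv: "?p \<star> ?q = ?r" using gauss_convolution[of "sqrt (P / 2)" "sqrt (Q / 2)"] assms by (simp add: add_divide_distrib)
  fix A assume "A \<in> sets (distr (complex_gauss P \<Otimes>\<^sub>M complex_gauss Q) borel (\<lambda>(x, y). x + y))"
  then have [measurable]: "A \<in> sets borel" by simp
  define f :: "complex \<Rightarrow> ennreal" where "f = indicator A"
  have [measurable]: "f \<in> borel_measurable borel" by (simp add: f_def)
  have c: "(\<integral>\<^sup>+b. \<integral>\<^sup>+b'. h (b + b') \<partial>?q \<partial>?p) = (\<integral>\<^sup>+b. h b \<partial>?r)" if [measurable]: "h \<in> borel_measurable borel" for h
    unfolding conv[symmetric]
    by (rule nn_integral_convolution[symmetric]) (simp_all add: p.finite_measure_axioms q.finite_measure_axioms)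
  have "(\<integral>\<^sup>+x. f x \<partial>distr (complex_gauss P \<Otimes>\<^sub>M complex_gauss Q) borel (\<lambda>(x, y). x + y)) = (\<integral>\<^sup>+x. \<integral>\<^sup>+y. f (x + y) \<partial>complex_gauss Q \<partial>complex_gauss P)"
    by (simp add: nn_integral_distr Q.nn_integral_fst[symmetric] split_beta')
  also have "\<dots> = (\<integral>\<^sup>+a. \<integral>\<^sup>+b. \<integral>\<^sup>+a'. \<integral>\<^sup>+b'. f (of_real a + \<i> * of_real b + (of_real a' + \<i> * of_real b')) \<partial>?q \<partial>?q \<partial>?p \<partial>?p)"
    by (subst nn_integral_complex_gauss[OF assms(2)], measurable)
       (subst nn_integral_complex_gauss[OF assms(1)], measurable)
  \<comment> \<open>The inner integrations are reordered so that each quadrature of the first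
    variable stands next to the same quadrature of the second.\<close>
  also have "\<dots> = (\<integral>\<^sup>+a. \<integral>\<^sup>+a'. \<integral>\<^sup>+b. \<integral>\<^sup>+b'. f (of_real a + \<i> * of_real b + (of_real a' + \<i> * of_real b')) \<partial>?q \<partial>?p \<partial>?q \<partial>?p)"
    by (intro nn_integral_cong pq.Fubini'[symmetric]) measurable
  also have "\<dots> = (\<integral>\<^sup>+a. \<integral>\<^sup>+a'. \<integral>\<^sup>+b. \<integral>\<^sup>+b'. f (of_real (a + a') + \<i> * of_real (b + b')) \<partial>?q \<partial>?p \<partial>?q \<partial>?p)"
    by (simp add: algebra_simps)
  also have "\<dots> = (\<integral>\<^sup>+a. \<integral>\<^sup>+a'. \<integral>\<^sup>+b. f (of_real (a + a') + \<i> * of_real b) \<partial>?r \<partial>?q \<partial>?p)"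
    by (intro nn_integral_cong c) measurable
  also have "\<dots> = (\<integral>\<^sup>+a. \<integral>\<^sup>+b. f (of_real a + \<i> * of_real b) \<partial>?r \<partial>?r)"
  proof (rule c)
    interpret r: prob_space ?r using assms by (intro prob_space_gauss) simp
    show "(\<lambda>a. \<integral>\<^sup>+b. f (of_real a + \<i> * of_real b) \<partial>?r) \<in> borel_measurable borel" by measurable
  qed
  also have "\<dots> = (\<integral>\<^sup>+x. f x \<partial>complex_gauss (P + Q))"
    using assms by (intro nn_integral_complex_gauss[symmetric]) auto
  finally show "emeasure (distr (complex_gauss P \<Otimes>\<^sub>M complex_gauss Q) borel (\<lambda>(x, y). x + y)) A = emeasure (complex_gauss (P + Q)) A"
    by (simp add: f_def)
qed simp

text \<open>The geometric distribution of mean \<open>P\<close>: the spectrum of the thermal state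
  with \<open>P\<close> photons on average.\<close>

definition thermal :: "real \<Rightarrow> nat \<Rightarrow> real" where
  "thermal P k = P ^ k / (P + 1) ^ Suc k"

section \<open>Gaussian moments of coherent amplitudes\<close>

lemma power_exp_minus_square_le:
  fixes r :: real
  assumes "0 \<le> r"
  shows "r ^ m * exp (- r\<^sup>2) \<le> 1 + fact m"
proof -
  have "(\<Sum>k\<in>{m}. (r\<^sup>2) ^ k /\<^sub>R fact k) \<le> exp (r\<^sup>2)"
    using summable_exp_generic[of "r\<^sup>2"] unfolding exp_def by (intro sum_le_suminf) auto
  then have 1: "r ^ m * r ^ m \<le> fact m * exp (r\<^sup>2)"
    by (simp add: divide_simps power2_eq_square power_mult_distrib mult.commute)
  have "r ^ m \<le> 1 + r ^ m * r ^ m"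
    using zero_le_power2[of "r ^ m - 1/2"] by (simp add: power2_eq_square algebra_simps)
  also have "\<dots> \<le> 1 * exp (r\<^sup>2) + fact m * exp (r\<^sup>2)" using 1 by (simp add: add_mono)
  finally have "r ^ m \<le> (1 + fact m) * exp (r\<^sup>2)" by (simp add: distrib_right)
  then show ?thesis by (simp add: exp_minus divide_simps)
qed

context
  fixes P :: real
  assumes P: "P > 0"
begin

text \<open>The product \<open>cnj (coherent_amp x i) * coherent_amp x j\<close> without its factor
  1 / sqrt(i! j!).\<close>

definition gauss_weight :: "nat \<Rightarrow> nat \<Rightarrow> complex \<Rightarrow> complex" where
  "gauss_weight i j x = exp (- of_real ((cmod x)\<^sup>2)) * cnj x ^ i * x ^ j"

lemma norm_gauss_weight_le: "cmod (gauss_weight i j x) \<le> 1 + fact (i + j)"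
proof -
  have "cmod (gauss_weight i j x) = cmod x ^ (i + j) * exp (- (cmod x)\<^sup>2)"
    by (simp add: gauss_weight_def norm_mult norm_power power_add mult_ac)
  then show ?thesis using power_exp_minus_square_le[of "cmod x" "i + j"] by simp
qed

lemma continuous_gauss_weight: "continuous_on UNIV (gauss_weight i j)"
  unfolding gauss_weight_def by (intro continuous_intros)

lemma measurable_gauss_weight [measurable]: "gauss_weight i j \<in> borel_measurable borel"
  by (rule borel_measurable_continuous_onI[OF continuous_gauss_weight])

lemma gauss_weight_mult: "x * gauss_weight i j x = gauss_weight i (Suc j) x" "cnj x * gauss_weight i j x = gauss_weight (Suc i) j x"
  by (simp_all add: gauss_weight_def)

text \<open>The derivative of \<^const>\<open>gauss_weight\<close> along \<open>d \<in> {1, \<i>}\<close>.\<close>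

definition gauss_weight_deriv :: "complex \<Rightarrow> nat \<Rightarrow> nat \<Rightarrow> complex \<Rightarrow> complex" where
  "gauss_weight_deriv d i j x = of_nat i * cnj d * gauss_weight (i - 1) j x + of_nat j * d * gauss_weight i (j - 1) x
     - (d * gauss_weight (Suc i) j x + cnj d * gauss_weight i (Suc j) x)"

lemma gauss_weight_has_derivative:
  "((\<lambda>t. gauss_weight i j (c + d * of_real t)) has_vector_derivative gauss_weight_deriv d i j (c + d * of_real t)) (at t)"
proof -
  let ?x = "\<lambda>t. c + d * of_real t"
  have x: "(?x has_vector_derivative d) (at t)"
    by (auto intro!: derivative_eq_intros)
  have cx: "((\<lambda>t. cnj (?x t)) has_vector_derivative cnj d) (at t)"
    using has_vector_derivative_cnj[OF x] by simp
  have e: "exp (- of_real ((cmod (?x t))\<^sup>2)) = exp (- (?x t * cnj (?x t)))" for t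
    by (simp add: complex_norm_square del: of_real_power)
  have mult: "((\<lambda>t. f t * g t) has_vector_derivative (f t * g' + f' * g t)) (at t)"
    if "(f has_vector_derivative f') (at t)" "(g has_vector_derivative g') (at t)" for f g :: "real \<Rightarrow> complex" and f' g'
    by (rule has_vector_derivative_mult[OF that])
  have pow: "((\<lambda>t. f t ^ m) has_vector_derivative (of_nat m * f t ^ (m - 1) * f')) (at t)"
    if "(f has_vector_derivative f') (at t)" for f :: "real \<Rightarrow> complex" and f' m
    using field_vector_diff_chain_at[OF that DERIV_power[OF DERIV_ident], of m] by (simp add: comp_def mult_ac)
  have "((\<lambda>t. - (?x t * cnj (?x t))) has_vector_derivative (- (?x t * cnj d + d * cnj (?x t)))) (at t)"
    by (intro has_vector_derivative_minus mult x cx)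
  then have ex: "((\<lambda>t. exp (- (?x t * cnj (?x t)))) has_vector_derivative
      ((- (?x t * cnj d + d * cnj (?x t))) * exp (- (?x t * cnj (?x t))))) (at t)"
    using field_vector_diff_chain_at[OF _ DERIV_exp] by (simp add: comp_def)
  have "((\<lambda>t. exp (- (?x t * cnj (?x t))) * cnj (?x t) ^ i * ?x t ^ j) has_vector_derivative
      gauss_weight_deriv d i j (?x t)) (at t)"
    by (rule has_vector_derivative_eq_rhs[OF mult[OF mult[OF ex pow[OF cx]] pow[OF x]]])
       (simp only: gauss_weight_deriv_def gauss_weight_def e, simp add: algebra_simps)
  then show ?thesis unfolding gauss_weight_def e .
qed

lemma continuous_gauss_weight_deriv: "continuous_on UNIV (\<lambda>t. gauss_weight_deriv d i j (c + d * of_real t))"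
  unfolding gauss_weight_deriv_def gauss_weight_def by (intro continuous_intros)

lemma norm_gauss_weight_deriv_le:
  assumes "cmod d = 1"
  shows "cmod (gauss_weight_deriv d i j x) \<le>
    real i * (1 + fact (i - 1 + j)) + real j * (1 + fact (i + (j - 1))) + ((1 + fact (Suc i + j)) + (1 + fact (i + Suc j)))"
proof -
  have "cmod (gauss_weight_deriv d i j x) \<le>
      cmod (of_nat i * cnj d * gauss_weight (i - 1) j x) + cmod (of_nat j * d * gauss_weight i (j - 1) x) +
      (cmod (d * gauss_weight (Suc i) j x) + cmod (cnj d * gauss_weight i (Suc j) x))"
    unfolding gauss_weight_deriv_def by (intro norm_triangle_le norm_triangle_le_diff add_mono norm_triangle_ineq order_refl)
  also have "\<dots> \<le> real i * (1 + fact (i - 1 + j)) + real j * (1 + fact (i + (j - 1))) + ((1 + fact (Suc i + j)) + (1 + fact (i + Suc j)))"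
    unfolding norm_mult complex_mod_cnj assms
    by (intro add_mono) (auto simp del: fact_Suc add_Suc add_Suc_right intro!: mult_left_mono norm_gauss_weight_le)
  finally show ?thesis .
qed

text \<open>Stein's identity in the two quadratures, combined with the weights 1 and i, reads E[x f]
  = P E[df / d(cnj x)]. For the weight f with indices i, j this derivative is i times the weight
  with i lowered, minus x f itself; the relation is then solved for E[x f].\<close>

lemma complex_gauss_stein:
  "(\<integral>x. gauss_weight i (Suc j) x \<partial>complex_gauss P) = of_nat i * of_real (P / (P + 1)) * (\<integral>x. gauss_weight (i - 1) j x \<partial>complex_gauss P)"
proof -
  let ?\<sigma> = "sqrt (P / 2)"
  interpret prob_space "complex_gauss P" by (rule prob_space_complex_gauss[OF P])
  obtain C where C: "\<And>x d. cmod d = 1 \<Longrightarrow> cmod (gauss_weight_deriv d i j x) \<le> C"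
    using norm_gauss_weight_deriv_le by blast
  have bd: "cmod (of_real (Re x) * gauss_weight i j x) \<le> 1 + fact (Suc (i + j))"
    "cmod (of_real (Im x) * gauss_weight i j x) \<le> 1 + fact (Suc (i + j))" for x
  proof -
    have "cmod x * cmod (gauss_weight i j x) \<le> 1 + fact (Suc (i + j))"
      using norm_gauss_weight_le[of i "Suc j" x] by (simp add: norm_mult flip: gauss_weight_mult)
    then show "cmod (of_real (Re x) * gauss_weight i j x) \<le> 1 + fact (Suc (i + j))"
      "cmod (of_real (Im x) * gauss_weight i j x) \<le> 1 + fact (Suc (i + j))"
      using mult_right_mono[OF abs_Re_le_cmod[of x] norm_ge_zero[of "gauss_weight i j x"]]
        mult_right_mono[OF abs_Im_le_cmod[of x] norm_ge_zero[of "gauss_weight i j x"]]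
      by (auto simp: norm_mult)
  qed
  define K where "K = max C (max (1 + fact (i + j)) (1 + fact (Suc (i + j))))"
  have K: "cmod d = 1 \<Longrightarrow> cmod (gauss_weight_deriv d i j x) \<le> K"
    "cmod (gauss_weight i j x) \<le> K"
    "cmod (of_real (Re x) * gauss_weight i j x) \<le> K"
    "cmod (of_real (Im x) * gauss_weight i j x) \<le> K" for x d
    unfolding K_def using C norm_gauss_weight_le[of i j x] bd[of x]
    by (simp_all only: le_max_iff_disj simp_thms)
  have m: "gauss_weight_deriv d i j \<in> borel_measurable borel" for d
    unfolding gauss_weight_deriv_def by measurable
  have re: "(\<integral>x. gauss_weight_deriv 1 i j x \<partial>complex_gauss P) = 2 / of_real P * (\<integral>x. of_real (Re x) * gauss_weight i j x \<partial>complex_gauss P)"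
  proof -
    have "(\<integral>a. gauss_weight_deriv 1 i j (of_real a + \<i> * of_real b) \<partial>gauss ?\<sigma>) =
        2 / of_real P * (\<integral>a. of_real a * gauss_weight i j (of_real a + \<i> * of_real b) \<partial>gauss ?\<sigma>)" for b
    proof -
      have x: "complex_of_real a + \<i> * of_real b = \<i> * of_real b + 1 * of_real a" for a by simp
      have "(\<integral>a. gauss_weight_deriv 1 i j (of_real a + \<i> * of_real b) \<partial>gauss ?\<sigma>) =
        (\<integral>a. of_real a * gauss_weight i j (of_real a + \<i> * of_real b) \<partial>gauss ?\<sigma>) / of_real (?\<sigma>\<^sup>2)"
        unfolding x
        by (rule stein_gauss[where C=K, OF _ gauss_weight_has_derivative continuous_gauss_weight_deriv])
           (use P K(1,2) K(3)[of "\<i> * of_real b + of_real _"] in auto)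
      then show ?thesis using P by (simp add: field_simps)
    qed
    then show ?thesis
      using integral_complex_gauss(2)[OF P m C[of 1]] integral_complex_gauss(2)[OF P _ bd(1)] by simp
  qed
  have im: "(\<integral>x. gauss_weight_deriv \<i> i j x \<partial>complex_gauss P) = 2 / of_real P * (\<integral>x. of_real (Im x) * gauss_weight i j x \<partial>complex_gauss P)"
  proof -
    have "(\<integral>b. gauss_weight_deriv \<i> i j (of_real a + \<i> * of_real b) \<partial>gauss ?\<sigma>) =
        2 / of_real P * (\<integral>b. of_real b * gauss_weight i j (of_real a + \<i> * of_real b) \<partial>gauss ?\<sigma>)" for a
    proof -
      have "(\<integral>b. gauss_weight_deriv \<i> i j (of_real a + \<i> * of_real b) \<partial>gauss ?\<sigma>) =
        (\<integral>b. of_real b * gauss_weight i j (of_real a + \<i> * of_real b) \<partial>gauss ?\<sigma>) / of_real (?\<sigma>\<^sup>2)"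
        by (rule stein_gauss[where C=K, OF _ gauss_weight_has_derivative continuous_gauss_weight_deriv])
           (use P K(1,2) K(4)[of "of_real a + \<i> * of_real _"] in auto)
      then show ?thesis using P by (simp add: field_simps)
    qed
    then show ?thesis
      using integral_complex_gauss(1)[OF P m C[of \<i>]] integral_complex_gauss(1)[OF P _ bd(2)] by simp
  qed
  have int: "integrable (complex_gauss P) (gauss_weight i j)" for i j
    by (rule integrable_const_bound[where B="1 + fact (i + j)"]) (auto simp: norm_gauss_weight_le)
  have intr: "integrable (complex_gauss P) (\<lambda>x. of_real (Re x) * gauss_weight i j x)"
    "integrable (complex_gauss P) (\<lambda>x. of_real (Im x) * gauss_weight i j x)"
    by (rule integrable_const_bound[where B="1 + fact (Suc (i + j))"], use bd in auto)+
  have intd: "integrable (complex_gauss P) (gauss_weight_deriv d i j)" for d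
    unfolding gauss_weight_deriv_def by (intro Bochner_Integration.integrable_diff Bochner_Integration.integrable_add integrable_mult_right int)
  let ?A = "\<lambda>i j. \<integral>x. gauss_weight i j x \<partial>complex_gauss P"
  have "(\<integral>x. gauss_weight_deriv 1 i j x + \<i> * gauss_weight_deriv \<i> i j x \<partial>complex_gauss P) =
      2 / of_real P * (\<integral>x. of_real (Re x) * gauss_weight i j x + \<i> * (of_real (Im x) * gauss_weight i j x) \<partial>complex_gauss P)"
    using intd intr by (simp add: re im distrib_left mult_ac)
  also have "(\<lambda>x. of_real (Re x) * gauss_weight i j x + \<i> * (of_real (Im x) * gauss_weight i j x)) = gauss_weight i (Suc j)"
    by (simp add: fun_eq_iff flip: gauss_weight_mult distrib_right mult.assoc complex_eq)
  also have "(\<lambda>x. gauss_weight_deriv 1 i j x + \<i> * gauss_weight_deriv \<i> i j x) =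
      (\<lambda>x. 2 * of_nat i * gauss_weight (i - 1) j x - 2 * gauss_weight i (Suc j) x)"
    by (simp add: fun_eq_iff gauss_weight_deriv_def algebra_simps)
  finally have "2 * of_nat i * ?A (i - 1) j - 2 * ?A i (Suc j) = 2 / of_real P * ?A i (Suc j)"
    using int by simp
  then have "2 * (of_nat i * of_real P * ?A (i - 1) j) = 2 * (of_real (P + 1) * ?A i (Suc j))"
    using P by (simp add: field_simps)
  then have "of_nat i * of_real P * ?A (i - 1) j = of_real (P + 1) * ?A i (Suc j)"
    by (simp only: mult_cancel_left) simp
  moreover have "complex_of_real (P + 1) \<noteq> 0" using P by (simp only: of_real_eq_0_iff)
  ultimately have "?A i (Suc j) = of_nat i * of_real P * ?A (i - 1) j / of_real (P + 1)"
    by (simp add: eq_divide_eq mult.commute del: of_real_add)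
  then show ?thesis by (simp add: mult_ac)
qed

text \<open>Each Stein step lowers both indices. Unequal indices end in a factor 0, and hermitian
  symmetry covers the case \<open>j = 0\<close>.\<close>

lemma complex_gauss_moment:
  "(\<integral>x. gauss_weight i j x \<partial>complex_gauss P) = (if i = j then of_real (fact i * P ^ i / (P + 1) ^ Suc i) else 0)"
proof -
  interpret prob_space "complex_gauss P" by (rule prob_space_complex_gauss[OF P])
  let ?A = "\<lambda>i j. \<integral>x. gauss_weight i j x \<partial>complex_gauss P"
  have A00: "?A 0 0 = of_real (1 / (P + 1))"
  proof -
    have "(\<integral>x. exp (- (cmod x)\<^sup>2) \<partial>complex_gauss P) = 1 / (1 + P)"
      using complex_gauss_exp_moment[OF P, of "-1"] P
      by (subst integral_eq_nn_integral) auto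
    moreover have "gauss_weight 0 0 = (\<lambda>x. complex_of_real (exp (- (cmod x)\<^sup>2)))"
      by (simp add: gauss_weight_def fun_eq_iff exp_of_real[symmetric] del: exp_of_real)
    ultimately show ?thesis by (simp add: add.commute)
  qed
  have A_cnj: "?A i j = cnj (?A j i)" for i j
  proof -
    have "gauss_weight i j = (\<lambda>x. cnj (gauss_weight j i x))"
      by (simp add: gauss_weight_def fun_eq_iff exp_cnj)
    then show ?thesis by (simp only: Bochner_Integration.integral_cnj)
  qed
  show ?thesis
  proof (induction j arbitrary: i)
    case 0
    show ?case
    proof (cases i)
      case (Suc i')
      then show ?thesis using A_cnj[of i 0] complex_gauss_stein[of 0 i'] by simp
    qed (simp add: A00)
  next
    case (Suc j)
    show ?case
    proof (cases i)
      case 0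
      then show ?thesis using complex_gauss_stein[of 0 j] by simp
    next
      case (Suc i')
      then show ?thesis using complex_gauss_stein[of i j] Suc.IH[of i'] P by (simp add: mult_ac)
    qed
  qed
qed

lemma complex_gauss_coherent:
  "(\<integral>x. cnj (coherent_amp x i) * coherent_amp x j \<partial>complex_gauss P) = (if i = j then of_real (thermal P i) else 0)"
proof -
  have "cnj (coherent_amp x i) * coherent_amp x j = gauss_weight i j x / of_real (sqrt (fact i) * sqrt (fact j))" for x
  proof -
    have e: "exp (- complex_of_real ((cmod x)\<^sup>2 / 2)) * exp (- of_real ((cmod x)\<^sup>2 / 2)) = exp (- of_real ((cmod x)\<^sup>2))"
      by (simp flip: exp_add)
    have "cnj (coherent_amp x i) * coherent_amp x j =
        (exp (- complex_of_real ((cmod x)\<^sup>2 / 2)) * exp (- of_real ((cmod x)\<^sup>2 / 2))) * cnj x ^ i * x ^ j /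
        of_real (sqrt (fact i) * sqrt (fact j))"
      by (simp add: coherent_amp_def exp_cnj mult_ac)
    then show ?thesis unfolding e gauss_weight_def .
  qed
  then have "(\<integral>x. cnj (coherent_amp x i) * coherent_amp x j \<partial>complex_gauss P) =
      (\<integral>x. gauss_weight i j x \<partial>complex_gauss P) / of_real (sqrt (fact i) * sqrt (fact j))"
    by (simp only: integral_divide_zero)
  moreover have "complex_of_real (sqrt (fact j) * sqrt (fact j)) = fact j" by simp
  ultimately show ?thesis unfolding complex_gauss_moment thermal_def by (auto simp del: of_real_mult simp: of_real_mult[of "fact _"])
qed

end

section \<open>Random codebooks\<close>

lemma nn_integral_PiM_component:
  assumes "prob_space A" "i \<in> I" and [measurable]: "f \<in> borel_measurable A"
  shows "(\<integral>\<^sup>+X. f (X i) \<partial>PiM I (\<lambda>_. A)) = (\<integral>\<^sup>+x. f x \<partial>A)"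
proof -
  interpret A: prob_space A by fact
  interpret product_prob_space "\<lambda>_. A" I by unfold_locales
  have "(\<integral>\<^sup>+x. f x \<partial>A) = (\<integral>\<^sup>+x. f x \<partial>distr (PiM I (\<lambda>_. A)) A (\<lambda>X. X i))"
    by (simp add: PiM_component[OF assms(2)])
  also have "\<dots> = (\<integral>\<^sup>+X. f (X i) \<partial>PiM I (\<lambda>_. A))"
    using assms(2) by (intro nn_integral_distr) auto
  finally show ?thesis ..
qed

lemma nn_integral_PiM_two_components:
  assumes "prob_space A" "i \<in> I" "j \<in> I" "i \<noteq> j" and [measurable]: "f \<in> borel_measurable (A \<Otimes>\<^sub>M A)"
  shows "(\<integral>\<^sup>+X. f (X i, X j) \<partial>PiM I (\<lambda>_. A)) = (\<integral>\<^sup>+x. \<integral>\<^sup>+y. f (x, y) \<partial>A \<partial>A)"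
proof -
  interpret A: prob_space A by fact
  interpret product_prob_space "\<lambda>_. A" I by unfold_locales
  have [measurable]: "(\<lambda>X. (X i, X j)) \<in> PiM I (\<lambda>_. A) \<rightarrow>\<^sub>M A \<Otimes>\<^sub>M A"
    using assms by (intro measurable_Pair measurable_component_singleton)
  have "A \<Otimes>\<^sub>M A = distr (PiM I (\<lambda>_. A)) (A \<Otimes>\<^sub>M A) (\<lambda>X. (X i, X j))"
  proof (rule pair_measure_eqI)
    fix S T assume S: "S \<in> sets A" and T: "T \<in> sets A"
    have "emeasure (distr (PiM I (\<lambda>_. A)) (A \<Otimes>\<^sub>M A) (\<lambda>X. (X i, X j))) (S \<times> T) =
        emeasure (PiM I (\<lambda>_. A)) ((\<lambda>X. (X i, X j)) -` (S \<times> T) \<inter> space (PiM I (\<lambda>_. A)))"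
      using S T by (intro emeasure_distr) auto
    also have "(\<lambda>X. (X i, X j)) -` (S \<times> T) \<inter> space (PiM I (\<lambda>_. A)) =
        {X \<in> space (PiM I (\<lambda>_. A)). \<forall>l\<in>{i, j}. X l \<in> (if l = i then S else T)}"
      using assms(4) by auto
    also have "emeasure (PiM I (\<lambda>_. A)) \<dots> = (\<Prod>l\<in>{i, j}. emeasure A (if l = i then S else T))"
      using assms S T by (intro emeasure_PiM_Collect) auto
    also have "\<dots> = emeasure A S * emeasure A T" using assms(4) by simp
    finally show "emeasure A S * emeasure A T =
        emeasure (distr (PiM I (\<lambda>_. A)) (A \<Otimes>\<^sub>M A) (\<lambda>X. (X i, X j))) (S \<times> T)" ..
  qed (simp_all add: A.sigma_finite_measure_axioms)
  then have "(\<integral>\<^sup>+p. f p \<partial>(A \<Otimes>\<^sub>M A)) = (\<integral>\<^sup>+p. f p \<partial>distr (PiM I (\<lambda>_. A)) (A \<Otimes>\<^sub>M A) (\<lambda>X. (X i, X j)))"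
    by simp
  also have "\<dots> = (\<integral>\<^sup>+X. f (X i, X j) \<partial>PiM I (\<lambda>_. A))" by (intro nn_integral_distr) auto
  finally show ?thesis by (simp add: A.nn_integral_fst)
qed

text \<open>The probabilistic method: without a point below \<open>c\<close> the mean would be at
  least \<open>c\<close>.\<close>

lemma (in prob_space) exists_less_nn_integral:
  assumes "(\<integral>\<^sup>+x. f x \<partial>M) < c"
  obtains x where "x \<in> space M" "f x < c"
proof (rule ccontr)
  assume "\<not> thesis"
  with that have "c \<le> f x" if "x \<in> space M" for x using \<open>x \<in> space M\<close> not_less by blast
  then have "(\<integral>\<^sup>+x. c \<partial>M) \<le> (\<integral>\<^sup>+x. f x \<partial>M)" by (intro nn_integral_mono)
  with assms show False by (simp add: emeasure_space_1)
qed

text \<open>\<open>f\<close> is the cost of a sent pair by itself, \<open>K\<close> that of a wrong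
  candidate against it. Different pairs share at most one word, so some word can be averaged
  independently of all others: the candidate's \<open>x'\<close> for \<open>b1\<close>, the sent
  \<open>y\<close> for \<open>b2\<close>, both sent words for \<open>b3\<close>. The bounds hold
  uniformly in the words that stay fixed.\<close>

lemma random_codebook:
  fixes f :: "'a \<times> 'b \<Rightarrow> ennreal" and K :: "'a \<times> 'b \<times> 'a \<times> 'b \<Rightarrow> ennreal" and a b1 b2 b3 :: ennreal
    and I J :: "nat set"
  assumes A: "prob_space A" and B: "prob_space B" and fin: "finite I" "finite J"
    and f[measurable]: "f \<in> borel_measurable (A \<Otimes>\<^sub>M B)"
    and K[measurable]: "K \<in> borel_measurable (A \<Otimes>\<^sub>M B \<Otimes>\<^sub>M A \<Otimes>\<^sub>M B)"
    and a: "(\<integral>\<^sup>+x. \<integral>\<^sup>+y. f (x, y) \<partial>B \<partial>A) \<le> a"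
    and b1: "\<And>x y. x \<in> space A \<Longrightarrow> y \<in> space B \<Longrightarrow> (\<integral>\<^sup>+x'. K (x', y, x, y) \<partial>A) \<le> b1"
    and b2: "\<And>x y'. x \<in> space A \<Longrightarrow> y' \<in> space B \<Longrightarrow> (\<integral>\<^sup>+y. K (x, y', x, y) \<partial>B) \<le> b2"
    and b3: "\<And>x' y'. x' \<in> space A \<Longrightarrow> y' \<in> space B \<Longrightarrow> (\<integral>\<^sup>+x. \<integral>\<^sup>+y. K (x', y', x, y) \<partial>B \<partial>A) \<le> b3"
  shows "(\<integral>\<^sup>+X. \<integral>\<^sup>+Y. (\<Sum>(i, j)\<in>I \<times> J. f (X i, Y j) + (\<Sum>(i', j')\<in>I \<times> J - {(i, j)}. K (X i', Y j', X i, Y j)))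
      \<partial>PiM J (\<lambda>_. B) \<partial>PiM I (\<lambda>_. A)) \<le>
    of_nat (card I * card J) * (a + (of_nat (card I) * b1 + of_nat (card J) * b2 + of_nat (card I * card J) * b3))"
proof -
  interpret A: prob_space A by fact
  interpret B: prob_space B by fact
  let ?A = "PiM I (\<lambda>_. A)" and ?B = "PiM J (\<lambda>_. B)"
  interpret PA: prob_space ?A by (intro prob_space_PiM A)
  interpret PB: prob_space ?B by (intro prob_space_PiM B)
  interpret AB: pair_sigma_finite A B ..
  interpret PAB: pair_sigma_finite ?A ?B ..
  have le_const: "(\<integral>\<^sup>+x. h x \<partial>M) \<le> c" if "prob_space M" "\<And>x. x \<in> space M \<Longrightarrow> h x \<le> c"
    for M :: "'c measure" and h and c :: ennreal
  proof -
    interpret prob_space M by fact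
    have "(\<integral>\<^sup>+x. h x \<partial>M) \<le> (\<integral>\<^sup>+x. c \<partial>M)" by (intro nn_integral_mono that)
    then show ?thesis by (simp add: emeasure_space_1)
  qed
  have c1[measurable]: "(\<lambda>X. X i) \<in> ?A \<rightarrow>\<^sub>M A" if "i \<in> I" for i using that by (rule measurable_component_singleton)
  have c2[measurable]: "(\<lambda>Y. Y j) \<in> ?B \<rightarrow>\<^sub>M B" if "j \<in> J" for j using that by (rule measurable_component_singleton)
  have spA: "X i \<in> space A" if "X \<in> space ?A" "i \<in> I" for X i using measurable_space[OF c1] that by blast
  have spB: "Y j \<in> space B" if "Y \<in> space ?B" "j \<in> J" for Y j using measurable_space[OF c2] that by blast
  define T where "T p q X Y = (case (p, q) of ((i', j'), (i, j)) \<Rightarrow> K (X i', Y j', X i, Y j))"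
    for p q :: "nat \<times> nat" and X Y
  \<comment> \<open>\<open>p\<close> is the candidate and \<open>q\<close> the sent pair. Equal
    pairs would fall under \<open>b2\<close>, but the sums leave them out.\<close>
  define b where "b p q = (if fst p \<noteq> fst q \<and> snd p = snd q then b1 else if fst p = fst q then b2 else b3)" for p q :: "nat \<times> nat"
  have f_term: "(\<integral>\<^sup>+X. \<integral>\<^sup>+Y. f (X i, Y j) \<partial>?B \<partial>?A) \<le> a" if "i \<in> I" "j \<in> J" for i j
  proof -
    have "(\<integral>\<^sup>+X. \<integral>\<^sup>+Y. f (X i, Y j) \<partial>?B \<partial>?A) = (\<integral>\<^sup>+X. \<integral>\<^sup>+y. f (X i, y) \<partial>B \<partial>?A)"
      using that spA by (intro nn_integral_cong nn_integral_PiM_component[OF B]) auto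
    also have "\<dots> = (\<integral>\<^sup>+x. \<integral>\<^sup>+y. f (x, y) \<partial>B \<partial>A)"
      using that by (intro nn_integral_PiM_component[OF A]) auto
    finally show ?thesis using a by simp
  qed
  have T_term: "(\<integral>\<^sup>+X. \<integral>\<^sup>+Y. T p q X Y \<partial>?B \<partial>?A) \<le> b p q"
    if pq_in: "p \<in> I \<times> J" "q \<in> I \<times> J" "p \<noteq> q" for p q
  proof -
    obtain i' j' i j where pq: "p = (i', j')" "q = (i, j)" "i' \<in> I" "i \<in> I" "j' \<in> J" "j \<in> J"
      using pq_in by (cases p, cases q) auto
    note [measurable] = c1[OF pq(3)] c1[OF pq(4)] c2[OF pq(5)] c2[OF pq(6)]
    consider "i' \<noteq> i" "j' = j" | "i' = i" "j' \<noteq> j" | "i' \<noteq> i" "j' \<noteq> j" using pq_in pq by auto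
    then show ?thesis
    proof cases
      case 1
      have "(\<integral>\<^sup>+X. \<integral>\<^sup>+Y. K (X i', Y j, X i, Y j) \<partial>?B \<partial>?A) = (\<integral>\<^sup>+Y. \<integral>\<^sup>+X. K (X i', Y j, X i, Y j) \<partial>?A \<partial>?B)"
        by (intro PAB.Fubini'[symmetric]) measurable
      also have "\<dots> \<le> b1"
      proof (rule le_const[OF PB.prob_space_axioms])
        fix Y assume Y: "Y \<in> space ?B"
        have "(\<integral>\<^sup>+X. K (X i', Y j, X i, Y j) \<partial>?A) = (\<integral>\<^sup>+x. \<integral>\<^sup>+x'. K (x', Y j, x, Y j) \<partial>A \<partial>A)"
          using nn_integral_PiM_two_components[OF A pq(4,3), of "\<lambda>(x, x'). K (x', Y j, x, Y j)"] 1 spB[OF Y pq(6)]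
          by simp
        also have "\<dots> \<le> b1" by (rule le_const[OF A]) (rule b1[OF _ spB[OF Y pq(6)]])
        finally show "(\<integral>\<^sup>+X. K (X i', Y j, X i, Y j) \<partial>?A) \<le> b1" .
      qed
      finally show ?thesis using 1 by (simp add: T_def b_def pq)
    next
      case 2
      have "(\<integral>\<^sup>+X. \<integral>\<^sup>+Y. K (X i, Y j', X i, Y j) \<partial>?B \<partial>?A) \<le> b2"
      proof (rule le_const[OF PA.prob_space_axioms])
        fix X assume X: "X \<in> space ?A"
        have "(\<integral>\<^sup>+Y. K (X i, Y j', X i, Y j) \<partial>?B) = (\<integral>\<^sup>+y'. \<integral>\<^sup>+y. K (X i, y', X i, y) \<partial>B \<partial>B)"
          using nn_integral_PiM_two_components[OF B pq(5,6), of "\<lambda>(y', y). K (X i, y', X i, y)"] 2 spA[OF X pq(4)]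
          by simp
        also have "\<dots> \<le> b2" by (rule le_const[OF B]) (rule b2[OF spA[OF X pq(4)]])
        finally show "(\<integral>\<^sup>+Y. K (X i, Y j', X i, Y j) \<partial>?B) \<le> b2" .
      qed
      then show ?thesis using 2 by (simp add: T_def b_def pq)
    next
      case 3
      have "(\<integral>\<^sup>+X. \<integral>\<^sup>+Y. K (X i', Y j', X i, Y j) \<partial>?B \<partial>?A) = (\<integral>\<^sup>+X. \<integral>\<^sup>+y'. \<integral>\<^sup>+y. K (X i', y', X i, y) \<partial>B \<partial>B \<partial>?A)"
      proof (rule nn_integral_cong)
        fix X assume X: "X \<in> space ?A"
        show "(\<integral>\<^sup>+Y. K (X i', Y j', X i, Y j) \<partial>?B) = (\<integral>\<^sup>+y'. \<integral>\<^sup>+y. K (X i', y', X i, y) \<partial>B \<partial>B)"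
          using nn_integral_PiM_two_components[OF B pq(5,6), of "\<lambda>(y', y). K (X i', y', X i, y)"]
            3 spA[OF X pq(4)] spA[OF X pq(3)] by simp
      qed
      also have "\<dots> = (\<integral>\<^sup>+x'. \<integral>\<^sup>+x. \<integral>\<^sup>+y'. \<integral>\<^sup>+y. K (x', y', x, y) \<partial>B \<partial>B \<partial>A \<partial>A)"
        using nn_integral_PiM_two_components[OF A pq(3,4), of "\<lambda>(x', x). \<integral>\<^sup>+y'. \<integral>\<^sup>+y. K (x', y', x, y) \<partial>B \<partial>B"] 3
        by simp
      also have "\<dots> \<le> b3"
      proof (rule le_const[OF A])
        fix x' assume x': "x' \<in> space A"
        have "(\<integral>\<^sup>+x. \<integral>\<^sup>+y'. \<integral>\<^sup>+y. K (x', y', x, y) \<partial>B \<partial>B \<partial>A) = (\<integral>\<^sup>+y'. \<integral>\<^sup>+x. \<integral>\<^sup>+y. K (x', y', x, y) \<partial>B \<partial>A \<partial>B)"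
          using x' by (intro AB.Fubini'[symmetric]) measurable
        also have "\<dots> \<le> b3" by (rule le_const[OF B]) (rule b3[OF x'])
        finally show "(\<integral>\<^sup>+x. \<integral>\<^sup>+y'. \<integral>\<^sup>+y. K (x', y', x, y) \<partial>B \<partial>B \<partial>A) \<le> b3" .
      qed
      finally show ?thesis using 3 by (simp add: T_def b_def pq)
    qed
  qed
  have T_meas[measurable]: "(\<lambda>(X, Y). T p q X Y) \<in> borel_measurable (?A \<Otimes>\<^sub>M ?B)" if pq_in: "p \<in> I \<times> J" "q \<in> I \<times> J" for p q
  proof -
    obtain i' j' i j where pq: "p = (i', j')" "q = (i, j)" "i' \<in> I" "i \<in> I" "j' \<in> J" "j \<in> J"
      using pq_in by (cases p, cases q) auto
    note [measurable] = c1[OF pq(3)] c1[OF pq(4)] c2[OF pq(5)] c2[OF pq(6)]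
    show ?thesis unfolding T_def pq by simp
  qed
  have f_meas[measurable]: "(\<lambda>(X, Y). f (X (fst q), Y (snd q))) \<in> borel_measurable (?A \<Otimes>\<^sub>M ?B)" if "q \<in> I \<times> J" for q
  proof -
    note [measurable] = c1[of "fst q"] c2[of "snd q"]
    show ?thesis using that by (auto simp: mem_Times_iff)
  qed
  have "(\<integral>\<^sup>+X. \<integral>\<^sup>+Y. (\<Sum>(i, j)\<in>I \<times> J. f (X i, Y j) + (\<Sum>(i', j')\<in>I \<times> J - {(i, j)}. K (X i', Y j', X i, Y j))) \<partial>?B \<partial>?A) =
      (\<integral>\<^sup>+p. (\<Sum>q\<in>I \<times> J. (case p of (X, Y) \<Rightarrow> f (X (fst q), Y (snd q))) + (\<Sum>p'\<in>I \<times> J - {q}. case p of (X, Y) \<Rightarrow> T p' q X Y)) \<partial>(?A \<Otimes>\<^sub>M ?B))"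
    by (subst PB.nn_integral_fst[symmetric])
       (auto simp: T_def split_beta' intro!: nn_integral_cong borel_measurable_sum borel_measurable_add)
  also have "\<dots> = (\<Sum>q\<in>I \<times> J. (\<integral>\<^sup>+p. (case p of (X, Y) \<Rightarrow> f (X (fst q), Y (snd q))) \<partial>(?A \<Otimes>\<^sub>M ?B)) +
      (\<Sum>p'\<in>I \<times> J - {q}. \<integral>\<^sup>+p. (case p of (X, Y) \<Rightarrow> T p' q X Y) \<partial>(?A \<Otimes>\<^sub>M ?B)))"
  proof (subst nn_integral_sum)
    fix q assume q: "q \<in> I \<times> J"
    show "(\<lambda>p. (case p of (X, Y) \<Rightarrow> f (X (fst q), Y (snd q))) + (\<Sum>p'\<in>I \<times> J - {q}. case p of (X, Y) \<Rightarrow> T p' q X Y))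
        \<in> borel_measurable (?A \<Otimes>\<^sub>M ?B)"
      using q by (intro borel_measurable_add borel_measurable_sum f_meas T_meas) auto
  next
    show "(\<Sum>q\<in>I \<times> J. \<integral>\<^sup>+p. (case p of (X, Y) \<Rightarrow> f (X (fst q), Y (snd q))) +
          (\<Sum>p'\<in>I \<times> J - {q}. case p of (X, Y) \<Rightarrow> T p' q X Y) \<partial>(?A \<Otimes>\<^sub>M ?B)) =
        (\<Sum>q\<in>I \<times> J. (\<integral>\<^sup>+p. (case p of (X, Y) \<Rightarrow> f (X (fst q), Y (snd q))) \<partial>(?A \<Otimes>\<^sub>M ?B)) +
      (\<Sum>p'\<in>I \<times> J - {q}. \<integral>\<^sup>+p. (case p of (X, Y) \<Rightarrow> T p' q X Y) \<partial>(?A \<Otimes>\<^sub>M ?B)))"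
    proof (intro sum.cong refl)
      fix q assume q: "q \<in> I \<times> J"
      have T: "(\<lambda>p. case p of (X, Y) \<Rightarrow> T p' q X Y) \<in> borel_measurable (?A \<Otimes>\<^sub>M ?B)" if "p' \<in> I \<times> J - {q}" for p'
        using that q by (intro T_meas) auto
      show "(\<integral>\<^sup>+p. (case p of (X, Y) \<Rightarrow> f (X (fst q), Y (snd q))) +
          (\<Sum>p'\<in>I \<times> J - {q}. case p of (X, Y) \<Rightarrow> T p' q X Y) \<partial>(?A \<Otimes>\<^sub>M ?B)) =
        (\<integral>\<^sup>+p. (case p of (X, Y) \<Rightarrow> f (X (fst q), Y (snd q))) \<partial>(?A \<Otimes>\<^sub>M ?B)) +
        (\<Sum>p'\<in>I \<times> J - {q}. \<integral>\<^sup>+p. (case p of (X, Y) \<Rightarrow> T p' q X Y) \<partial>(?A \<Otimes>\<^sub>M ?B))"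
        by (simp only: nn_integral_sum[OF T] nn_integral_add[OF f_meas[OF q] borel_measurable_sum[OF T]])
    qed
  qed
  also have "\<dots> \<le> (\<Sum>q\<in>I \<times> J. a + (\<Sum>p'\<in>I \<times> J - {q}. b p' q))"
  proof (intro sum_mono add_mono)
    fix q assume q: "q \<in> I \<times> J"
    show "(\<integral>\<^sup>+p. (case p of (X, Y) \<Rightarrow> f (X (fst q), Y (snd q))) \<partial>(?A \<Otimes>\<^sub>M ?B)) \<le> a"
      using f_term[of "fst q" "snd q"] q PB.nn_integral_fst[OF f_meas[OF q]] by (auto simp: mem_Times_iff)
    fix p' assume "p' \<in> I \<times> J - {q}"
    then show "(\<integral>\<^sup>+p. (case p of (X, Y) \<Rightarrow> T p' q X Y) \<partial>(?A \<Otimes>\<^sub>M ?B)) \<le> b p' q"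
      using T_term[of p' q] q PB.nn_integral_fst[OF T_meas[of p' q]] by auto
  qed
  also have "\<dots> \<le> (\<Sum>q\<in>I \<times> J. a + (of_nat (card I) * b1 + of_nat (card J) * b2 + of_nat (card I * card J) * b3))"
  proof (intro sum_mono add_left_mono)
    fix q assume q: "q \<in> I \<times> J"
    \<comment> \<open>Each bound is extended to every candidate sharing the relevant word, the sent
      pair included, so that the counts become \<open>card I\<close>, \<open>card J\<close> and
      their product.\<close>
    have "(\<Sum>p'\<in>I \<times> J - {q}. b p' q) \<le> (\<Sum>p'\<in>I \<times> J. (if snd p' = snd q then b1 else 0) + (if fst p' = fst q then b2 else 0) + b3)"
      using fin by (intro sum_le_included[where i=id] ) (auto simp: b_def)
    also have "\<dots> = of_nat (card I) * b1 + of_nat (card J) * b2 + of_nat (card I * card J) * b3"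
    proof -
      have "(\<Sum>p'\<in>I \<times> J. (if snd p' = snd q then b1 else 0)) = of_nat (card I) * b1"
      proof -
        have "(\<Sum>p'\<in>I \<times> J. (if snd p' = snd q then b1 else 0)) = (\<Sum>p'\<in>I \<times> {snd q}. b1)"
          using q fin by (intro sum.mono_neutral_cong_right) auto
        then show ?thesis by (simp add: card_cartesian_product)
      qed
      moreover have "(\<Sum>p'\<in>I \<times> J. (if fst p' = fst q then b2 else 0)) = of_nat (card J) * b2"
      proof -
        have "(\<Sum>p'\<in>I \<times> J. (if fst p' = fst q then b2 else 0)) = (\<Sum>p'\<in>{fst q} \<times> J. b2)"
          using q fin by (intro sum.mono_neutral_cong_right) auto
        then show ?thesis by (simp add: card_cartesian_product)
      qed
      ultimately show ?thesis by (simp add: sum.distrib card_cartesian_product)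
    qed
    finally show "(\<Sum>p'\<in>I \<times> J - {q}. b p' q) \<le> of_nat (card I) * b1 + of_nat (card J) * b2 + of_nat (card I * card J) * b3" .
  qed
  also have "\<dots> = of_nat (card I * card J) * (a + (of_nat (card I) * b1 + of_nat (card J) * b2 + of_nat (card I * card J) * b3))"
    by (simp add: card_cartesian_product)
  finally show ?thesis .
qed

section \<open>Typical sets of number states\<close>

definition thermal_prod :: "nat \<Rightarrow> real \<Rightarrow> nat list \<Rightarrow> real" where
  "thermal_prod n P k = (\<Prod>i<n. thermal P (k ! i))"

lemma cmod_coherent_ket_le: "cmod (coherent_ket n x k) \<le> 1"
proof (cases "length k = n")
  case True
  then have "(\<Sum>k\<in>{k}. (cmod (coherent_ket n x k))\<^sup>2) \<le> 1"
    by (intro finite_sum_le_has_sum[OF coherent_ket_has_sum]) auto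
  then show ?thesis by (simp add: power_le_one_iff)
qed (simp add: coherent_ket_def tensor_ket_def)

lemma cmod_coherent_amp_le: "cmod (coherent_amp x k) \<le> 1"
  using cmod_coherent_ket_le[of 1 "\<lambda>_. x" "[k]"] by (simp add: coherent_ket_def tensor_ket_def)

lemma sum_coherent_ket_le:
  "finite J \<Longrightarrow> J \<subseteq> {k. length k = n} \<Longrightarrow> (\<Sum>k\<in>J. (cmod (coherent_ket n x k))\<^sup>2) \<le> 1"
  by (intro finite_sum_le_has_sum[OF coherent_ket_has_sum]) auto

lemma measurable_cnj [measurable]: "cnj \<in> borel_measurable borel"
  by (intro borel_measurable_continuous_onI continuous_intros)

lemma measurable_coherent_amp [measurable]: "(\<lambda>x. coherent_amp x k) \<in> borel_measurable borel"
  unfolding coherent_amp_def by measurable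

lemma measurable_displace_elem [measurable]: "(\<lambda>x. displace_elem x k j) \<in> borel_measurable borel"
proof -
  have [measurable]: "(\<lambda>x. displace_num x k j) \<in> borel_measurable borel" for j
  proof (induction k arbitrary: j)
    case 0
    have "(\<lambda>x. displace_num x 0 j) = (\<lambda>x. (- cnj x) ^ j)" by simp
    then show ?case by (auto intro!: borel_measurable_continuous_onI continuous_intros)
  next
    case (Suc k)
    note [measurable] = Suc
    show ?case by simp
  qed
  show ?thesis unfolding displace_elem_def by measurable
qed

lemma measurable_coherent_ket:
  assumes "\<And>i. i < n \<Longrightarrow> (\<lambda>\<omega>. f \<omega> i) \<in> borel_measurable M"
  shows "(\<lambda>\<omega>. coherent_ket n (f \<omega>) k) \<in> borel_measurable M"
proof (cases "length k = n")
  case True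
  then show ?thesis
    using assms by (auto simp: coherent_ket_def tensor_ket_def
        intro!: borel_measurable_prod measurable_compose[OF _ measurable_coherent_amp])
qed (simp add: coherent_ket_def tensor_ket_def)

lemma measurable_displaced_ket:
  assumes "\<And>i. i < n \<Longrightarrow> (\<lambda>\<omega>. f \<omega> i) \<in> borel_measurable M"
  shows "(\<lambda>\<omega>. displaced_ket n (f \<omega>) j k) \<in> borel_measurable M"
proof (cases "length k = n")
  case True
  then show ?thesis
    using assms by (auto simp: displaced_ket_def tensor_ket_def
        intro!: borel_measurable_prod measurable_compose[OF _ measurable_displace_elem])
qed (simp add: displaced_ket_def tensor_ket_def)

text \<open>The coefficients are orthogonal in L2, so expanding the square leaves only the diagonal.
  The general form covers one random word and the sum of two.\<close>

lemma (in prob_space) nn_integral_orthogonal: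
  fixes c :: "'j \<Rightarrow> 'a \<Rightarrow> complex" and l :: "'j \<Rightarrow> real"
  assumes "finite J" and c[measurable]: "\<And>j. j \<in> J \<Longrightarrow> c j \<in> borel_measurable M"
    and bounded: "\<And>j \<omega>. j \<in> J \<Longrightarrow> cmod (c j \<omega>) \<le> 1"
    and orth: "\<And>i j. i \<in> J \<Longrightarrow> j \<in> J \<Longrightarrow> (\<integral>\<omega>. cnj (c i \<omega>) * c j \<omega> \<partial>M) = (if i = j then of_real (l j) else 0)"
  shows "(\<integral>\<^sup>+\<omega>. ennreal ((cmod (\<Sum>j\<in>J. c j \<omega> * w j))\<^sup>2) \<partial>M) = ennreal (\<Sum>j\<in>J. l j * (cmod (w j))\<^sup>2)"
proof -
  have prod_le: "cmod (cnj (c i \<omega>) * c j \<omega>) \<le> 1" if "i \<in> J" "j \<in> J" for i j \<omega>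
    using bounded[OF that(1), of \<omega>] bounded[OF that(2), of \<omega>] by (simp add: norm_mult mult_le_one)
  have int: "integrable M (\<lambda>\<omega>. cnj (c i \<omega>) * c j \<omega>)" if "i \<in> J" "j \<in> J" for i j
    by (rule integrable_const_bound[where B=1]) (use that prod_le in auto)
  have eq: "complex_of_real ((cmod (\<Sum>j\<in>J. c j \<omega> * w j))\<^sup>2) =
      (\<Sum>i\<in>J. \<Sum>j\<in>J. (cnj (w i) * w j) * (cnj (c i \<omega>) * c j \<omega>))" for \<omega>
    unfolding complex_norm_square cnj_sum sum_product
    by (subst sum.swap) (auto intro!: sum.cong simp: mult_ac)
  have "has_bochner_integral M (\<lambda>\<omega>. \<Sum>i\<in>J. \<Sum>j\<in>J. (cnj (w i) * w j) * (cnj (c i \<omega>) * c j \<omega>))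
      (\<Sum>i\<in>J. \<Sum>j\<in>J. (cnj (w i) * w j) * (if i = j then of_real (l j) else 0))"
    by (intro has_bochner_integral_sum has_bochner_integral_mult_right)
       (use int orth in \<open>auto simp: has_bochner_integral_iff\<close>)
  also have "(\<Sum>i\<in>J. \<Sum>j\<in>J. (cnj (w i) * w j) * (if i = j then of_real (l j) else 0)) =
      (\<Sum>i\<in>J. \<Sum>j\<in>J. if i = j then of_real (l j * (cmod (w j))\<^sup>2) else 0)"
    by (intro sum.cong refl) (auto simp: complex_norm_square mult_ac simp del: of_real_power)
  also have "\<dots> = complex_of_real (\<Sum>j\<in>J. l j * (cmod (w j))\<^sup>2)"
    using assms(1) by (simp add: sum.delta')
  finally have "has_bochner_integral M (\<lambda>\<omega>. complex_of_real ((cmod (\<Sum>j\<in>J. c j \<omega> * w j))\<^sup>2))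
      (complex_of_real (\<Sum>j\<in>J. l j * (cmod (w j))\<^sup>2))"
    unfolding eq .
  from has_bochner_integral_Re[OF this]
  have "has_bochner_integral M (\<lambda>\<omega>. (cmod (\<Sum>j\<in>J. c j \<omega> * w j))\<^sup>2) (\<Sum>j\<in>J. l j * (cmod (w j))\<^sup>2)"
    by (simp only: Re_complex_of_real)
  then have i: "integrable M (\<lambda>\<omega>. (cmod (\<Sum>j\<in>J. c j \<omega> * w j))\<^sup>2)"
    and v: "(\<integral>\<omega>. (cmod (\<Sum>j\<in>J. c j \<omega> * w j))\<^sup>2 \<partial>M) = (\<Sum>j\<in>J. l j * (cmod (w j))\<^sup>2)"
    by (simp_all only: has_bochner_integral_iff)
  show ?thesis using nn_integral_eq_integral[OF i] v by simp
qed

section \<open>Gaussian codewords and their thermal spectra\<close>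

abbreviation codeword_gauss :: "nat \<Rightarrow> real \<Rightarrow> (nat \<Rightarrow> complex) measure" where
  "codeword_gauss n P \<equiv> PiM {..<n} (\<lambda>_. complex_gauss P)"

lemma measurable_codeword_component:
  "i < n \<Longrightarrow> (\<lambda>x. x i) \<in> borel_measurable (codeword_gauss n P)"
  using measurable_component_singleton[of i "{..<n}" "\<lambda>_. complex_gauss P"]
  by (simp add: measurable_cong_sets[OF refl sets_complex_gauss])

lemma prob_space_codeword_gauss: "P > 0 \<Longrightarrow> prob_space (codeword_gauss n P)"
  by (intro prob_space_PiM prob_space_complex_gauss)

lemma thermal_prod_delta:
  assumes "length i = n" "length j = n"
  shows "(\<Prod>t<n. if i ! t = j ! t then complex_of_real (thermal P (i ! t)) else 0) =
    (if i = j then of_real (thermal_prod n P j) else 0)"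
proof (cases "i = j")
  case False
  then obtain t where "t < n" "i ! t \<noteq> j ! t" using assms by (auto simp: list_eq_iff_nth_eq)
  then show ?thesis using False by (auto intro!: prod_zero bexI[of _ t])
qed (simp add: thermal_prod_def)

lemma codeword_gauss_orthogonal:
  assumes "P > 0" "length i = n" "length j = n"
  shows "(\<integral>x. cnj (coherent_ket n x i) * coherent_ket n x j \<partial>codeword_gauss n P) =
    (if i = j then of_real (thermal_prod n P j) else 0)"
proof -
  interpret G: prob_space "complex_gauss P" by (rule prob_space_complex_gauss[OF assms(1)])
  interpret product_prob_space "\<lambda>_::nat. complex_gauss P" "{..<n}" by unfold_locales
  have "(\<integral>x. cnj (coherent_ket n x i) * coherent_ket n x j \<partial>codeword_gauss n P) =
      (\<integral>x. (\<Prod>t<n. cnj (coherent_amp (x t) (i ! t)) * coherent_amp (x t) (j ! t)) \<partial>codeword_gauss n P)"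
    using assms by (simp add: coherent_ket_def tensor_ket_def prod.distrib)
  also have "\<dots> = (\<Prod>t<n. \<integral>x. cnj (coherent_amp x (i ! t)) * coherent_amp x (j ! t) \<partial>complex_gauss P)"
  proof (rule product_integral_prod)
    fix t
    show "integrable (complex_gauss P) (\<lambda>x. cnj (coherent_amp x (i ! t)) * coherent_amp x (j ! t))"
      by (rule G.integrable_const_bound[where B=1])
         (auto simp: norm_mult intro!: mult_le_one cmod_coherent_amp_le)
  qed simp
  also have "\<dots> = (\<Prod>t<n. if i ! t = j ! t then complex_of_real (thermal P (i ! t)) else 0)"
    by (intro prod.cong refl complex_gauss_coherent assms)
  finally show ?thesis by (simp only: thermal_prod_delta[OF assms(2,3)])
qed

lemma codeword_gauss_second_moment:
  assumes "P > 0" "finite J" "J \<subseteq> {j. length j = n}"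
  shows "(\<integral>\<^sup>+x. ennreal ((cmod (\<Sum>j\<in>J. coherent_ket n x j * w j))\<^sup>2) \<partial>codeword_gauss n P) =
    ennreal (\<Sum>j\<in>J. thermal_prod n P j * (cmod (w j))\<^sup>2)"
proof -
  interpret prob_space "codeword_gauss n P" by (rule prob_space_codeword_gauss[OF assms(1)])
  show ?thesis
    by (rule nn_integral_orthogonal)
       (use assms in \<open>auto intro!: measurable_coherent_ket measurable_codeword_component cmod_coherent_ket_le
         simp: codeword_gauss_orthogonal subset_iff\<close>)
qed

text \<open>Fubini reduces the claim to a single mode, where the sum of the two amplitudes is
  Gaussian of power P + Q. Thus the mixture over both users is again thermal.\<close>

lemma sum_codeword_gauss_orthogonal:
  assumes "P > 0" "Q > 0" "length i = n" "length j = n"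
  shows "(\<integral>p. cnj (coherent_ket n (\<lambda>t. fst p t + snd p t) i) * coherent_ket n (\<lambda>t. fst p t + snd p t) j
      \<partial>(codeword_gauss n P \<Otimes>\<^sub>M codeword_gauss n Q)) =
    (if i = j then of_real (thermal_prod n (P + Q) j) else 0)"
proof -
  interpret GP: prob_space "complex_gauss P" by (rule prob_space_complex_gauss[OF assms(1)])
  interpret GQ: prob_space "complex_gauss Q" by (rule prob_space_complex_gauss[OF assms(2)])
  interpret GPQ: pair_prob_space "complex_gauss P" "complex_gauss Q" ..
  interpret PP: product_prob_space "\<lambda>_::nat. complex_gauss P" "{..<n}" by unfold_locales
  interpret PQ: product_prob_space "\<lambda>_::nat. complex_gauss Q" "{..<n}" by unfold_locales
  interpret A: prob_space "codeword_gauss n P" by (rule prob_space_codeword_gauss[OF assms(1)])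
  interpret B: prob_space "codeword_gauss n Q" by (rule prob_space_codeword_gauss[OF assms(2)])
  interpret AB: pair_prob_space "codeword_gauss n P" "codeword_gauss n Q" ..
  define h where "h t z = cnj (coherent_amp z (i ! t)) * coherent_amp z (j ! t)" for t z
  have h_le: "cmod (h t z) \<le> 1" for t z
    unfolding h_def by (auto simp: norm_mult intro!: mult_le_one cmod_coherent_amp_le)
  have h_meas[measurable]: "h t \<in> borel_measurable borel" for t unfolding h_def by measurable
  have eq: "cnj (coherent_ket n z i) * coherent_ket n z j = (\<Prod>t<n. h t (z t))" for z
    using assms by (simp add: coherent_ket_def tensor_ket_def prod.distrib h_def)
  have int: "integrable (codeword_gauss n P \<Otimes>\<^sub>M codeword_gauss n Q) (\<lambda>(x, y). \<Prod>t<n. h t (x t + y t))"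
  proof (rule AB.integrable_const_bound[where B=1])
    show "AE p in codeword_gauss n P \<Otimes>\<^sub>M codeword_gauss n Q. norm (case p of (x, y) \<Rightarrow> \<Prod>t<n. h t (x t + y t)) \<le> 1"
    proof (rule AE_I2)
      fix p
      have "(\<Prod>t<n. cmod (h t (fst p t + snd p t))) \<le> 1" by (intro prod_le_1) (simp add: h_le)
      then show "norm (case p of (x, y) \<Rightarrow> \<Prod>t<n. h t (x t + y t)) \<le> 1"
        by (simp add: split_beta' flip: prod_norm)
    qed
    show "(\<lambda>(x, y). \<Prod>t<n. h t (x t + y t)) \<in> borel_measurable (codeword_gauss n P \<Otimes>\<^sub>M codeword_gauss n Q)"
      unfolding split_beta' by (intro borel_measurable_prod) (auto intro!: measurable_compose[OF _ h_meas] borel_measurable_add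
          measurable_compose[OF measurable_fst measurable_codeword_component]
          measurable_compose[OF measurable_snd measurable_codeword_component])
  qed
  have "(\<integral>p. cnj (coherent_ket n (\<lambda>t. fst p t + snd p t) i) * coherent_ket n (\<lambda>t. fst p t + snd p t) j
      \<partial>(codeword_gauss n P \<Otimes>\<^sub>M codeword_gauss n Q)) =
      (\<integral>x. \<integral>y. (\<Prod>t<n. h t (x t + y t)) \<partial>codeword_gauss n Q \<partial>codeword_gauss n P)"
    unfolding eq using AB.integral_fst'[OF int] by (simp add: split_beta')
  also have "\<dots> = (\<integral>x. (\<Prod>t<n. \<integral>z. h t (x t + z) \<partial>complex_gauss Q) \<partial>codeword_gauss n P)"
  proof (intro Bochner_Integration.integral_cong refl PQ.product_integral_prod)
    fix x t
    show "integrable (complex_gauss Q) (\<lambda>z. h t (x t + z))"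
      by (rule GQ.integrable_const_bound[where B=1]) (auto simp: h_le)
  qed simp
  also have "\<dots> = (\<Prod>t<n. \<integral>w. \<integral>z. h t (w + z) \<partial>complex_gauss Q \<partial>complex_gauss P)"
  proof (rule PP.product_integral_prod)
    fix t
    have "cmod (\<integral>z. h t (w + z) \<partial>complex_gauss Q) \<le> 1" for w
      by (rule order_trans[OF integral_norm_bound GQ.integral_le_const])
         (auto simp: h_le intro!: GQ.integrable_const_bound[where B=1])
    then show "integrable (complex_gauss P) (\<lambda>w. \<integral>z. h t (w + z) \<partial>complex_gauss Q)"
      by (intro GP.integrable_const_bound[where B=1]) auto
  qed simp
  also have "\<dots> = (\<Prod>t<n. if i ! t = j ! t then complex_of_real (thermal (P + Q) (i ! t)) else 0)"
  proof (intro prod.cong refl)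
    fix t
    have int': "integrable (complex_gauss P \<Otimes>\<^sub>M complex_gauss Q) (\<lambda>(w, z). h t (w + z))"
      by (rule GPQ.integrable_const_bound[where B=1]) (auto simp: h_le split_beta')
    have "(\<integral>w. \<integral>z. h t (w + z) \<partial>complex_gauss Q \<partial>complex_gauss P) =
        (\<integral>u. h t u \<partial>distr (complex_gauss P \<Otimes>\<^sub>M complex_gauss Q) borel (\<lambda>(x, y). x + y))"
      using GPQ.integral_fst'[OF int'] by (subst integral_distr) (auto simp: split_beta')
    also have "\<dots> = (\<integral>u. h t u \<partial>complex_gauss (P + Q))"
      by (simp only: complex_gauss_convolution[OF assms(1,2)])
    finally show "(\<integral>w. \<integral>z. h t (w + z) \<partial>complex_gauss Q \<partial>complex_gauss P) =
        (if i ! t = j ! t then complex_of_real (thermal (P + Q) (i ! t)) else 0)"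
      using complex_gauss_coherent[of "P + Q" "i ! t" "j ! t"] assms by (simp add: h_def)
  qed
  finally show ?thesis by (simp only: thermal_prod_delta[OF assms(3,4)])
qed

section \<open>Truncated test vectors and smoothed states\<close>

definition test_ket :: "nat \<Rightarrow> nat list set \<Rightarrow> (nat \<Rightarrow> complex) \<Rightarrow> (nat \<Rightarrow> complex) \<Rightarrow> ket" where
  "test_ket n J x y = (\<lambda>k. \<Sum>i\<in>J. coherent_ket n x i * displaced_ket n y i k)"

text \<open>The users swap roles compared with \<open>test_ket\<close>: here |y> is cut to
  \<open>J\<close> and displaced by \<open>x\<close>, and only the result is cut to
  \<open>L\<close>, because this last cut refers to the undisplaced number basis.\<close>

definition smoothed_ket :: "nat \<Rightarrow> nat list set \<Rightarrow> nat list set \<Rightarrow> (nat \<Rightarrow> complex) \<Rightarrow> (nat \<Rightarrow> complex) \<Rightarrow> ket" where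
  "smoothed_ket n J L x y = (\<lambda>k. if k \<in> L then test_ket n J y x k else 0)"

lemma braket_restrict: "braket \<phi> (\<lambda>k. if k \<in> L then \<psi> k else 0) = braket (\<lambda>k. if k \<in> L then \<phi> k else 0) \<psi>"
  unfolding braket_def by (intro infsum_cong) auto

lemma braket_restrict_finite:
  "finite L \<Longrightarrow> braket (\<lambda>k. if k \<in> L then \<phi> k else 0) \<psi> = (\<Sum>k\<in>L. cnj (\<phi> k) * \<psi> k)"
proof -
  assume "finite L"
  have "braket (\<lambda>k. if k \<in> L then \<phi> k else 0) \<psi> = (\<Sum>\<^sub>\<infinity>k\<in>L. cnj (\<phi> k) * \<psi> k)"
    unfolding braket_def by (rule infsum_cong_neutral) auto
  with \<open>finite L\<close> show ?thesis by simp
qed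

lemma sum_cmod_power2_le:
  assumes "\<psi> \<in> fock n" "finite L"
  shows "(\<Sum>k\<in>L. (cmod (\<psi> k))\<^sup>2) \<le> (ket_norm \<psi>)\<^sup>2"
  unfolding ket_norm_power2 using assms by (intro finite_sum_le_infsum) (auto simp: fock_def)

context
  fixes n :: nat and J :: "nat list set"
  assumes J: "finite J" "J \<subseteq> {j. length j = n}"
begin

lemma displaced_in_fock: "j \<in> J \<Longrightarrow> displaced_ket n x j \<in> fock n"
  using J by (intro displaced_ket_fock) auto

lemma test_ket_fock: "test_ket n J x y \<in> fock n"
  unfolding test_ket_def by (rule fock_sum) (rule displaced_in_fock)

lemma ket_norm_test_ket_le: "ket_norm (test_ket n J x y) \<le> 1"
proof -
  have "(ket_norm (test_ket n J x y))\<^sup>2 \<le> 1"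
    unfolding test_ket_def orthonormal_kets_ket_norm[OF displaced_ket_orthonormal_subset[OF J(2)] J(1)]
    by (rule sum_coherent_ket_le[OF J])
  then show ?thesis by (simp add: power_le_one_iff)
qed

lemma braket_test_ket:
  "u \<in> fock n \<Longrightarrow> braket u (test_ket n J x y) = (\<Sum>j\<in>J. coherent_ket n x j * braket u (displaced_ket n y j))"
  unfolding test_ket_def by (rule braket_sum_right) (auto intro: displaced_in_fock)

lemma smoothed_ket_fock: "smoothed_ket n J L x y \<in> fock n"
  unfolding smoothed_ket_def by (rule fock_restrict) (rule test_ket_fock)

lemma test_ket_distance:
  "(ket_norm (\<lambda>k. coherent_ket n (\<lambda>i. y i + x i) k - displaced_phase n y x * test_ket n J x y k))\<^sup>2 =
    1 - (\<Sum>j\<in>J. (cmod (coherent_ket n x j))\<^sup>2)"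
  using coherent_residual[OF J, of y x] by (simp add: test_ket_def sum_distrib_left mult.assoc)

text \<open>The average over \<open>x\<close> is the thermal state cut to \<open>J\<close> and
  displaced by the fixed \<open>y\<close>. Its eigenvalues are at most \<open>l\<close> and its
  eigenbasis is orthonormal, so Bessel finishes.\<close>

lemma nn_integral_test_ket:
  assumes "P > 0" "u \<in> fock n" and l: "\<And>j. j \<in> J \<Longrightarrow> thermal_prod n P j \<le> l" "0 \<le> l"
  shows "(\<integral>\<^sup>+x. ennreal ((cmod (braket u (test_ket n J x y)))\<^sup>2) \<partial>codeword_gauss n P) \<le> ennreal (l * (ket_norm u)\<^sup>2)"
proof -
  have "(\<integral>\<^sup>+x. ennreal ((cmod (braket u (test_ket n J x y)))\<^sup>2) \<partial>codeword_gauss n P) =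
      ennreal (\<Sum>j\<in>J. thermal_prod n P j * (cmod (braket u (displaced_ket n y j)))\<^sup>2)"
    unfolding braket_test_ket[OF assms(2)] by (rule codeword_gauss_second_moment[OF assms(1) J])
  also have "(\<Sum>j\<in>J. thermal_prod n P j * (cmod (braket u (displaced_ket n y j)))\<^sup>2) \<le>
      (\<Sum>j\<in>J. l * (cmod (braket (displaced_ket n y j) u))\<^sup>2)"
    by (intro sum_mono mult_mono l) (auto simp: braket_cnj[of u, symmetric] intro: l)
  also have "\<dots> \<le> l * (ket_norm u)\<^sup>2"
    unfolding sum_distrib_left[symmetric]
    by (intro mult_left_mono l(2) Bessel_braket[OF displaced_ket_orthonormal_subset[OF J(2)] J(1) assms(2)])
  finally show ?thesis by (simp add: ennreal_leI)
qed

end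

text \<open>The sum over a finite \<open>J\<close> is at most the sum over all number states, which by dominated
  convergence is the second moment of the full displaced coherent state.\<close>

lemma nn_integral_test_ket_le_coherent:
  assumes J: "finite J" "J \<subseteq> {j. length j = n}" and "Q > 0" "u \<in> fock n"
  shows "(\<integral>\<^sup>+y. ennreal ((cmod (braket u (test_ket n J y x)))\<^sup>2) \<partial>codeword_gauss n Q) \<le>
    (\<integral>\<^sup>+y. ennreal ((cmod (braket u (coherent_ket n (\<lambda>i. x i + y i))))\<^sup>2) \<partial>codeword_gauss n Q)"
proof -
  \<comment> \<open>Boxes of occupation numbers exhaust the number states; joining \<open>J\<close>
    makes every \<open>L r\<close> contain it.\<close>
  define L where "L r = J \<union> {k. set k \<subseteq> {..r} \<and> length k = n}" for r :: nat
  have L: "finite (L r)" "L r \<subseteq> {j. length j = n}" for r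
    using J by (auto simp: L_def finite_lists_length_eq)
  define F where "F r y = ennreal ((cmod (braket u (test_ket n (L r) y x)))\<^sup>2)" for r y
  interpret prob_space "codeword_gauss n Q" by (rule prob_space_codeword_gauss[OF assms(3)])
  have [measurable]: "(\<lambda>y. coherent_ket n y k) \<in> borel_measurable (codeword_gauss n Q)" for k
    by (intro measurable_coherent_ket measurable_codeword_component)
  have meas[measurable]: "F r \<in> borel_measurable (codeword_gauss n Q)" for r
    unfolding F_def braket_test_ket[OF L assms(4)]
    by measurable
  have lists: "filterlim L (finite_subsets_at_top {k :: nat list. length k = n}) sequentially"
    unfolding filterlim_iff eventually_finite_subsets_at_top
  proof safe
    fix P and X :: "nat list set" assume X: "finite X" "X \<subseteq> {k. length k = n}"
      and P: "\<forall>Y. finite Y \<and> X \<subseteq> Y \<and> Y \<subseteq> {k. length k = n} \<longrightarrow> P Y"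
    define r where "r = Max (insert 0 (\<Union> (set ` X)))"
    have "P (L s)" if "s \<ge> r" for s
    proof -
      have "a \<le> s" if "a \<in> set k" "k \<in> X" for a k
        using that X(1) \<open>s \<ge> r\<close> by (auto simp: r_def intro!: order_trans[OF Max_ge])
      then have "X \<subseteq> L s" using X(2) by (auto simp: L_def)
      with P L show ?thesis by blast
    qed
    then show "\<forall>\<^sub>F s in sequentially. P (L s)" unfolding eventually_sequentially by blast
  qed
  have lim: "(\<lambda>r. F r y) \<longlonglongrightarrow> ennreal ((cmod (braket u (coherent_ket n (\<lambda>i. x i + y i))))\<^sup>2)" for y
  proof -
    let ?p = "displaced_phase n x y" and ?c = "coherent_ket n (\<lambda>i. x i + y i)"
    have "((\<lambda>X. \<Sum>j\<in>X. (cmod (coherent_ket n y j))\<^sup>2) \<longlongrightarrow> 1) (finite_subsets_at_top {k. length k = n})"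
      using coherent_ket_has_sum unfolding has_sum_def .
    then have "(\<lambda>r. \<Sum>j\<in>L r. (cmod (coherent_ket n y j))\<^sup>2) \<longlonglongrightarrow> 1"
      by (rule filterlim_compose[OF _ lists])
    then have "(\<lambda>r. ket_norm u * sqrt (1 - (\<Sum>j\<in>L r. (cmod (coherent_ket n y j))\<^sup>2))) \<longlonglongrightarrow> ket_norm u * sqrt (1 - 1)"
      by (intro tendsto_intros)
    then have z: "(\<lambda>r. ket_norm u * sqrt (1 - (\<Sum>j\<in>L r. (cmod (coherent_ket n y j))\<^sup>2))) \<longlonglongrightarrow> 0" by simp
    \<comment> \<open>Pointwise convergence: the squared distance of the truncated from the full
      state is the weight outside \<open>L r\<close>, and the phase disappears in the
      modulus.\<close>
    have "(\<lambda>r. braket u ?c - ?p * braket u (test_ket n (L r) y x)) \<longlonglongrightarrow> 0"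
    proof (rule Lim_null_comparison[OF _ z], rule always_eventually, rule allI)
      fix r
      have f: "(\<lambda>k. ?p * test_ket n (L r) y x k) \<in> fock n" by (intro fock_scale test_ket_fock L)
      have "braket u ?c - ?p * braket u (test_ket n (L r) y x) = braket u (\<lambda>k. ?c k - ?p * test_ket n (L r) y x k)"
        by (simp add: braket_diff_right[OF assms(4) coherent_ket_fock f] braket_scale_right)
      moreover have "cmod (braket u (\<lambda>k. ?c k - ?p * test_ket n (L r) y x k)) \<le>
          ket_norm u * ket_norm (\<lambda>k. ?c k - ?p * test_ket n (L r) y x k)"
        by (rule Cauchy_Schwarz_braket[OF assms(4) fock_diff[OF coherent_ket_fock f]])
      moreover have "ket_norm (\<lambda>k. ?c k - ?p * test_ket n (L r) y x k) =
          sqrt (1 - (\<Sum>j\<in>L r. (cmod (coherent_ket n y j))\<^sup>2))"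
        using test_ket_distance[OF L, of x y r] by (simp add: real_sqrt_unique)
      ultimately show "norm (braket u ?c - ?p * braket u (test_ket n (L r) y x)) \<le>
          ket_norm u * sqrt (1 - (\<Sum>j\<in>L r. (cmod (coherent_ket n y j))\<^sup>2))" by simp
    qed
    then have "(\<lambda>r. braket u ?c - (braket u ?c - ?p * braket u (test_ket n (L r) y x))) \<longlonglongrightarrow> braket u ?c - 0"
      by (intro tendsto_intros)
    then have "(\<lambda>r. cmod (?p * braket u (test_ket n (L r) y x))) \<longlonglongrightarrow> cmod (braket u ?c)"
      by (intro tendsto_norm) simp
    then have "(\<lambda>r. cmod (braket u (test_ket n (L r) y x))) \<longlonglongrightarrow> cmod (braket u ?c)"
      by (simp add: norm_mult)
    then show ?thesis unfolding F_def by (intro tendsto_ennrealI tendsto_power)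
  qed
  have "(\<lambda>r. \<integral>\<^sup>+y. F r y \<partial>codeword_gauss n Q) \<longlonglongrightarrow>
      (\<integral>\<^sup>+y. ennreal ((cmod (braket u (coherent_ket n (\<lambda>i. x i + y i))))\<^sup>2) \<partial>codeword_gauss n Q)"
  proof (rule nn_integral_dominated_convergence[where w="\<lambda>_. ennreal ((ket_norm u)\<^sup>2)"])
    show "(\<lambda>y. ennreal ((cmod (braket u (coherent_ket n (\<lambda>i. x i + y i))))\<^sup>2)) \<in> borel_measurable (codeword_gauss n Q)"
      by (rule borel_measurable_LIMSEQ_order[OF lim meas])
    show "AE y in codeword_gauss n Q. F r y \<le> ennreal ((ket_norm u)\<^sup>2)" for r
    proof (rule AE_I2)
      fix y
      have "cmod (braket u (test_ket n (L r) y x)) \<le> ket_norm u * 1"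
        by (rule order_trans[OF Cauchy_Schwarz_braket[OF assms(4) test_ket_fock[OF L]]])
           (intro mult_left_mono ket_norm_test_ket_le L ket_norm_nonneg)
      then show "F r y \<le> ennreal ((ket_norm u)\<^sup>2)" unfolding F_def by (intro ennreal_leI power_mono) auto
    qed
    show "(\<integral>\<^sup>+y. ennreal ((ket_norm u)\<^sup>2) \<partial>codeword_gauss n Q) < \<infinity>" by (simp add: emeasure_space_1)
  qed (auto intro: lim)
  moreover have "(\<integral>\<^sup>+y. ennreal ((cmod (braket u (test_ket n J y x)))\<^sup>2) \<partial>codeword_gauss n Q) \<le> (\<integral>\<^sup>+y. F r y \<partial>codeword_gauss n Q)" for r
    unfolding F_def braket_test_ket[OF L assms(4)] braket_test_ket[OF J assms(4)]
      codeword_gauss_second_moment[OF assms(3) L] codeword_gauss_second_moment[OF assms(3) J]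
  proof (intro ennreal_leI sum_mono2 L)
    have "thermal Q k \<ge> 0" for k using assms(3) by (simp add: thermal_def)
    then show "0 \<le> thermal_prod n Q j * (cmod (braket u (displaced_ket n x j)))\<^sup>2" for j
      by (simp add: thermal_prod_def prod_nonneg)
  qed (auto simp: L_def)
  ultimately show ?thesis by (intro LIMSEQ_le_const) auto
qed

text \<open>The outer cut is moved to \<open>u\<close>, which it can only shorten; the average over
  one word remains.\<close>

lemma nn_integral_smoothed_ket:
  assumes J: "finite J" "J \<subseteq> {j. length j = n}" and "Q > 0" "u \<in> fock n"
    and l: "\<And>j. j \<in> J \<Longrightarrow> thermal_prod n Q j \<le> l" "0 \<le> l"
  shows "(\<integral>\<^sup>+y. ennreal ((cmod (braket u (smoothed_ket n J L x y)))\<^sup>2) \<partial>codeword_gauss n Q) \<le> ennreal (l * (ket_norm u)\<^sup>2)"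
proof -
  let ?u = "\<lambda>k. if k \<in> L then u k else 0"
  have u: "?u \<in> fock n" by (rule fock_restrict[OF assms(4)])
  have "(\<integral>\<^sup>+y. ennreal ((cmod (braket u (smoothed_ket n J L x y)))\<^sup>2) \<partial>codeword_gauss n Q) \<le> ennreal (l * (ket_norm ?u)\<^sup>2)"
    unfolding smoothed_ket_def braket_restrict by (rule nn_integral_test_ket[OF J assms(3) u l])
  also have "\<dots> \<le> ennreal (l * (ket_norm u)\<^sup>2)"
    by (intro ennreal_leI mult_left_mono ket_norm_restrict_le[OF assms(4)] l(2))
  finally show ?thesis .
qed

text \<open>With the inner cut \<open>J\<close> the state no longer depends on x + y alone. Removing
  that cut can only increase the average, and what remains is a thermal mixture of power P + Q seen
  through the outer cut \<open>L\<close>.\<close>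

lemma nn_integral_smoothed_ket_joint:
  assumes J: "finite J" "J \<subseteq> {j. length j = n}" and "P > 0" "Q > 0" "u \<in> fock n"
    and L: "finite L" "L \<subseteq> {j. length j = n}"
    and l: "\<And>j. j \<in> L \<Longrightarrow> thermal_prod n (P + Q) j \<le> l" "0 \<le> l"
  shows "(\<integral>\<^sup>+x. \<integral>\<^sup>+y. ennreal ((cmod (braket u (smoothed_ket n J L x y)))\<^sup>2) \<partial>codeword_gauss n Q \<partial>codeword_gauss n P) \<le>
    ennreal (l * (ket_norm u)\<^sup>2)"
proof -
  let ?u = "\<lambda>k. if k \<in> L then u k else 0"
  let ?A = "codeword_gauss n P" and ?B = "codeword_gauss n Q"
  have u: "?u \<in> fock n" by (rule fock_restrict[OF assms(5)])
  interpret A: prob_space ?A by (rule prob_space_codeword_gauss[OF assms(3)])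
  interpret B: prob_space ?B by (rule prob_space_codeword_gauss[OF assms(4)])
  interpret AB: pair_prob_space ?A ?B ..
  define c where "c k p = coherent_ket n (\<lambda>t. fst p t + snd p t) k" for k and p :: "(nat \<Rightarrow> complex) \<times> (nat \<Rightarrow> complex)"
  have c_meas[measurable]: "c k \<in> borel_measurable (?A \<Otimes>\<^sub>M ?B)" for k
    unfolding c_def
    by (intro measurable_coherent_ket borel_measurable_add measurable_compose[OF measurable_fst measurable_codeword_component]
        measurable_compose[OF measurable_snd measurable_codeword_component])
  have "(\<integral>\<^sup>+x. \<integral>\<^sup>+y. ennreal ((cmod (braket u (smoothed_ket n J L x y)))\<^sup>2) \<partial>?B \<partial>?A) \<le>
      (\<integral>\<^sup>+x. \<integral>\<^sup>+y. ennreal ((cmod (braket ?u (coherent_ket n (\<lambda>i. x i + y i))))\<^sup>2) \<partial>?B \<partial>?A)"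
    unfolding smoothed_ket_def braket_restrict
    by (intro nn_integral_mono nn_integral_test_ket_le_coherent[OF J assms(4) u])
  also have "\<dots> = (\<integral>\<^sup>+x. \<integral>\<^sup>+y. ennreal ((cmod (\<Sum>k\<in>L. c k (x, y) * cnj (u k)))\<^sup>2) \<partial>?B \<partial>?A)"
    unfolding braket_restrict_finite[OF L(1)] c_def by (simp add: mult.commute)
  also have "\<dots> = (\<integral>\<^sup>+p. ennreal ((cmod (\<Sum>k\<in>L. c k p * cnj (u k)))\<^sup>2) \<partial>(?A \<Otimes>\<^sub>M ?B))"
    by (rule B.nn_integral_fst) measurable
  also have "\<dots> = ennreal (\<Sum>k\<in>L. thermal_prod n (P + Q) k * (cmod (cnj (u k)))\<^sup>2)"
  proof (rule AB.nn_integral_orthogonal[OF L(1) c_meas])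
    fix i j assume "i \<in> L" "j \<in> L"
    then show "(\<integral>p. cnj (c i p) * c j p \<partial>(?A \<Otimes>\<^sub>M ?B)) = (if i = j then of_real (thermal_prod n (P + Q) j) else 0)"
      using L unfolding c_def by (intro sum_codeword_gauss_orthogonal assms) auto
  qed (simp add: c_def cmod_coherent_ket_le)
  also have "\<dots> \<le> ennreal (\<Sum>k\<in>L. l * (cmod (u k))\<^sup>2)"
    by (intro ennreal_leI sum_mono mult_mono l) (auto intro: l)
  also have "\<dots> \<le> ennreal (l * (ket_norm u)\<^sup>2)"
    unfolding sum_distrib_left[symmetric]
    by (intro ennreal_leI mult_left_mono sum_cmod_power2_le[OF assms(5) L(1)] l(2))
  finally show ?thesis .
qed

text \<open>The error is the cut to \<open>L\<close> of the inner truncation error, plus what this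
  cut removes from the exact coherent state. The factor 2 is that of (a + b)^2 <= 2 a^2 + 2
  b^2.\<close>

lemma smoothed_ket_distance:
  assumes J: "finite J" "J \<subseteq> {j. length j = n}" and L: "finite L" "L \<subseteq> {j. length j = n}"
  shows "(ket_norm (\<lambda>k. coherent_ket n (\<lambda>i. x i + y i) k - displaced_phase n x y * smoothed_ket n J L x y k))\<^sup>2 \<le>
    2 * (1 - (\<Sum>j\<in>J. (cmod (coherent_ket n y j))\<^sup>2)) +
    2 * (1 - (\<Sum>k\<in>L. (cmod (coherent_ket n (\<lambda>i. x i + y i) k))\<^sup>2))"
proof -
  let ?c = "coherent_ket n (\<lambda>i. x i + y i)" and ?p = "displaced_phase n x y"
  let ?r = "\<lambda>k. ?c k - ?p * test_ket n J y x k"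
  let ?a = "\<lambda>k. if k \<in> L then ?r k else 0" and ?b = "\<lambda>k. ?c k - (if k \<in> L then ?c k else 0)"
  have f: "?r \<in> fock n" by (intro fock_diff coherent_ket_fock fock_scale test_ket_fock J)
  have fa: "?a \<in> fock n" by (rule fock_restrict[OF f])
  have fb: "?b \<in> fock n" by (intro fock_diff fock_restrict coherent_ket_fock)
  have a: "(ket_norm ?a)\<^sup>2 \<le> 1 - (\<Sum>j\<in>J. (cmod (coherent_ket n y j))\<^sup>2)"
    using ket_norm_restrict_le[OF f, of L] test_ket_distance[OF J, of x y] by simp
  have b: "(ket_norm ?b)\<^sup>2 = 1 - (\<Sum>k\<in>L. (cmod (?c k))\<^sup>2)"
  proof -
    have "(ket_norm ?b)\<^sup>2 = (\<Sum>\<^sub>\<infinity>k\<in>UNIV - L. (cmod (?c k))\<^sup>2)"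
      unfolding ket_norm_power2 by (rule infsum_cong_neutral) auto
    also have "\<dots> = (ket_norm ?c)\<^sup>2 - (\<Sum>\<^sub>\<infinity>k\<in>L. (cmod (?c k))\<^sup>2)"
      unfolding ket_norm_power2 using coherent_ket_fock[of n "\<lambda>i. x i + y i"] L(1)
      by (intro infsum_Diff) (auto simp: fock_def)
    finally show ?thesis using L(1) by simp
  qed
  have eq: "(\<lambda>k. ?c k - ?p * smoothed_ket n J L x y k) = (\<lambda>k. ?a k + ?b k)"
    by (auto simp: smoothed_ket_def fun_eq_iff)
  have "(ket_norm (\<lambda>k. ?a k + ?b k))\<^sup>2 \<le> (ket_norm ?a + ket_norm ?b)\<^sup>2"
    by (intro power_mono ket_norm_triangle[OF fa fb] ket_norm_nonneg)
  also have "\<dots> \<le> 2 * (ket_norm ?a)\<^sup>2 + 2 * (ket_norm ?b)\<^sup>2"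
    using sum_squares_bound[of "ket_norm ?a" "ket_norm ?b"] by (simp add: power2_sum)
  finally have "(ket_norm (\<lambda>k. ?a k + ?b k))\<^sup>2 \<le> 2 * (ket_norm ?a)\<^sup>2 + 2 * (ket_norm ?b)\<^sup>2" .
  also have "\<dots> \<le> 2 * (1 - (\<Sum>j\<in>J. (cmod (coherent_ket n y j))\<^sup>2)) + 2 * (1 - (\<Sum>k\<in>L. (cmod (?c k))\<^sup>2))"
    by (intro add_mono mult_left_mono a eq_refl[OF b]) auto
  finally show ?thesis unfolding eq .
qed

lemma ket_norm_smoothed_ket_le:
  assumes "finite J" "J \<subseteq> {j. length j = n}"
  shows "ket_norm (smoothed_ket n J L x y) \<le> 1"
proof -
  have "(ket_norm (smoothed_ket n J L x y))\<^sup>2 \<le> (ket_norm (test_ket n J y x))\<^sup>2"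
    unfolding smoothed_ket_def by (rule ket_norm_restrict_le[OF test_ket_fock[OF assms]])
  then have "ket_norm (smoothed_ket n J L x y) \<le> ket_norm (test_ket n J y x)"
    by (rule power2_le_imp_le) simp
  then show ?thesis using ket_norm_test_ket_le[OF assms] by (rule order_trans)
qed

lemma (in prob_space) nn_integral_orthogonal_residual:
  fixes c :: "'j \<Rightarrow> 'a \<Rightarrow> complex" and l :: "'j \<Rightarrow> real"
  assumes c[measurable]: "\<And>j. j \<in> J \<Longrightarrow> c j \<in> borel_measurable M"
    and bounded: "\<And>j \<omega>. j \<in> J \<Longrightarrow> cmod (c j \<omega>) \<le> 1"
    and le: "\<And>\<omega>. (\<Sum>j\<in>J. (cmod (c j \<omega>))\<^sup>2) \<le> 1"
    and norm: "\<And>j. j \<in> J \<Longrightarrow> (\<integral>\<omega>. cnj (c j \<omega>) * c j \<omega> \<partial>M) = of_real (l j)"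
  shows "(\<integral>\<^sup>+\<omega>. ennreal (1 - (\<Sum>j\<in>J. (cmod (c j \<omega>))\<^sup>2)) \<partial>M) = ennreal (1 - (\<Sum>j\<in>J. l j))"
proof -
  have int: "integrable M (\<lambda>\<omega>. (cmod (c j \<omega>))\<^sup>2)" if j: "j \<in> J" for j
  proof (rule integrable_const_bound[where B=1])
    show "AE \<omega> in M. norm ((cmod (c j \<omega>))\<^sup>2) \<le> 1" using bounded[OF j] by (simp add: power_le_one)
    note [measurable] = c[OF j]
    show "(\<lambda>\<omega>. (cmod (c j \<omega>))\<^sup>2) \<in> borel_measurable M" by measurable
  qed
  have val: "(\<integral>\<omega>. (cmod (c j \<omega>))\<^sup>2 \<partial>M) = l j" if "j \<in> J" for j
  proof -
    have "complex_of_real (\<integral>\<omega>. (cmod (c j \<omega>))\<^sup>2 \<partial>M) = (\<integral>\<omega>. complex_of_real ((cmod (c j \<omega>))\<^sup>2) \<partial>M)"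
      by (simp only: integral_complex_of_real)
    also have "\<dots> = of_real (l j)"
      using norm[OF that] unfolding complex_norm_square by (simp add: mult.commute)
    finally show ?thesis by (simp only: of_real_eq_iff)
  qed
  have i: "integrable M (\<lambda>\<omega>. 1 - (\<Sum>j\<in>J. (cmod (c j \<omega>))\<^sup>2))"
    by (intro Bochner_Integration.integrable_diff Bochner_Integration.integrable_sum int) auto
  have "(\<integral>\<^sup>+\<omega>. ennreal (1 - (\<Sum>j\<in>J. (cmod (c j \<omega>))\<^sup>2)) \<partial>M) = ennreal (\<integral>\<omega>. 1 - (\<Sum>j\<in>J. (cmod (c j \<omega>))\<^sup>2) \<partial>M)"
    using le by (intro nn_integral_eq_integral i) auto
  also have "(\<integral>\<omega>. 1 - (\<Sum>j\<in>J. (cmod (c j \<omega>))\<^sup>2) \<partial>M) = 1 - (\<Sum>j\<in>J. l j)"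
    using int val by (subst Bochner_Integration.integral_diff) (auto simp: prob_space)
  finally show ?thesis .
qed

lemma (in prob_space) nn_integral_le_const':
  assumes "\<And>x. x \<in> space M \<Longrightarrow> f x \<le> c"
  shows "(\<integral>\<^sup>+x. f x \<partial>M) \<le> c"
proof -
  have "(\<integral>\<^sup>+x. f x \<partial>M) \<le> (\<integral>\<^sup>+x. c \<partial>M)" by (intro nn_integral_mono assms)
  then show ?thesis by (simp add: emeasure_space_1)
qed

section \<open>Expected cost of random codebooks\<close>

definition energy :: "nat \<Rightarrow> (nat \<Rightarrow> complex) \<Rightarrow> real" where
  "energy n x = (\<Sum>i<n. (cmod (x i))\<^sup>2)"

lemma measurable_energy [measurable]: "energy n \<in> borel_measurable (codeword_gauss n P)"
  unfolding energy_def
  by (intro borel_measurable_sum borel_measurable_power borel_measurable_norm measurable_codeword_component) simp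

text \<open>Index sets \<open>J\<^sub>1, J\<^sub>2, J\<^sub>3\<close> of typical number states for the first user, the second user and the
  sum; eigenvalue bounds \<open>l\<^sub>1, l\<^sub>2, l\<^sub>3\<close> on them; \<open>\<epsilon>\<close> bounds the weight outside.\<close>

locale typical_sets =
  fixes n :: nat and P Q :: real and J1 J2 J3 :: "nat list set" and l1 l2 l3 \<epsilon> :: real
  assumes P: "P > 0" and Q: "Q > 0"
    and J1: "finite J1" "J1 \<subseteq> {j. length j = n}"
    and J2: "finite J2" "J2 \<subseteq> {j. length j = n}"
    and J3: "finite J3" "J3 \<subseteq> {j. length j = n}"
    and l1: "\<And>j. j \<in> J1 \<Longrightarrow> thermal_prod n P j \<le> l1" "0 \<le> l1"
    and l2: "\<And>j. j \<in> J2 \<Longrightarrow> thermal_prod n Q j \<le> l2" "0 \<le> l2"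
    and l3: "\<And>j. j \<in> J3 \<Longrightarrow> thermal_prod n (P + Q) j \<le> l3" "0 \<le> l3"
    and \<epsilon>: "1 - (\<Sum>j\<in>J1. thermal_prod n P j) \<le> \<epsilon>" "1 - (\<Sum>j\<in>J2. thermal_prod n Q j) \<le> \<epsilon>"
      "1 - (\<Sum>j\<in>J3. thermal_prod n (P + Q) j) \<le> \<epsilon>"
    and \<epsilon>0: "0 \<le> \<epsilon>"
begin

text \<open>The squared distance, phase aside, of the test vector from the coherent state it tests
  for. \<open>residual2\<close> is an upper bound for that of the smoothed state.\<close>

definition residual1 where "residual1 x = 1 - (\<Sum>j\<in>J1. (cmod (coherent_ket n x j))\<^sup>2)"

definition residual2 where
  "residual2 x y = 2 * (1 - (\<Sum>j\<in>J2. (cmod (coherent_ket n y j))\<^sup>2)) +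
    2 * (1 - (\<Sum>k\<in>J3. (cmod (coherent_ket n (\<lambda>i. x i + y i) k))\<^sup>2))"

definition overlap where
  "overlap x' y' x y = (cmod (braket (test_ket n J1 x' y') (smoothed_ket n J2 J3 x y)))\<^sup>2"

lemma residual_nonneg: "0 \<le> residual1 x" "0 \<le> residual2 x y"
  unfolding residual1_def residual2_def
  using sum_coherent_ket_le[OF J1, of x] sum_coherent_ket_le[OF J2, of y]
    sum_coherent_ket_le[OF J3, of "\<lambda>i. x i + y i"] by auto

abbreviation "A \<equiv> codeword_gauss n P"
abbreviation "B \<equiv> codeword_gauss n Q"

sublocale A: prob_space A by (rule prob_space_codeword_gauss[OF P])
sublocale B: prob_space B by (rule prob_space_codeword_gauss[OF Q])
sublocale AB: pair_prob_space A B ..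

lemma measurable_fst_component: "i < n \<Longrightarrow> (\<lambda>p. fst p i) \<in> borel_measurable (codeword_gauss n R \<Otimes>\<^sub>M M)"
  and measurable_snd_component: "i < n \<Longrightarrow> (\<lambda>p. snd p i) \<in> borel_measurable (M \<Otimes>\<^sub>M codeword_gauss n R)"
  by (auto intro: measurable_compose[OF measurable_fst measurable_codeword_component]
      measurable_compose[OF measurable_snd measurable_codeword_component])

lemma measurable_coherent_fst [measurable]:
    "(\<lambda>x. coherent_ket n x k) \<in> borel_measurable (codeword_gauss n R)"
  and measurable_coherent_sum [measurable]:
    "(\<lambda>p. coherent_ket n (\<lambda>i. fst p i + snd p i) k) \<in> borel_measurable (A \<Otimes>\<^sub>M B)"
  and measurable_displaced [measurable]:
    "(\<lambda>x. displaced_ket n x j k) \<in> borel_measurable (codeword_gauss n R)"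
  by (intro measurable_coherent_ket measurable_displaced_ket borel_measurable_add
      measurable_codeword_component measurable_fst_component measurable_snd_component; assumption)+

lemma measurable_residual1 [measurable]: "residual1 \<in> borel_measurable A"
  unfolding residual1_def by measurable

lemma measurable_residual2 [measurable]: "(\<lambda>p. residual2 (fst p) (snd p)) \<in> borel_measurable (A \<Otimes>\<^sub>M B)"
  unfolding residual2_def by measurable

lemma measurable_energy_sum [measurable]:
  "(\<lambda>p. energy n (\<lambda>i. fst p i + snd p i)) \<in> borel_measurable (A \<Otimes>\<^sub>M B)"
  unfolding energy_def
  by (intro borel_measurable_sum borel_measurable_power borel_measurable_norm borel_measurable_add
      measurable_fst_component measurable_snd_component) simp_all

text \<open>The outer cut to \<open>J3\<close> makes the inner product a finite sum, from which
  joint measurability in all four words can be read off.\<close>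

lemma overlap_eq:
  "overlap x' y' x y = (cmod (\<Sum>k\<in>J3. cnj (\<Sum>i\<in>J1. coherent_ket n x' i * displaced_ket n y' i k) *
    (\<Sum>j\<in>J2. coherent_ket n y j * displaced_ket n x j k)))\<^sup>2"
  unfolding overlap_def smoothed_ket_def braket_restrict braket_restrict_finite[OF J3(1)]
  by (simp add: test_ket_def)

lemma measurable_overlap [measurable (raw)]:
  assumes [measurable]: "f1 \<in> M \<rightarrow>\<^sub>M A" "f2 \<in> M \<rightarrow>\<^sub>M B" "f3 \<in> M \<rightarrow>\<^sub>M A" "f4 \<in> M \<rightarrow>\<^sub>M B"
  shows "(\<lambda>\<omega>. overlap (f1 \<omega>) (f2 \<omega>) (f3 \<omega>) (f4 \<omega>)) \<in> borel_measurable M"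
  unfolding overlap_eq by measurable

lemma nn_integral_residual1: "(\<integral>\<^sup>+x. ennreal (residual1 x) \<partial>A) \<le> ennreal \<epsilon>"
proof -
  have "(\<integral>\<^sup>+x. ennreal (residual1 x) \<partial>A) = ennreal (1 - (\<Sum>j\<in>J1. thermal_prod n P j))"
    unfolding residual1_def
    by (rule A.nn_integral_orthogonal_residual)
       (use J1 in \<open>auto simp: cmod_coherent_ket_le sum_coherent_ket_le codeword_gauss_orthogonal[OF P]\<close>)
  then show ?thesis using \<epsilon>(1) by (simp add: ennreal_leI)
qed

lemma nn_integral_residual2: "(\<integral>\<^sup>+x. \<integral>\<^sup>+y. ennreal (residual2 x y) \<partial>B \<partial>A) \<le> ennreal (4 * \<epsilon>)"
proof -
  have 2: "(\<integral>\<^sup>+y. ennreal (1 - (\<Sum>j\<in>J2. (cmod (coherent_ket n y j))\<^sup>2)) \<partial>B) \<le> ennreal \<epsilon>"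
    by (rule order_trans[OF eq_refl ennreal_leI[OF \<epsilon>(2)]], rule B.nn_integral_orthogonal_residual)
       (use J2 in \<open>auto simp: cmod_coherent_ket_le sum_coherent_ket_le codeword_gauss_orthogonal[OF Q]\<close>)
  have 3: "(\<integral>\<^sup>+p. ennreal (1 - (\<Sum>k\<in>J3. (cmod (coherent_ket n (\<lambda>i. fst p i + snd p i) k))\<^sup>2)) \<partial>(A \<Otimes>\<^sub>M B)) \<le> ennreal \<epsilon>"
    by (rule order_trans[OF eq_refl ennreal_leI[OF \<epsilon>(3)]], rule AB.nn_integral_orthogonal_residual)
       (use J3 sum_codeword_gauss_orthogonal[OF P Q] in \<open>auto simp: cmod_coherent_ket_le sum_coherent_ket_le\<close>)
  have "(\<integral>\<^sup>+x. \<integral>\<^sup>+y. ennreal (residual2 x y) \<partial>B \<partial>A) = (\<integral>\<^sup>+p. ennreal (residual2 (fst p) (snd p)) \<partial>(A \<Otimes>\<^sub>M B))"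
    by (subst B.nn_integral_fst[symmetric]) auto
  also have "\<dots> = (\<integral>\<^sup>+p. ennreal 2 * ennreal (1 - (\<Sum>j\<in>J2. (cmod (coherent_ket n (snd p) j))\<^sup>2)) +
      ennreal 2 * ennreal (1 - (\<Sum>k\<in>J3. (cmod (coherent_ket n (\<lambda>i. fst p i + snd p i) k))\<^sup>2)) \<partial>(A \<Otimes>\<^sub>M B))"
    unfolding residual2_def using sum_coherent_ket_le[OF J2] sum_coherent_ket_le[OF J3]
    by (intro nn_integral_cong) (simp add: ennreal_mult'[symmetric] ennreal_plus[symmetric] del: ennreal_plus ennreal_numeral)
  also have "\<dots> = ennreal 2 * (\<integral>\<^sup>+p. ennreal (1 - (\<Sum>j\<in>J2. (cmod (coherent_ket n (snd p) j))\<^sup>2)) \<partial>(A \<Otimes>\<^sub>M B)) +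
      ennreal 2 * (\<integral>\<^sup>+p. ennreal (1 - (\<Sum>k\<in>J3. (cmod (coherent_ket n (\<lambda>i. fst p i + snd p i) k))\<^sup>2)) \<partial>(A \<Otimes>\<^sub>M B))"
    by (subst nn_integral_add, measurable) (subst nn_integral_cmult, measurable)+
  also have "\<dots> \<le> ennreal 2 * ennreal \<epsilon> + ennreal 2 * ennreal \<epsilon>"
  proof (intro add_mono mult_left_mono 3)
    have "(\<integral>\<^sup>+p. ennreal (1 - (\<Sum>j\<in>J2. (cmod (coherent_ket n (snd p) j))\<^sup>2)) \<partial>(A \<Otimes>\<^sub>M B)) =
        (\<integral>\<^sup>+x. \<integral>\<^sup>+y. ennreal (1 - (\<Sum>j\<in>J2. (cmod (coherent_ket n y j))\<^sup>2)) \<partial>B \<partial>A)"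
      by (subst B.nn_integral_fst[symmetric]) auto
    also have "\<dots> \<le> ennreal \<epsilon>" by (rule A.nn_integral_le_const') (rule 2)
    finally show "(\<integral>\<^sup>+p. ennreal (1 - (\<Sum>j\<in>J2. (cmod (coherent_ket n (snd p) j))\<^sup>2)) \<partial>(A \<Otimes>\<^sub>M B)) \<le> ennreal \<epsilon>" .
  qed auto
  also have "\<dots> = ennreal (4 * \<epsilon>)"
    using \<epsilon>0 by (simp add: ennreal_mult'[symmetric] ennreal_plus[symmetric] del: ennreal_plus ennreal_numeral)
  finally show ?thesis .
qed

text \<open>Here the test is random and the sent state fixed; in the next two bounds it is the other
  way round.\<close>

lemma nn_integral_overlap1:
  "(\<integral>\<^sup>+x'. ennreal (overlap x' y x y) \<partial>A) \<le> ennreal l1"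
proof -
  let ?v = "smoothed_ket n J2 J3 x y"
  have v: "?v \<in> fock n" by (rule smoothed_ket_fock[OF J2])
  have "cmod (braket (test_ket n J1 x' y) ?v) = cmod (braket ?v (test_ket n J1 x' y))" for x'
    by (subst braket_cnj[symmetric]) simp
  then have "(\<integral>\<^sup>+x'. ennreal (overlap x' y x y) \<partial>A) \<le> ennreal (l1 * (ket_norm ?v)\<^sup>2)"
    unfolding overlap_def using nn_integral_test_ket[OF J1 P v l1] by simp
  also have "\<dots> \<le> ennreal l1"
    using ket_norm_smoothed_ket_le[OF J2, of J3 x y] l1(2) by (intro ennreal_leI mult_left_le) (auto simp: power_le_one)
  finally show ?thesis .
qed

lemma nn_integral_overlap2: "(\<integral>\<^sup>+y. ennreal (overlap x' y' x y) \<partial>B) \<le> ennreal l2"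
  and nn_integral_overlap3: "(\<integral>\<^sup>+x. \<integral>\<^sup>+y. ennreal (overlap x' y' x y) \<partial>B \<partial>A) \<le> ennreal l3"
proof -
  let ?u = "test_ket n J1 x' y'"
  have u: "?u \<in> fock n" by (rule test_ket_fock[OF J1])
  have 1: "l * (ket_norm ?u)\<^sup>2 \<le> l" if "0 \<le> l" for l
    using ket_norm_test_ket_le[OF J1, of x' y'] that by (intro mult_left_le) (auto simp: power_le_one)
  show "(\<integral>\<^sup>+y. ennreal (overlap x' y' x y) \<partial>B) \<le> ennreal l2"
    unfolding overlap_def by (rule order_trans[OF nn_integral_smoothed_ket[OF J2 Q u l2] ennreal_leI[OF 1[OF l2(2)]]])
  show "(\<integral>\<^sup>+x. \<integral>\<^sup>+y. ennreal (overlap x' y' x y) \<partial>B \<partial>A) \<le> ennreal l3"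
    unfolding overlap_def
    by (rule order_trans[OF nn_integral_smoothed_ket_joint[OF J2 P Q u J3 l3] ennreal_leI[OF 1[OF l3(2)]]])
qed

text \<open>The summand anticipates the decoder: 4, 6, 4 are its coefficients, and the division by
  \<open>t\<close> belongs to the later use of a <= t + a^2 / t. As \<open>residual2\<close> has
  mean at most \<open>4 * \<epsilon>\<close>, the residuals add up to 28 = 4 + 6 * 4. Power
  violations and decoding terms form a single cost, so one codebook pair below the average serves
  both.\<close>

lemma exists_codebooks:
  fixes I J :: "nat set" and a1 a2 a3 \<delta> t W :: real
  assumes fin: "finite I" "finite J" "I \<noteq> {}" "J \<noteq> {}" and t: "t > 0" and \<delta>: "0 \<le> \<delta>"
    and a1: "emeasure A {x \<in> space A. a1 < energy n x} \<le> ennreal \<delta>"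
    and a2: "emeasure B {y \<in> space B. a2 < energy n y} \<le> ennreal \<delta>"
    and a3: "emeasure (A \<Otimes>\<^sub>M B) {p \<in> space (A \<Otimes>\<^sub>M B). a3 < energy n (\<lambda>i. fst p i + snd p i)} \<le> ennreal \<delta>"
    and W: "3 * \<delta> + 28 * \<epsilon> / t + 4 / t * (card I * l1 + card J * l2 + card I * card J * l3) < W"
  obtains X Y where
    "(\<Sum>(i, j)\<in>I \<times> J. of_bool (a1 < energy n (X i) \<or> a2 < energy n (Y j) \<or> a3 < energy n (\<lambda>k. X i k + Y j k)) +
       (4 * residual1 (X i) + 6 * residual2 (X i) (Y j) +
        4 * (\<Sum>(i', j')\<in>I \<times> J - {(i, j)}. overlap (X i') (Y j') (X i) (Y j))) / t) \<le> card I * card J * W"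
proof -
  define b1 where "b1 p = (indicator {x \<in> space A. a1 < energy n x} (fst p) :: ennreal)" for p :: "(nat \<Rightarrow> complex) \<times> (nat \<Rightarrow> complex)"
  define b2 where "b2 p = (indicator {y \<in> space B. a2 < energy n y} (snd p) :: ennreal)" for p :: "(nat \<Rightarrow> complex) \<times> (nat \<Rightarrow> complex)"
  define b3 where "b3 p = (indicator {p \<in> space (A \<Otimes>\<^sub>M B). a3 < energy n (\<lambda>i. fst p i + snd p i)} p :: ennreal)" for p
  define f where "f p = b1 p + (b2 p + (b3 p + (ennreal (4 / t) * ennreal (residual1 (fst p)) + ennreal (6 / t) * ennreal (residual2 (fst p) (snd p)))))" for p
  define K where "K = (\<lambda>(x', y', x, y). ennreal (4 / t) * ennreal (overlap x' y' x y))"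
  have [measurable]: "b1 \<in> borel_measurable (A \<Otimes>\<^sub>M B)" "b2 \<in> borel_measurable (A \<Otimes>\<^sub>M B)" "b3 \<in> borel_measurable (A \<Otimes>\<^sub>M B)"
    unfolding b1_def b2_def b3_def by measurable
  have [measurable]: "f \<in> borel_measurable (A \<Otimes>\<^sub>M B)" unfolding f_def by measurable
  have [measurable]: "K \<in> borel_measurable (A \<Otimes>\<^sub>M B \<Otimes>\<^sub>M A \<Otimes>\<^sub>M B)" unfolding K_def split_beta' by measurable
  have "(\<integral>\<^sup>+p. f p \<partial>(A \<Otimes>\<^sub>M B)) = (\<integral>\<^sup>+p. b1 p \<partial>(A \<Otimes>\<^sub>M B)) + ((\<integral>\<^sup>+p. b2 p \<partial>(A \<Otimes>\<^sub>M B)) +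
      ((\<integral>\<^sup>+p. b3 p \<partial>(A \<Otimes>\<^sub>M B)) + (ennreal (4 / t) * (\<integral>\<^sup>+p. ennreal (residual1 (fst p)) \<partial>(A \<Otimes>\<^sub>M B)) +
        ennreal (6 / t) * (\<integral>\<^sup>+p. ennreal (residual2 (fst p) (snd p)) \<partial>(A \<Otimes>\<^sub>M B)))))"
    unfolding f_def by (simp add: nn_integral_add nn_integral_cmult)
  also have "\<dots> \<le> ennreal \<delta> + (ennreal \<delta> + (ennreal \<delta> + (ennreal (4 / t) * ennreal \<epsilon> + ennreal (6 / t) * ennreal (4 * \<epsilon>))))"
  proof (intro add_mono mult_left_mono)
    have "(\<integral>\<^sup>+p. b1 p \<partial>(A \<Otimes>\<^sub>M B)) = (\<integral>\<^sup>+x. \<integral>\<^sup>+y. b1 (x, y) \<partial>B \<partial>A)" by (rule B.nn_integral_fst[symmetric]) measurable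
    also have "\<dots> = (\<integral>\<^sup>+x. indicator {x \<in> space A. a1 < energy n x} x \<partial>A)" by (simp add: b1_def B.emeasure_space_1)
    also have "\<dots> = emeasure A {x \<in> space A. a1 < energy n x}" by (rule nn_integral_indicator) measurable
    finally show "(\<integral>\<^sup>+p. b1 p \<partial>(A \<Otimes>\<^sub>M B)) \<le> ennreal \<delta>" using a1 by simp
    have "(\<integral>\<^sup>+p. b2 p \<partial>(A \<Otimes>\<^sub>M B)) = (\<integral>\<^sup>+x. \<integral>\<^sup>+y. b2 (x, y) \<partial>B \<partial>A)" by (rule B.nn_integral_fst[symmetric]) measurable
    also have "\<dots> = (\<integral>\<^sup>+y. indicator {y \<in> space B. a2 < energy n y} y \<partial>B)" by (simp add: b2_def A.emeasure_space_1)
    also have "\<dots> = emeasure B {y \<in> space B. a2 < energy n y}" by (rule nn_integral_indicator) measurable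
    finally show "(\<integral>\<^sup>+p. b2 p \<partial>(A \<Otimes>\<^sub>M B)) \<le> ennreal \<delta>" using a2 by simp
    have "(\<integral>\<^sup>+p. b3 p \<partial>(A \<Otimes>\<^sub>M B)) = emeasure (A \<Otimes>\<^sub>M B) {p \<in> space (A \<Otimes>\<^sub>M B). a3 < energy n (\<lambda>i. fst p i + snd p i)}"
      unfolding b3_def by (rule nn_integral_indicator) measurable
    then show "(\<integral>\<^sup>+p. b3 p \<partial>(A \<Otimes>\<^sub>M B)) \<le> ennreal \<delta>" using a3 by simp
    have "(\<integral>\<^sup>+p. ennreal (residual1 (fst p)) \<partial>(A \<Otimes>\<^sub>M B)) = (\<integral>\<^sup>+x. \<integral>\<^sup>+y. ennreal (residual1 x) \<partial>B \<partial>A)"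
      by (subst B.nn_integral_fst[symmetric]) auto
    also have "\<dots> = (\<integral>\<^sup>+x. ennreal (residual1 x) \<partial>A)" by (simp add: B.emeasure_space_1)
    finally show "(\<integral>\<^sup>+p. ennreal (residual1 (fst p)) \<partial>(A \<Otimes>\<^sub>M B)) \<le> ennreal \<epsilon>" using nn_integral_residual1 by simp
    have "(\<integral>\<^sup>+p. ennreal (residual2 (fst p) (snd p)) \<partial>(A \<Otimes>\<^sub>M B)) = (\<integral>\<^sup>+x. \<integral>\<^sup>+y. ennreal (residual2 x y) \<partial>B \<partial>A)"
      by (subst B.nn_integral_fst[symmetric]) auto
    then show "(\<integral>\<^sup>+p. ennreal (residual2 (fst p) (snd p)) \<partial>(A \<Otimes>\<^sub>M B)) \<le> ennreal (4 * \<epsilon>)" using nn_integral_residual2 by simp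
  qed auto
  also have "\<dots> = ennreal (3 * \<delta> + 28 * \<epsilon> / t)"
    using \<delta> \<epsilon>0 t by (simp add: ennreal_mult'[symmetric] ennreal_plus[symmetric] del: ennreal_plus)
  finally have fa: "(\<integral>\<^sup>+x. \<integral>\<^sup>+y. f (x, y) \<partial>B \<partial>A) \<le> ennreal (3 * \<delta> + 28 * \<epsilon> / t)"
    by (simp add: B.nn_integral_fst)
  let ?A = "PiM I (\<lambda>_. A)" and ?B = "PiM J (\<lambda>_. B)"
  interpret PA: prob_space ?A by (intro prob_space_PiM A.prob_space_axioms)
  interpret PB: prob_space ?B by (intro prob_space_PiM B.prob_space_axioms)
  define F where "F X Y = (\<Sum>(i, j)\<in>I \<times> J. f (X i, Y j) + (\<Sum>(i', j')\<in>I \<times> J - {(i, j)}. K (X i', Y j', X i, Y j)))" for X Y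
  have "(\<integral>\<^sup>+X. \<integral>\<^sup>+Y. F X Y \<partial>?B \<partial>?A) \<le>
      of_nat (card I * card J) * (ennreal (3 * \<delta> + 28 * \<epsilon> / t) +
        (of_nat (card I) * ennreal (4 / t * l1) + of_nat (card J) * ennreal (4 / t * l2) + of_nat (card I * card J) * ennreal (4 / t * l3)))"
    unfolding F_def
  proof (rule random_codebook[OF A.prob_space_axioms B.prob_space_axioms fin(1,2) _ _ fa])
    note t' = t[THEN less_imp_le]
    have cm: "ennreal (4 / t * l) = ennreal (4 / t) * ennreal l" for l
      using t' by (intro ennreal_mult') simp
    show "(\<integral>\<^sup>+x'. K (x', y, x, y) \<partial>A) \<le> ennreal (4 / t * l1)" if "x \<in> space A" "y \<in> space B" for x y
    proof -
      note [measurable] = that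
      have "(\<lambda>x'. case (x', y, x, y) of (x', y', x, y) \<Rightarrow> overlap x' y' x y) \<in> borel_measurable A" by measurable
      then show ?thesis unfolding K_def cm using nn_integral_overlap1[of y x]
        by (simp add: nn_integral_cmult mult_left_mono)
    qed
    show "(\<integral>\<^sup>+y. K (x, y', x, y) \<partial>B) \<le> ennreal (4 / t * l2)" if "x \<in> space A" "y' \<in> space B" for x y'
    proof -
      note [measurable] = that
      have "(\<lambda>y. case (x, y', x, y) of (x', y', x, y) \<Rightarrow> overlap x' y' x y) \<in> borel_measurable B" by measurable
      then show ?thesis unfolding K_def cm using nn_integral_overlap2[of x y' x]
        by (simp add: nn_integral_cmult mult_left_mono)
    qed
    show "(\<integral>\<^sup>+x. \<integral>\<^sup>+y. K (x', y', x, y) \<partial>B \<partial>A) \<le> ennreal (4 / t * l3)" if "x' \<in> space A" "y' \<in> space B" for x' y'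
    proof -
      note [measurable] = that
      have 1: "(\<lambda>p. case (x', y', p) of (x', y', x, y) \<Rightarrow> overlap x' y' x y) \<in> borel_measurable (A \<Otimes>\<^sub>M B)" by measurable
      have "(\<integral>\<^sup>+x. \<integral>\<^sup>+y. K (x', y', x, y) \<partial>B \<partial>A) = (\<integral>\<^sup>+p. K (x', y', p) \<partial>(A \<Otimes>\<^sub>M B))"
        by (rule B.nn_integral_fst) measurable
      also have "\<dots> = ennreal (4 / t) * (\<integral>\<^sup>+p. ennreal (case p of (x, y) \<Rightarrow> overlap x' y' x y) \<partial>(A \<Otimes>\<^sub>M B))"
        using 1 by (subst nn_integral_cmult[symmetric]) (auto simp: K_def split_beta')
      also have "(\<integral>\<^sup>+p. ennreal (case p of (x, y) \<Rightarrow> overlap x' y' x y) \<partial>(A \<Otimes>\<^sub>M B)) = (\<integral>\<^sup>+x. \<integral>\<^sup>+y. ennreal (overlap x' y' x y) \<partial>B \<partial>A)"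
        using 1 by (subst B.nn_integral_fst[symmetric]) auto
      finally show ?thesis unfolding cm using nn_integral_overlap3[of x' y'] by (simp add: mult_left_mono)
    qed
  qed measurable
  also have "\<dots> = ennreal (card I * card J * (3 * \<delta> + 28 * \<epsilon> / t + 4 / t * (card I * l1 + card J * l2 + card I * card J * l3)))"
    using \<delta> \<epsilon>0 t l1(2) l2(2) l3(2)
    by (simp add: ennreal_mult'[symmetric] ennreal_plus[symmetric] ennreal_of_nat_eq_real_of_nat algebra_simps add_divide_distrib del: ennreal_plus)
  also have "\<dots> < ennreal (card I * card J * W)"
  proof (rule ennreal_lessI)
    have "0 < card I * card J" using fin by (simp add: card_gt_0_iff)
    then have pos: "0 < real (card I * card J)" by (simp only: of_nat_0_less_iff)
    have "0 \<le> 3 * \<delta> + 28 * \<epsilon> / t + 4 / t * (card I * l1 + card J * l2 + card I * card J * l3)"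
      using \<delta> \<epsilon>0 t l1(2) l2(2) l3(2) by auto
    then have "0 < W" using W by linarith
    then show "0 < real (card I * card J) * W" using pos by simp
    show "real (card I * card J) * (3 * \<delta> + 28 * \<epsilon> / t + 4 / t * (card I * l1 + card J * l2 + card I * card J * l3)) < real (card I * card J) * W"
      using W pos by (rule mult_strict_left_mono)
  qed
  \<comment> \<open>The codebooks are fixed one at a time: an \<open>X\<close> with small mean cost
    over the second codebook, and afterwards a \<open>Y\<close> for this \<open>X\<close>.\<close>
  finally obtain X where X: "X \<in> space ?A" "(\<integral>\<^sup>+Y. F X Y \<partial>?B) < ennreal (card I * card J * W)"
    using PA.exists_less_nn_integral by blast
  then obtain Y where Y: "Y \<in> space ?B" "F X Y < ennreal (card I * card J * W)"
    using PB.exists_less_nn_integral by blast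
  have spX: "X i \<in> space A" if "i \<in> I" for i using X(1) that by (auto simp: space_PiM PiE_iff)
  have spY: "Y j \<in> space B" if "j \<in> J" for j using Y(1) that by (auto simp: space_PiM PiE_iff)
  define G where "G i j = of_bool (a1 < energy n (X i) \<or> a2 < energy n (Y j) \<or> a3 < energy n (\<lambda>k. X i k + Y j k)) +
       (4 * residual1 (X i) + 6 * residual2 (X i) (Y j) +
        4 * (\<Sum>(i', j')\<in>I \<times> J - {(i, j)}. overlap (X i') (Y j') (X i) (Y j))) / t" for i j
  have ov0: "0 \<le> overlap x' y' x y" for x' y' x y by (simp add: overlap_def)
  have G0: "0 \<le> G i j" for i j
    unfolding G_def using t residual_nonneg ov0 by (auto intro!: add_nonneg_nonneg divide_nonneg_nonneg sum_nonneg mult_nonneg_nonneg)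
  have "ennreal (\<Sum>(i, j)\<in>I \<times> J. G i j) = (\<Sum>(i, j)\<in>I \<times> J. ennreal (G i j))"
    using G0 by (simp add: split_beta' sum_ennreal)
  also have "\<dots> \<le> F X Y"
    unfolding F_def
  proof (rule sum_mono, clarify)
    fix i j assume ij: "i \<in> I" "j \<in> J"
    let ?S = "\<Sum>(i', j')\<in>I \<times> J - {(i, j)}. overlap (X i') (Y j') (X i) (Y j)"
    have S0: "0 \<le> ?S" by (intro sum_nonneg) (auto simp: ov0)
    have "ennreal (G i j) = ennreal (of_bool (a1 < energy n (X i) \<or> a2 < energy n (Y j) \<or> a3 < energy n (\<lambda>k. X i k + Y j k))) +
        (ennreal (4 / t * residual1 (X i)) + ennreal (6 / t * residual2 (X i) (Y j)) + ennreal (4 / t * ?S))"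
      unfolding G_def using t residual_nonneg[of "X i"] residual_nonneg(2)[of "X i" "Y j"] S0
      by (simp add: ennreal_plus[symmetric] add_divide_distrib del: ennreal_plus)
    also have "\<dots> \<le> (b1 (X i, Y j) + (b2 (X i, Y j) + b3 (X i, Y j))) +
        (ennreal (4 / t) * ennreal (residual1 (X i)) + ennreal (6 / t) * ennreal (residual2 (X i) (Y j)) +
          (\<Sum>(i', j')\<in>I \<times> J - {(i, j)}. K (X i', Y j', X i, Y j)))"
    proof (intro add_mono)
      show "ennreal (of_bool (a1 < energy n (X i) \<or> a2 < energy n (Y j) \<or> a3 < energy n (\<lambda>k. X i k + Y j k))) \<le>
          b1 (X i, Y j) + (b2 (X i, Y j) + b3 (X i, Y j))"
        using spX[OF ij(1)] spY[OF ij(2)]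
        by (auto simp: b1_def b2_def b3_def space_pair_measure indicator_def)
      have "ennreal (4 / t * ?S) = (\<Sum>(i', j')\<in>I \<times> J - {(i, j)}. ennreal (4 / t * overlap (X i') (Y j') (X i) (Y j)))"
        using t ov0 by (subst sum_distrib_left) (simp add: split_beta' sum_ennreal)
      then show "ennreal (4 / t * ?S) \<le> (\<Sum>(i', j')\<in>I \<times> J - {(i, j)}. K (X i', Y j', X i, Y j))"
        using ennreal_mult'[of "4 / t"] t
        by (simp only: K_def split_beta' fst_conv snd_conv order_refl zero_le_divide_iff) simp
    qed (use t in \<open>simp_all only: ennreal_mult'[of "4 / t"] ennreal_mult'[of "6 / t"] order_refl
        zero_le_divide_iff less_imp_le zero_le_numeral simp_thms\<close>)
    finally show "ennreal (G i j) \<le> f (X i, Y j) + (\<Sum>(i', j')\<in>I \<times> J - {(i, j)}. K (X i', Y j', X i, Y j))"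
      by (simp add: f_def add_ac)
  qed
  also note Y(2)
  finally have "ennreal (\<Sum>(i, j)\<in>I \<times> J. G i j) \<le> ennreal (card I * card J * W)" by simp
  moreover have "0 \<le> real (card I * card J) * W"
  proof (rule ccontr)
    assume "\<not> 0 \<le> real (card I * card J) * W"
    then show False using Y(2) by (simp add: ennreal_neg)
  qed
  ultimately have "(\<Sum>(i, j)\<in>I \<times> J. G i j) \<le> card I * card J * W" by (simp add: ennreal_le_iff)
  then show thesis unfolding G_def by (rule that)
qed

end

section \<open>Covert codes\<close>

lemma op_trace_comp_pure_state:
  assumes "bounded_op n \<Lambda>" "\<phi> \<in> fock n"
  shows "op_trace n (\<Lambda> \<circ> pure_state \<phi>) = braket \<phi> (\<Lambda> \<phi>)"
proof -
  have "\<Lambda> (pure_state \<phi> (basis_ket k)) k = cnj (\<phi> k) * \<Lambda> \<phi> k" for k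
    using bounded_opD(2)[OF assms(1,2,2), of "cnj (\<phi> k)" 0]
    unfolding pure_state_def braket_basis_ket by simp
  then have "op_trace n (\<Lambda> \<circ> pure_state \<phi>) = (\<Sum>\<^sub>\<infinity>k\<in>{k. length k = n}. cnj (\<phi> k) * \<Lambda> \<phi> k)"
    by (simp add: op_trace_def)
  then show ?thesis by (simp only: infsum_length_eq_braket[OF assms(2)])
qed

lemma povm_probability:
  assumes "is_povm n I \<Lambda>" "i \<in> I" "\<phi> \<in> fock n" "ket_norm \<phi> = 1"
  shows "0 \<le> Re (braket \<phi> (\<Lambda> i \<phi>))" "Re (braket \<phi> (\<Lambda> i \<phi>)) \<le> 1"
proof -
  have fin: "finite I" and pos: "\<And>i. i \<in> I \<Longrightarrow> positive_op n (\<Lambda> i)"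
    and sum: "(\<lambda>k. \<Sum>i\<in>I. \<Lambda> i \<phi> k) = \<phi>"
    using assms(1,3) by (auto simp: is_povm_def)
  have nn: "0 \<le> Re (braket \<phi> (\<Lambda> i \<phi>))" if "i \<in> I" for i
    using pos[OF that] assms(3) by (auto simp: positive_op_def complex_nonneg_Reals_iff)
  then show "0 \<le> Re (braket \<phi> (\<Lambda> i \<phi>))" using assms(2) .
  have "braket \<phi> (\<lambda>k. \<Sum>i\<in>I. 1 * \<Lambda> i \<phi> k) = (\<Sum>i\<in>I. 1 * braket \<phi> (\<Lambda> i \<phi>))"
    using pos assms(3) by (intro braket_sum_right) (auto simp: positive_op_def dest: bounded_opD(1))
  then have "(\<Sum>i\<in>I. braket \<phi> (\<Lambda> i \<phi>)) = 1" using sum assms(4) by (simp add: braket_self)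
  then have "(\<Sum>i\<in>I. Re (braket \<phi> (\<Lambda> i \<phi>))) = 1" by (simp flip: Re_sum)
  then show "Re (braket \<phi> (\<Lambda> i \<phi>)) \<le> 1"
    using member_le_sum[OF assms(2), of "\<lambda>i. Re (braket \<phi> (\<Lambda> i \<phi>))"] nn fin by auto
qed

text \<open>Carries the numbered outcomes of the sequential decoder over to message pairs.\<close>

lemma is_povm_reindex:
  assumes "is_povm n I \<Lambda>" "bij_betw h I' I"
  shows "is_povm n I' (\<lambda>i. \<Lambda> (h i))"
  unfolding is_povm_def
proof (intro conjI ballI)
  show "finite I'" using assms by (auto simp: is_povm_def bij_betw_finite)
  show "positive_op n (\<Lambda> (h i))" if "i \<in> I'" for i
    using assms that by (auto simp: is_povm_def bij_betw_apply)
  show "(\<lambda>k. \<Sum>i\<in>I'. \<Lambda> (h i) \<psi> k) = \<psi>" if "\<psi> \<in> fock n" for \<psi>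
    using assms that by (simp add: is_povm_def sum.reindex_bij_betw[OF assms(2), of "\<lambda>i. \<Lambda> i \<psi> _"])
qed

lemma tensor_ket_coherent: "tensor_ket n (\<lambda>i. coherent (x i)) = coherent_ket n x"
  by (simp add: coherent_ket_def coherent_eq)

lemma tensor_ket_vacuum: "tensor_ket n (\<lambda>_. vacuum) = coherent_ket n (\<lambda>_. 0)"
proof -
  have "coherent_amp 0 = vacuum" by (auto simp: coherent_amp_def vacuum_def fun_eq_iff)
  then show ?thesis by (simp add: coherent_ket_def)
qed

lemma power_constraint_iff: "n > 0 \<Longrightarrow> power_constraint n N x \<longleftrightarrow> energy n x \<le> real n * N"
  by (simp add: power_constraint_def energy_def field_simps)

lemma energy_scale: "energy n (\<lambda>k. x k / of_real (sqrt (3/2))) = 2/3 * energy n x"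
  unfolding energy_def sum_distrib_left
  by (intro sum.cong) (simp_all add: norm_divide power_divide)

text \<open>sqrt(1/6) + sqrt(2/3) = sqrt(3/2): the helper's word adds in phase to that of each user,
  which is the origin of the 3/2 in the rates.\<close>

lemma receiver_amp_sum: "receiver_amp x y (x + y) = of_real (sqrt (3/2)) * (x + y)"
proof -
  have "sqrt (2/3) = 2 * sqrt (1/6)" "sqrt (3/2) = 3 * sqrt (1/6)"
    by (rule real_sqrt_unique; simp add: power_mult_distrib)+
  then have "complex_of_real (sqrt (2/3)) = 2 * of_real (sqrt (1/6))"
    "complex_of_real (sqrt (3/2)) = 3 * of_real (sqrt (1/6))"
    by (metis of_real_mult of_real_numeral)+
  then show ?thesis unfolding receiver_amp_def by (simp add: algebra_simps)
qed

lemma warden_amp_sum: "warden_amp x y (x + y) = 0"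
  by (simp add: warden_amp_def algebra_simps)

text \<open>Makes the decoder's bound affine in squared norms, whose averages are known, at the
  price of one \<open>t\<close> per norm.\<close>

lemma le_add_square_div:
  fixes a t :: real
  assumes "t > 0"
  shows "a \<le> t + a\<^sup>2 / t"
proof -
  have "0 \<le> (a - t)\<^sup>2 + a\<^sup>2 + t\<^sup>2" by simp
  then have "a * t \<le> t * t + a\<^sup>2" by (simp add: power2_eq_square algebra_simps)
  then show ?thesis using assms by (simp add: field_simps)
qed

text \<open>14 = 6 + 4 + 4 collects the terms \<open>t\<close>. A pair violating a constraint counts
  1 in the cost, which pays both for its decoding error, at most 1, and for its share of the
  warden's state.\<close>

lemma (in typical_sets) covert_code_exists:
  assumes n: "n > 0" and N: "0 \<le> N1" "0 \<le> N2" "0 \<le> N3" and R: "0 \<le> R1" "0 \<le> R2"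
    and t: "t > 0" and \<delta>: "0 \<le> \<delta>"
    and a1: "emeasure A {x \<in> space A. 3/2 * (real n * N1) < energy n x} \<le> ennreal \<delta>"
    and a2: "emeasure B {y \<in> space B. 3/2 * (real n * N2) < energy n y} \<le> ennreal \<delta>"
    and a3: "emeasure (A \<Otimes>\<^sub>M B) {p \<in> space (A \<Otimes>\<^sub>M B). 3/2 * (real n * N3) < energy n (\<lambda>i. fst p i + snd p i)} \<le> ennreal \<delta>"
    and W: "3 * \<delta> + 28 * \<epsilon> / t + 4 / t * (num_messages n R1 * l1 + num_messages n R2 * l2 +
      real (num_messages n R1) * real (num_messages n R2) * l3) < W"
  obtains C where "is_code N1 N2 N3 n R1 R2 C"
    and "0 \<le> error_prob n R1 R2 C" "error_prob n R1 R2 C \<le> 14 * t + W"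
    and "0 \<le> trace_norm n (\<lambda>\<xi> k. warden_avg_state n R1 R2 C \<xi> k - innocent_state n \<xi> k)"
      "trace_norm n (\<lambda>\<xi> k. warden_avg_state n R1 R2 C \<xi> k - innocent_state n \<xi> k) \<le> 2 * W"
proof -
  define I where "I = {1..num_messages n R1}"
  define J where "J = {1..num_messages n R2}"
  have pos: "num_messages n R \<ge> 1" if "0 \<le> R" for R
  proof -
    have "(1::real) \<le> 2 powr (real n * R)" using that by (intro ge_one_powr_ge_zero) auto
    then have "1 \<le> \<lfloor>2 powr (real n * R)\<rfloor>" by (simp add: le_floor_iff)
    then have "nat 1 \<le> nat \<lfloor>2 powr (real n * R)\<rfloor>" by (rule nat_mono)
    then show ?thesis unfolding num_messages_def by simp
  qed
  have fin: "finite I" "finite J" "I \<noteq> {}" "J \<noteq> {}" and card: "card I = num_messages n R1" "card J = num_messages n R2"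
    using pos[OF R(1)] pos[OF R(2)] by (auto simp: I_def J_def)
  have msg: "messages n R1 R2 = I \<times> J" by (simp add: messages_def I_def J_def)
  define Mc where "Mc = card (I \<times> J)"
  have Mc: "Mc \<ge> 1" "real Mc = card I * card J" "real Mc > 0"
    using fin by (auto simp: Mc_def card_cartesian_product Suc_le_eq card_gt_0_iff)
  have "3 * \<delta> + 28 * \<epsilon> / t + 4 / t * (card I * l1 + card J * l2 + card I * card J * l3) < W"
    using W by (simp add: card)
  from exists_codebooks[OF fin t \<delta> a1 a2 a3 this]
  obtain X Y where XY:
    "(\<Sum>(i, j)\<in>I \<times> J. of_bool (3/2 * (real n * N1) < energy n (X i) \<or> 3/2 * (real n * N2) < energy n (Y j) \<or>
         3/2 * (real n * N3) < energy n (\<lambda>k. X i k + Y j k)) +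
       (4 * residual1 (X i) + 6 * residual2 (X i) (Y j) +
        4 * (\<Sum>(i', j')\<in>I \<times> J - {(i, j)}. overlap (X i') (Y j') (X i) (Y j))) / t) \<le> card I * card J * W" .
  define bad where "bad i j \<longleftrightarrow> 3/2 * (real n * N1) < energy n (X i) \<or> 3/2 * (real n * N2) < energy n (Y j) \<or>
         3/2 * (real n * N3) < energy n (\<lambda>k. X i k + Y j k)" for i j
  define S where "S i j = (\<Sum>(i', j')\<in>I \<times> J - {(i, j)}. overlap (X i') (Y j') (X i) (Y j))" for i j
  define D where "D i j = (4 * residual1 (X i) + 6 * residual2 (X i) (Y j) + 4 * S i j) / t" for i j
  have S0: "0 \<le> S i j" for i j unfolding S_def by (intro sum_nonneg) (auto simp: overlap_def)
  have D0: "0 \<le> D i j" for i j unfolding D_def using residual_nonneg S0 t by (simp add: add_nonneg_nonneg)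
  have sum_W: "(\<Sum>(i, j)\<in>I \<times> J. of_bool (bad i j) + D i j) \<le> real Mc * W"
    using XY unfolding Mc(2) bad_def D_def S_def .
  \<comment> \<open>The drawn words are amplitudes at the receiver. The transmitted words are
    smaller by sqrt(3/2), and their energies by the factor 2/3.\<close>
  define s where "s = complex_of_real (sqrt (3/2))"
  have s0: "s \<noteq> 0" by (simp add: s_def)
  define u where "u i = (\<lambda>k. X i k / s)" for i
  define v where "v j = (\<lambda>k. Y j k / s)" for j
  define e1 where "e1 i = (if power_constraint n N1 (u i) then u i else (\<lambda>_. 0))" for i
  define e2 where "e2 j = (if power_constraint n N2 (v j) then v j else (\<lambda>_. 0))" for j
  \<comment> \<open>The helper adds the words actually sent, replaced or not. The warden's amplitude
    is therefore 0 whenever \<open>ok\<close> holds, even for a bad pair.\<close>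
  define ok where "ok i j \<longleftrightarrow> power_constraint n N3 (\<lambda>k. e1 i k + e2 j k)" for i j
  define e3 where "e3 i j = (if ok i j then (\<lambda>k. e1 i k + e2 j k) else (\<lambda>_. 0))" for i j
  have pc0: "power_constraint n N (\<lambda>_. 0)" if "0 \<le> N" for N using that by (simp add: power_constraint_def)
  have e1_pc: "power_constraint n N1 (e1 i)" and e2_pc: "power_constraint n N2 (e2 j)" and e3_pc: "power_constraint n N3 (e3 i j)" for i j
    using pc0 N by (auto simp: e1_def e2_def e3_def ok_def)
  have good: "e1 i = u i" "e2 j = v j" "ok i j" if "\<not> bad i j" for i j
  proof -
    have "energy n (u i) \<le> real n * N1" "energy n (v j) \<le> real n * N2" "energy n (\<lambda>k. (X i k + Y j k) / s) \<le> real n * N3"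
      using that unfolding u_def v_def s_def energy_scale bad_def by auto
    moreover have "(\<lambda>k. (X i k + Y j k) / s) = (\<lambda>k. u i k + v j k)" by (simp add: u_def v_def add_divide_distrib)
    ultimately show "e1 i = u i" "e2 j = v j" "ok i j"
      by (simp_all add: e1_def e2_def ok_def power_constraint_iff[OF n])
  qed
  define \<phi> where "\<phi> = (\<lambda>(i, j). coherent_ket n (\<lambda>k. X i k + Y j k))"
  define st where "st = (\<lambda>(i, j). \<lambda>k. displaced_phase n (Y j) (X i) * test_ket n J1 (X i) (Y j) k)"
  define \<psi> where "\<psi> = (\<lambda>(i, j). \<lambda>k. displaced_phase n (X i) (Y j) * smoothed_ket n J2 J3 (X i) (Y j) k)"
  \<comment> \<open>An arbitrary enumeration of the message pairs serves as the order of the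
    tests.\<close>
  obtain h where h: "bij_betw h {..<Mc} (I \<times> J)"
    using ex_bij_betw_nat_finite[of "I \<times> J"] fin unfolding Mc_def atLeast0LessThan by blast
  define hi where "hi = inv_into {..<Mc} h"
  have hi: "bij_betw hi (I \<times> J) {..<Mc}" unfolding hi_def by (rule bij_betw_inv_into[OF h])
  have h_hi: "h (hi m) = m" if "m \<in> I \<times> J" for m unfolding hi_def by (rule bij_betw_inv_into_right[OF h that])
  obtain \<Lambda> where \<Lambda>: "is_povm n {..<Mc} \<Lambda>"
    and err: "\<And>j. j < Mc \<Longrightarrow> 1 - Re (braket (\<phi> (h j)) (\<Lambda> j (\<phi> (h j)))) \<le>
      6 * ket_norm (\<lambda>k. \<phi> (h j) k - \<psi> (h j) k) + 4 * ket_norm (\<lambda>k. \<phi> (h j) k - st (h j) k) +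
      4 * sqrt (\<Sum>i\<in>{..<Mc} - {j}. (cmod (braket (st (h i)) (\<psi> (h j))))\<^sup>2)"
  proof (rule sequential_decoder[OF Mc(1), of "\<lambda>j. st (h j)" n "\<lambda>j. \<phi> (h j)" "\<lambda>j. \<psi> (h j)"])
    show "st (h j) \<in> fock n" for j
      unfolding st_def split_beta by (intro fock_scale test_ket_fock J1)
    show "\<phi> (h j) \<in> fock n" "ket_norm (\<phi> (h j)) = 1" for j
      unfolding \<phi>_def split_beta by (simp_all add: coherent_ket_fock)
    show "\<psi> (h j) \<in> fock n" for j
      unfolding \<psi>_def split_beta by (intro fock_scale smoothed_ket_fock J2)
  qed blast
  define C where "C = \<lparr>enc1 = e1, enc2 = e2, enc3 = e3, dec = (\<lambda>m. \<Lambda> (hi m))\<rparr>"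
  have povm: "is_povm n (I \<times> J) (dec C)" unfolding C_def by (simp add: is_povm_reindex[OF \<Lambda> hi])
  have code: "is_code N1 N2 N3 n R1 R2 C"
    unfolding is_code_def msg using povm by (simp add: C_def e1_pc e2_pc e3_pc)
  define \<rho> where "\<rho> = (\<lambda>(i, j). coherent_ket n (\<lambda>k. receiver_amp (e1 i k) (e2 j k) (e3 i j k)))"
  have \<rho>: "\<rho> m \<in> fock n" "ket_norm (\<rho> m) = 1" for m
    unfolding \<rho>_def split_beta by (simp_all add: coherent_ket_fock)
  have success: "op_trace n (dec C m \<circ> receiver_state n C m) = braket (\<rho> m) (dec C m (\<rho> m))" if "m \<in> I \<times> J" for m
  proof -
    have "receiver_state n C m = pure_state (\<rho> m)"
      by (simp add: receiver_state_def C_def \<rho>_def split_beta tensor_ket_coherent)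
    moreover have "bounded_op n (dec C m)" using povm that unfolding is_povm_def positive_op_def by blast
    ultimately show ?thesis by (simp add: op_trace_comp_pure_state \<rho>(1))
  qed
  have err_bound: "1 - Re (braket (\<rho> (i, j)) (dec C (i, j) (\<rho> (i, j)))) \<le> of_bool (bad i j) + 14 * t + D i j"
    if ij: "(i, j) \<in> I \<times> J" for i j
  proof (cases "bad i j")
    case True
    then show ?thesis using povm_probability(1)[OF povm ij \<rho>[of "(i, j)"]] D0[of i j] t by simp
  next
    case False
    have \<rho>\<phi>: "\<rho> (i, j) = \<phi> (i, j)"
    proof -
      have "receiver_amp (e1 i k) (e2 j k) (e3 i j k) = X i k + Y j k" for k
      proof -
        have "receiver_amp (e1 i k) (e2 j k) (e3 i j k) = s * (u i k + v j k)"
          unfolding s_def receiver_amp_sum[symmetric] by (simp add: good[OF False] e3_def)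
        also have "\<dots> = X i k + Y j k" using s0 by (simp add: u_def v_def flip: add_divide_distrib)
        finally show ?thesis .
      qed
      then show ?thesis by (simp add: \<rho>_def \<phi>_def)
    qed
    define \<delta>' where "\<delta>' = ket_norm (\<lambda>k. \<phi> (i, j) k - \<psi> (i, j) k)"
    define \<eta> where "\<eta> = ket_norm (\<lambda>k. \<phi> (i, j) k - st (i, j) k)"
    have \<delta>': "\<delta>'\<^sup>2 \<le> residual2 (X i) (Y j)"
      unfolding \<delta>'_def \<phi>_def \<psi>_def residual2_def using smoothed_ket_distance[OF J2 J3, of "X i" "Y j"] by simp
    have \<eta>: "\<eta>\<^sup>2 = residual1 (X i)"
      unfolding \<eta>_def \<phi>_def st_def residual1_def using test_ket_distance[OF J1, of "Y j" "X i"] by (simp add: add.commute)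
    have "(\<Sum>l\<in>{..<Mc} - {hi (i, j)}. (cmod (braket (st (h l)) (\<psi> (h (hi (i, j))))))\<^sup>2) =
        (\<Sum>m\<in>I \<times> J - {(i, j)}. (cmod (braket (st m) (\<psi> (i, j))))\<^sup>2)"
    proof (rule sum.reindex_bij_witness[of _ hi h])
      show "hi (h l) = l" if "l \<in> {..<Mc} - {hi (i, j)}" for l
        using that bij_betw_inv_into_left[OF h] by (auto simp: hi_def)
      show "h l \<in> I \<times> J - {(i, j)}" if "l \<in> {..<Mc} - {hi (i, j)}" for l
        using that bij_betw_apply[OF h, of l] bij_betw_inv_into_left[OF h, of l] by (auto simp: hi_def)
      show "h (hi m) = m" if "m \<in> I \<times> J - {(i, j)}" for m using that by (intro h_hi) simp
      show "hi m \<in> {..<Mc} - {hi (i, j)}" if "m \<in> I \<times> J - {(i, j)}" for m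
      proof -
        have "m \<in> I \<times> J" "m \<noteq> (i, j)" using that by blast+
        then have "hi m \<noteq> hi (i, j)" using h_hi[of m] h_hi[OF ij] by metis
        then show ?thesis using bij_betw_apply[OF hi \<open>m \<in> I \<times> J\<close>] by blast
      qed
    qed (simp add: h_hi[OF ij])
    also have "\<dots> = S i j"
      unfolding S_def overlap_def
      by (intro sum.cong) (auto simp: st_def \<psi>_def braket_scale_left braket_scale_right norm_mult)
    finally have T: "(\<Sum>l\<in>{..<Mc} - {hi (i, j)}. (cmod (braket (st (h l)) (\<psi> (h (hi (i, j))))))\<^sup>2) = S i j" .
    have "hi (i, j) < Mc" using bij_betw_apply[OF hi ij] by simp
    from err[OF this] have "1 - Re (braket (\<rho> (i, j)) (dec C (i, j) (\<rho> (i, j)))) \<le> 6 * \<delta>' + 4 * \<eta> + 4 * sqrt (S i j)"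
      unfolding T unfolding h_hi[OF ij] \<rho>\<phi> \<delta>'_def \<eta>_def by (simp add: C_def)
    also have "\<dots> \<le> 6 * (t + \<delta>'\<^sup>2 / t) + 4 * (t + \<eta>\<^sup>2 / t) + 4 * (t + (sqrt (S i j))\<^sup>2 / t)"
      by (intro add_mono mult_left_mono le_add_square_div t) auto
    also have "\<dots> \<le> 6 * (t + residual2 (X i) (Y j) / t) + 4 * (t + residual1 (X i) / t) + 4 * (t + S i j / t)"
      using \<delta>' \<eta> S0 t by (simp add: divide_right_mono)
    also have "\<dots> = of_bool (bad i j) + 14 * t + D i j"
      using False by (simp add: D_def add_divide_distrib)
    finally show ?thesis .
  qed
  have err_eq: "error_prob n R1 R2 C = (\<Sum>m\<in>I \<times> J. 1 - Re (braket (\<rho> m) (dec C m (\<rho> m)))) / real Mc"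
    unfolding error_prob_def msg Mc_def by (simp add: success)
  have W_bound: "(\<Sum>(i, j)\<in>I \<times> J. of_bool (bad i j) + 14 * t + D i j) \<le> real Mc * (14 * t + W)"
  proof -
    have "(\<Sum>(i, j)\<in>I \<times> J. of_bool (bad i j) + 14 * t + D i j) = (\<Sum>m\<in>I \<times> J. 14 * t) + (\<Sum>(i, j)\<in>I \<times> J. of_bool (bad i j) + D i j)"
      unfolding sum.distrib[symmetric] by (intro sum.cong) auto
    then show ?thesis using sum_W by (simp add: Mc_def algebra_simps)
  qed
  have le: "error_prob n R1 R2 C \<le> 14 * t + W"
  proof -
    have "(\<Sum>m\<in>I \<times> J. 1 - Re (braket (\<rho> m) (dec C m (\<rho> m)))) \<le> (\<Sum>(i, j)\<in>I \<times> J. of_bool (bad i j) + 14 * t + D i j)"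
      using err_bound by (intro sum_mono) auto
    also note W_bound
    finally show ?thesis unfolding err_eq using Mc(3) by (simp add: pos_divide_le_eq mult.commute)
  qed
  have ge: "0 \<le> error_prob n R1 R2 C"
    unfolding err_eq using povm_probability(2)[OF povm _ \<rho>] by (intro divide_nonneg_nonneg sum_nonneg) auto
  define H where "H = {(i, j)\<in>I \<times> J. \<not> ok i j}"
  have finH: "finite H" using fin by (intro finite_subset[of H "I \<times> J"]) (auto simp: H_def)
  have H_bad: "real (card H) \<le> real Mc * W"
  proof -
    have "real (card H) = (\<Sum>m\<in>H. 1)" by simp
    \<comment> \<open>A pair in \<open>H\<close> is bad, so its own summand is at least 1.\<close>
    also have "\<dots> \<le> (\<Sum>(i, j)\<in>H. of_bool (bad i j) + D i j)"
      using D0 good(3) by (intro sum_mono) (auto simp: H_def)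
    also have "\<dots> \<le> (\<Sum>(i, j)\<in>I \<times> J. of_bool (bad i j) + D i j)"
      using D0 fin by (intro sum_mono2) (auto simp: H_def)
    finally show ?thesis using sum_W by simp
  qed
  define \<omega> where "\<omega> = (\<lambda>(i, j). coherent_ket n (\<lambda>k. warden_amp (e1 i k) (e2 j k) (e3 i j k)))"
  define vac where "vac = coherent_ket n (\<lambda>_. 0)"
  \<comment> \<open>Each exceptional pair enters twice, its own state with weight 1/Mc and the
    vacuum with weight -1/Mc. This gives the factor 2 in the trace norm.\<close>
  define a where "a = (\<lambda>(m :: nat \<times> nat, b). (if b then 1 else - 1) / real Mc)"
  define w where "w = (\<lambda>(m, b). if b then \<omega> m else vac)"
  have \<omega>_vac: "\<omega> m = vac" if "m \<in> I \<times> J - H" for m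
    using that by (auto simp: \<omega>_def vac_def H_def e3_def warden_amp_sum)
  have T: "(\<lambda>\<xi> k. warden_avg_state n R1 R2 C \<xi> k - innocent_state n \<xi> k) =
      (\<lambda>\<xi> k. \<Sum>p\<in>H \<times> UNIV. of_real (a p) * pure_state (w p) \<xi> k)"
  proof (intro ext)
    fix \<xi> k
    have "warden_avg_state n R1 R2 C \<xi> k = (\<Sum>m\<in>I \<times> J. pure_state (\<omega> m) \<xi> k) / of_nat Mc"
      unfolding warden_avg_state_def msg Mc_def
      by (simp add: warden_state_def C_def \<omega>_def tensor_ket_coherent split_beta)
    moreover have "innocent_state n \<xi> k = (\<Sum>m\<in>I \<times> J. pure_state vac \<xi> k) / of_nat Mc"
      using Mc(1) by (simp add: innocent_state_def tensor_ket_vacuum vac_def Mc_def[symmetric])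
    ultimately have "warden_avg_state n R1 R2 C \<xi> k - innocent_state n \<xi> k =
        (\<Sum>m\<in>I \<times> J. pure_state (\<omega> m) \<xi> k - pure_state vac \<xi> k) / of_nat Mc"
      by (simp add: sum_subtractf diff_divide_distrib)
    also have "(\<Sum>m\<in>I \<times> J. pure_state (\<omega> m) \<xi> k - pure_state vac \<xi> k) = (\<Sum>m\<in>H. pure_state (\<omega> m) \<xi> k - pure_state vac \<xi> k)"
      using fin \<omega>_vac by (intro sum.mono_neutral_right) (auto simp: H_def)
    also have "\<dots> / of_nat Mc = (\<Sum>m\<in>H. \<Sum>b\<in>UNIV. of_real (a (m, b)) * pure_state (w (m, b)) \<xi> k)"
      unfolding sum_divide_distrib
      by (intro sum.cong) (simp_all add: UNIV_bool a_def w_def diff_divide_distrib)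
    also have "\<dots> = (\<Sum>p\<in>H \<times> UNIV. of_real (a p) * pure_state (w p) \<xi> k)"
      by (simp add: sum.cartesian_product)
    finally show "warden_avg_state n R1 R2 C \<xi> k - innocent_state n \<xi> k = (\<Sum>p\<in>H \<times> UNIV. of_real (a p) * pure_state (w p) \<xi> k)" .
  qed
  have w: "w p \<in> fock n" "ket_norm (w p) \<le> 1" for p
    by (auto simp: w_def \<omega>_def vac_def coherent_ket_fock split: prod.splits)
  have finHU: "finite (H \<times> (UNIV :: bool set))" using finH by simp
  have "(\<Sum>p\<in>H \<times> UNIV. \<bar>a p\<bar>) = 2 * real (card H) / real Mc"
    unfolding sum.cartesian_product' by (simp add: a_def UNIV_bool)
  also have "\<dots> \<le> 2 * W" using H_bad Mc(3) by (simp add: pos_divide_le_eq mult.commute)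
  finally have abs_le: "(\<Sum>p\<in>H \<times> UNIV. \<bar>a p\<bar>) \<le> 2 * W" .
  show thesis
  proof (rule that[OF code ge le])
    show "0 \<le> trace_norm n (\<lambda>\<xi> k. warden_avg_state n R1 R2 C \<xi> k - innocent_state n \<xi> k)"
      unfolding T by (rule trace_norm_le(1)[OF finHU w])
    show "trace_norm n (\<lambda>\<xi> k. warden_avg_state n R1 R2 C \<xi> k - innocent_state n \<xi> k) \<le> 2 * W"
      unfolding T by (rule order_trans[OF trace_norm_le(2)[OF finHU w] abs_le])
  qed
qed

section \<open>Exponential tails\<close>

lemma thermal_eq: "P > 0 \<Longrightarrow> thermal P k = 1 / (P + 1) * (P / (P + 1)) ^ k"
  by (simp add: thermal_def power_divide)

lemma thermal_pos: "P > 0 \<Longrightarrow> thermal P k > 0"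
  by (simp add: thermal_def)

lemma thermal_prod_has_sum:
  assumes "P > 0"
  shows "(thermal_prod n P has_sum 1) {k. length k = n}"
proof -
  have "thermal P sums (1 / (P + 1) * (1 / (1 - P / (P + 1))))"
    unfolding thermal_eq[OF assms] using assms by (intro sums_mult geometric_sums) auto
  then have "thermal P sums 1" using assms by (simp add: field_simps)
  then have s: "(thermal P has_sum 1) UNIV"
    using thermal_pos[OF assms] by (intro sums_nonneg_imp_has_sum) (auto simp: less_imp_le)
  have "((\<lambda>k. \<Prod>i<n. thermal P (k ! i)) has_sum (\<Prod>i<n. 1)) {k. length k = n}"
    using s thermal_pos[OF assms] by (intro has_sum_length_prod(1)) (auto simp: less_imp_le has_sum_imp_summable)
  then show ?thesis by (simp add: thermal_prod_def[abs_def])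
qed

text \<open>A geometric series in each mode, multiplied over the modes. With exponent 1 + s these
  are the moments behind the typical sets.\<close>

lemma thermal_prod_powr_has_sum:
  assumes "P > 0" "s > 0"
  defines "r \<equiv> (P / (P + 1)) powr s"
  shows "((\<lambda>k. thermal_prod n P k powr s) has_sum ((1 / (P + 1)) powr s / (1 - r)) ^ n) {k. length k = n}"
proof -
  have r: "0 \<le> r" "r < 1" unfolding r_def using assms(1,2) powr_less_mono2[of s "P / (P + 1)" 1] by auto
  have eq: "thermal P k powr s = (1 / (P + 1)) powr s * r ^ k" for k
  proof -
    have "((P / (P + 1)) ^ k) powr s = r ^ k"
      using assms(1) by (simp add: r_def powr_power powr_powr mult.commute flip: powr_realpow)
    then show ?thesis using assms(1) by (simp only: thermal_eq powr_mult)
  qed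
  have "(\<lambda>k. thermal P k powr s) sums ((1 / (P + 1)) powr s * (1 / (1 - r)))"
    unfolding eq using r by (intro sums_mult geometric_sums) auto
  then have s: "((\<lambda>k. thermal P k powr s) has_sum (1 / (P + 1)) powr s / (1 - r)) UNIV"
    by (intro sums_nonneg_imp_has_sum) auto
  have "((\<lambda>k. \<Prod>i<n. thermal P (k ! i) powr s) has_sum (\<Prod>i<n. (1 / (P + 1)) powr s / (1 - r))) {k. length k = n}"
    using s by (intro has_sum_length_prod(1)) (auto simp: has_sum_imp_summable)
  then show ?thesis
    using thermal_pos[OF assms(1)] by (simp add: thermal_prod_def prod_powr_distrib less_imp_le)
qed

text \<open>The Renyi-type moment \<open>\<Sum>k. thermal P k powr (1 + s)\<close> has logarithmic derivative \<open>- g P ln 2\<close>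
  at \<open>s = 0\<close>.\<close>

lemma exists_thermal_moment:
  assumes "P > 0" "c < g P"
  obtains s where "s > 0"
    "2 powr (c * s) * ((1 / (P + 1)) powr (1 + s) / (1 - (P / (P + 1)) powr (1 + s))) < 1"
proof -
  define f where "f s = 2 powr (c * s) * ((1 / (P + 1)) powr (1 + s) / (1 - (P / (P + 1)) powr (1 + s)))" for s
  define r where "r = P / (P + 1)"
  have r: "0 < r" "r < 1" "1 - r = 1 / (P + 1)" using assms(1) by (auto simp: r_def field_simps)
  have "((\<lambda>s. 2 powr (c * s) * (1 - r) powr (1 + s)) has_real_derivative (c * ln 2 + ln (1 - r)) * (1 - r)) (at 0)"
    using r by (auto intro!: derivative_eq_intros simp: algebra_simps)
  moreover have "((\<lambda>s. 1 - r powr (1 + s)) has_real_derivative - (r * ln r)) (at 0)"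
    using r by (auto intro!: derivative_eq_intros)
  ultimately have "((\<lambda>s. (2 powr (c * s) * (1 - r) powr (1 + s)) / (1 - r powr (1 + s))) has_real_derivative
      ((c * ln 2 + ln (1 - r)) * (1 - r) * (1 - r powr (1 + 0)) - (2 powr (c * 0) * (1 - r) powr (1 + 0)) * - (r * ln r)) /
        ((1 - r powr (1 + 0)) * (1 - r powr (1 + 0)))) (at 0)"
    by (rule DERIV_divide) (use r(1,2) in simp)
  then have "((\<lambda>s. (2 powr (c * s) * (1 - r) powr (1 + s)) / (1 - r powr (1 + s))) has_real_derivative
      ((c * ln 2 + ln (1 - r)) * (1 - r) * (1 - r) - (1 - r) * - (r * ln r)) / ((1 - r) * (1 - r))) (at 0)"
    using r(1,2) by simp
  also have "((c * ln 2 + ln (1 - r)) * (1 - r) * (1 - r) - (1 - r) * - (r * ln r)) / ((1 - r) * (1 - r)) =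
      c * ln 2 + ln (1 - r) + r * ln r / (1 - r)"
  proof -
    have "((a * u * u - u * - b) / (u * u)) = a + b / u" if "u \<noteq> 0" for a b u :: real
      using that by (simp add: field_simps)
    from this[of "1 - r"] r(1,2) show ?thesis by simp
  qed
  also have "c * ln 2 + ln (1 - r) + r * ln r / (1 - r) = (c - g P) * ln 2"
    using assms(1) unfolding r(3) by (simp add: r_def g_def ln_div log_def field_simps)
  finally have "(f has_real_derivative (c - g P) * ln 2) (at 0)"
    unfolding f_def r_def[symmetric] r(3)[symmetric] times_divide_eq_right .
  moreover have "(c - g P) * ln 2 < 0" using assms(2) by (simp add: mult_neg_pos)
  ultimately obtain d where d: "d > 0" "\<And>h. 0 < h \<Longrightarrow> h < d \<Longrightarrow> f h < f 0"
    using DERIV_neg_dec_right[of f "(c - g P) * ln 2" 0] by auto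
  have "f 0 = 1" using r assms(1) by (simp add: f_def r(3) flip: r_def)
  then show thesis using d(1) d(2)[of "d / 2"] by (intro that[of "d / 2"]) (auto simp: f_def)
qed

text \<open>Typicality is one-sided: only eigenvalues above 2^(-nc) are discarded. On these the
  factor (2^(nc) times the eigenvalue)^s is at least 1, and by Markov their weight is at most
  \<open>q ^ n\<close> with q < 1. To keep the set finite, a finite \<open>K\<close> missing weight
  at most 1 / (n + 1) is chosen beforehand; hence the second term of
  \<open>\<epsilon>\<close>.\<close>

lemma exists_typical_set:
  assumes "P > 0" "c < g P"
  obtains J \<epsilon> where "\<And>n. finite (J n)" "\<And>n. J n \<subseteq> {j. length j = n}"
    "\<And>n j. j \<in> J n \<Longrightarrow> thermal_prod n P j \<le> 2 powr (- (real n * c))"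
    "\<And>n. 1 - (\<Sum>j\<in>J n. thermal_prod n P j) \<le> \<epsilon> n" "\<And>n. 0 \<le> \<epsilon> n" "\<epsilon> \<longlonglongrightarrow> 0"
proof -
  obtain s where s: "s > 0"
    "2 powr (c * s) * ((1 / (P + 1)) powr (1 + s) / (1 - (P / (P + 1)) powr (1 + s))) < 1"
    using exists_thermal_moment[OF assms] .
  define q where "q = 2 powr (c * s) * ((1 / (P + 1)) powr (1 + s) / (1 - (P / (P + 1)) powr (1 + s)))"
  have "(P / (P + 1)) powr (1 + s) \<le> 1" using assms(1) s(1) by (intro powr_le1) auto
  then have q: "0 \<le> q" "q < 1" using s by (auto simp: q_def)
  define \<epsilon> where "\<epsilon> n = q ^ n + 1 / real (Suc n)" for n
  have pos: "thermal_prod n P k > 0" for n k using thermal_pos[OF assms(1)] by (auto simp: thermal_prod_def intro!: prod_pos)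
  have "\<exists>J. finite J \<and> J \<subseteq> {j. length j = n} \<and> (\<forall>j\<in>J. thermal_prod n P j \<le> 2 powr (- (real n * c))) \<and>
     1 - (\<Sum>j\<in>J. thermal_prod n P j) \<le> \<epsilon> n" for n
  proof -
    obtain K where K: "finite K" "K \<subseteq> {k. length k = n}" "dist (\<Sum>k\<in>K. thermal_prod n P k) 1 \<le> 1 / real (Suc n)"
      using has_sum_finite_approximation[OF thermal_prod_has_sum[OF assms(1), of n], of "1 / real (Suc n)"] by auto
    define J where "J = {k \<in> K. thermal_prod n P k \<le> 2 powr (- (real n * c))}"
    have "(\<Sum>k\<in>K - J. thermal_prod n P k) \<le> (\<Sum>k\<in>K - J. 2 powr (real n * c * s) * thermal_prod n P k powr (1 + s))"
    proof (rule sum_mono)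
      fix k assume "k \<in> K - J"
      then have "2 powr (- (real n * c)) \<le> thermal_prod n P k" by (auto simp: J_def)
      then have "2 powr (real n * c) * 2 powr (- (real n * c)) \<le> 2 powr (real n * c) * thermal_prod n P k"
        by (rule mult_left_mono) simp
      then have "1 \<le> (2 powr (real n * c) * thermal_prod n P k) powr s"
        using s(1) by (intro ge_one_powr_ge_zero) (auto simp flip: powr_add)
      then have "thermal_prod n P k * 1 \<le> thermal_prod n P k * (2 powr (real n * c) * thermal_prod n P k) powr s"
        using pos[of n k] by (intro mult_left_mono) auto
      then show "thermal_prod n P k \<le> 2 powr (real n * c * s) * thermal_prod n P k powr (1 + s)"
        using pos[of n k] by (simp add: powr_mult powr_powr powr_add mult_ac)
    qed
    also have "\<dots> \<le> q ^ n"
    proof (rule order_trans[OF finite_sum_le_has_sum])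
      show "((\<lambda>k. 2 powr (real n * c * s) * thermal_prod n P k powr (1 + s)) has_sum
        2 powr (real n * c * s) * ((1 / (P + 1)) powr (1 + s) / (1 - (P / (P + 1)) powr (1 + s))) ^ n) {k. length k = n}"
        using s(1) by (intro has_sum_cmult_right thermal_prod_powr_has_sum assms(1)) auto
      have "2 powr (real n * c * s) = (2 powr (c * s)) ^ n"
        by (simp add: powr_powr mult_ac flip: powr_realpow)
      then show "2 powr (real n * c * s) * ((1 / (P + 1)) powr (1 + s) / (1 - (P / (P + 1)) powr (1 + s))) ^ n \<le> q ^ n"
        by (simp add: q_def power_mult_distrib[symmetric])
    qed (use K in auto)
    finally have "(\<Sum>k\<in>K - J. thermal_prod n P k) \<le> q ^ n" .
    moreover have "(\<Sum>k\<in>K. thermal_prod n P k) = (\<Sum>k\<in>K - J. thermal_prod n P k) + (\<Sum>k\<in>J. thermal_prod n P k)"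
      using K(1) by (intro sum.subset_diff) (auto simp: J_def)
    moreover have "1 - (\<Sum>k\<in>K. thermal_prod n P k) \<le> 1 / real (Suc n)"
      using K(3) unfolding dist_real_def by linarith
    ultimately have "1 - (\<Sum>j\<in>J. thermal_prod n P j) \<le> \<epsilon> n" unfolding \<epsilon>_def by linarith
    then show ?thesis using K by (intro exI[of _ J]) (auto simp: J_def)
  qed
  then obtain J where J: "\<And>n. finite (J n) \<and> J n \<subseteq> {j. length j = n} \<and>
     (\<forall>j\<in>J n. thermal_prod n P j \<le> 2 powr (- (real n * c))) \<and> 1 - (\<Sum>j\<in>J n. thermal_prod n P j) \<le> \<epsilon> n"
    by metis
  have "\<epsilon> \<longlonglongrightarrow> 0 + 0" unfolding \<epsilon>_def
    using q by (intro tendsto_add LIMSEQ_realpow_zero LIMSEQ_Suc[OF lim_1_over_n]) auto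
  then show thesis using J q by (intro that[of J \<epsilon>]) (auto simp: \<epsilon>_def)
qed

section \<open>Chernoff bounds for the energy of codewords\<close>

lemma codeword_gauss_exp_energy:
  assumes "P > 0" "s * P < 1"
  shows "(\<integral>\<^sup>+x. ennreal (exp (s * energy n x)) \<partial>codeword_gauss n P) = ennreal ((1 / (1 - s * P)) ^ n)"
proof -
  interpret GP: prob_space "complex_gauss P" by (rule prob_space_complex_gauss[OF assms(1)])
  interpret product_sigma_finite "\<lambda>_::nat. complex_gauss P" ..
  have "ennreal (exp (s * energy n x)) = (\<Prod>i<n. ennreal (exp (s * (cmod (x i))\<^sup>2)))" for x
    by (simp add: energy_def sum_distrib_left exp_sum prod_ennreal)
  then have "(\<integral>\<^sup>+x. ennreal (exp (s * energy n x)) \<partial>codeword_gauss n P) =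
      (\<Prod>i<n. \<integral>\<^sup>+x. ennreal (exp (s * (cmod x)\<^sup>2)) \<partial>complex_gauss P)"
    by (simp only:) (intro product_nn_integral_prod; measurable)
  also have "\<dots> = ennreal ((1 / (1 - s * P)) ^ n)"
    using assms by (simp add: complex_gauss_exp_moment ennreal_power)
  finally show ?thesis .
qed

lemma codeword_gauss_sum_exp_energy:
  assumes "P > 0" "Q > 0" "s * (P + Q) < 1"
  shows "(\<integral>\<^sup>+p. ennreal (exp (s * energy n (\<lambda>i. fst p i + snd p i))) \<partial>(codeword_gauss n P \<Otimes>\<^sub>M codeword_gauss n Q)) =
    ennreal ((1 / (1 - s * (P + Q))) ^ n)"
proof -
  interpret GP: prob_space "complex_gauss P" by (rule prob_space_complex_gauss[OF assms(1)])
  interpret GQ: prob_space "complex_gauss Q" by (rule prob_space_complex_gauss[OF assms(2)])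
  interpret PP: product_sigma_finite "\<lambda>_::nat. complex_gauss P" ..
  interpret PQ: product_sigma_finite "\<lambda>_::nat. complex_gauss Q" ..
  interpret B: prob_space "codeword_gauss n Q" by (rule prob_space_codeword_gauss[OF assms(2)])
  define h where "h z = ennreal (exp (s * (cmod z)\<^sup>2))" for z
  have [measurable]: "h \<in> borel_measurable borel" unfolding h_def by measurable
  have h_add: "(\<lambda>b. h (c + b)) \<in> borel_measurable (complex_gauss Q)" for c by measurable
  note [measurable] = measurable_codeword_component
  have eq: "ennreal (exp (s * energy n x)) = (\<Prod>i<n. h (x i))" for x
    by (simp add: h_def energy_def sum_distrib_left exp_sum prod_ennreal)
  have "(\<integral>\<^sup>+p. ennreal (exp (s * energy n (\<lambda>i. fst p i + snd p i))) \<partial>(codeword_gauss n P \<Otimes>\<^sub>M codeword_gauss n Q)) =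
      (\<integral>\<^sup>+x. \<integral>\<^sup>+y. (\<Prod>i<n. h (x i + y i)) \<partial>codeword_gauss n Q \<partial>codeword_gauss n P)"
    unfolding eq by (subst B.nn_integral_fst[symmetric]) auto
  also have "\<dots> = (\<integral>\<^sup>+x. (\<Prod>i<n. \<integral>\<^sup>+b. h (x i + b) \<partial>complex_gauss Q) \<partial>codeword_gauss n P)"
    by (intro nn_integral_cong PQ.product_nn_integral_prod) (simp_all add: h_add)
  also have "\<dots> = (\<Prod>i<n. \<integral>\<^sup>+a. \<integral>\<^sup>+b. h (a + b) \<partial>complex_gauss Q \<partial>complex_gauss P)"
    by (intro PP.product_nn_integral_prod) (simp, measurable)
  also have "(\<integral>\<^sup>+a. \<integral>\<^sup>+b. h (a + b) \<partial>complex_gauss Q \<partial>complex_gauss P) = (\<integral>\<^sup>+z. h z \<partial>complex_gauss (P + Q))"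
    unfolding complex_gauss_convolution[OF assms(1,2), symmetric]
    by (simp add: nn_integral_distr split_beta' GQ.nn_integral_fst[symmetric])
  also have "\<dots> = ennreal (1 / (1 - s * (P + Q)))"
    unfolding h_def using assms by (intro complex_gauss_exp_moment) auto
  finally show ?thesis using assms by (simp add: ennreal_power)
qed

text \<open>As a function of s the quotient has value 1 and derivative P - N < 0 at 0, so it drops
  below 1 for small positive s.\<close>

lemma exists_chernoff_parameter:
  fixes P N :: real
  assumes "0 < P" "P < N"
  obtains s where "s > 0" "s * P < 1" "exp (- s * N) / (1 - s * P) < 1"
proof -
  define f where "f s = exp (- s * N) / (1 - s * P)" for s
  have "(f has_real_derivative P - N) (at 0)"
    unfolding f_def by (auto intro!: derivative_eq_intros)
  then obtain d where d: "d > 0" "\<And>h. 0 < h \<Longrightarrow> h < d \<Longrightarrow> f h < f 0"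
    using DERIV_neg_dec_right[of f "P - N" 0] assms by auto
  \<comment> \<open>The second bound keeps \<open>s * P\<close> at most 1/2, so that the exponential
    moment is finite.\<close>
  define s where "s = min (d / 2) (1 / (2 * P))"
  have "s * P \<le> 1 / (2 * P) * P" unfolding s_def using assms by (intro mult_right_mono) auto
  then have "s * P < 1" using assms by simp
  moreover have "0 < s" "s < d" using d(1) assms by (auto simp: s_def min_def)
  ultimately show thesis using d(2)[of s] by (intro that[of s]) (auto simp: f_def)
qed

text \<open>Markov's inequality for exp(s E), with \<open>E\<close> general so as to cover a single
  word and the sum of two words.\<close>

lemma exp_moment_tail:
  fixes E :: "'a \<Rightarrow> real"
  assumes [measurable]: "E \<in> borel_measurable M" and "s > 0" "s * P < 1"
    and moment: "(\<integral>\<^sup>+x. ennreal (exp (s * E x)) \<partial>M) = ennreal ((1 / (1 - s * P)) ^ n)"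
  shows "emeasure M {x \<in> space M. real n * N < E x} \<le> ennreal ((exp (- s * N) / (1 - s * P)) ^ n)"
proof -
  have "emeasure M {x \<in> space M. real n * N < E x} = (\<integral>\<^sup>+x. indicator {x \<in> space M. real n * N < E x} x \<partial>M)"
    by (intro nn_integral_indicator[symmetric]) measurable
  also have "\<dots> \<le> (\<integral>\<^sup>+x. ennreal (exp (- s * (real n * N))) * ennreal (exp (s * E x)) \<partial>M)"
  proof (intro nn_integral_mono)
    fix x
    show "indicator {x \<in> space M. real n * N < E x} x \<le> ennreal (exp (- s * (real n * N))) * ennreal (exp (s * E x))"
    proof (cases "real n * N < E x")
      case True
      then have "s * (real n * N) \<le> s * E x" using assms(2) by (intro mult_left_mono) auto
      then have "1 \<le> exp (- s * (real n * N)) * exp (s * E x)" by (simp flip: exp_add)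
      then show ?thesis by (simp add: indicator_def ennreal_leI flip: ennreal_mult')
    qed simp
  qed
  also have "\<dots> = ennreal (exp (- s * (real n * N))) * ennreal ((1 / (1 - s * P)) ^ n)"
    by (simp add: nn_integral_cmult moment)
  also have "\<dots> = ennreal ((exp (- s * N) / (1 - s * P)) ^ n)"
  proof -
    have "exp (- s * (real n * N)) = exp (- s * N) ^ n"
      by (simp add: mult_ac flip: exp_of_nat_mult)
    then show ?thesis by (simp add: power_divide flip: ennreal_mult')
  qed
  finally show ?thesis .
qed

lemma exists_energy_tail:
  assumes "P > 0" "P < N"
  obtains q where "0 \<le> q" "q < 1"
    "\<And>n. emeasure (codeword_gauss n P) {x \<in> space (codeword_gauss n P). real n * N < energy n x} \<le> ennreal (q ^ n)"
proof -
  obtain s where s: "s > 0" "s * P < 1" "exp (- s * N) / (1 - s * P) < 1"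
    using exists_chernoff_parameter[OF assms] .
  show thesis
    using s by (intro that[of "exp (- s * N) / (1 - s * P)"] exp_moment_tail codeword_gauss_exp_energy assms) auto
qed

lemma exists_sum_energy_tail:
  assumes "P > 0" "Q > 0" "P + Q < N"
  obtains q where "0 \<le> q" "q < 1"
    "\<And>n. emeasure (codeword_gauss n P \<Otimes>\<^sub>M codeword_gauss n Q)
      {p \<in> space (codeword_gauss n P \<Otimes>\<^sub>M codeword_gauss n Q). real n * N < energy n (\<lambda>i. fst p i + snd p i)} \<le> ennreal (q ^ n)"
proof -
  have "P + Q > 0" using assms by simp
  then obtain s where s: "s > 0" "s * (P + Q) < 1" "exp (- s * N) / (1 - s * (P + Q)) < 1"
    using exists_chernoff_parameter[of "P + Q" N] assms(3) by blast
  have m: "(\<lambda>p. energy n (\<lambda>i. fst p i + snd p i)) \<in> borel_measurable (codeword_gauss n P \<Otimes>\<^sub>M codeword_gauss n Q)" for n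
    unfolding energy_def using measurable_codeword_component[measurable] by measurable
  show thesis
    using s by (intro that[of "exp (- s * N) / (1 - s * (P + Q))"] exp_moment_tail m codeword_gauss_sum_exp_energy assms) auto
qed

section \<open>Achievable rates\<close>

lemma num_messages_le: "real (num_messages n R) \<le> 2 powr (real n * R)"
proof -
  have "0 \<le> \<lfloor>2 powr (real n * R)\<rfloor>" by simp
  then have "real (num_messages n R) = of_int \<lfloor>2 powr (real n * R)\<rfloor>" unfolding num_messages_def by simp
  also have "\<dots> \<le> 2 powr (real n * R)" by (rule of_int_floor_le)
  finally show ?thesis .
qed

lemma tendsto_powr_times_powr_minus:
  assumes "R < c" and a: "\<And>n. 0 \<le> a n" "\<And>n. a n \<le> 2 powr (real n * R)"
  shows "(\<lambda>n. a n * 2 powr (- (real n * c))) \<longlonglongrightarrow> 0"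
proof (rule tendsto_sandwich[OF _ _ tendsto_const])
  have "2 powr (R - c) < 1" using assms(1) powr_less_mono[of "R - c" 0 2] by simp
  then show "(\<lambda>n. (2 powr (R - c)) ^ n) \<longlonglongrightarrow> 0" by (intro LIMSEQ_realpow_zero) auto
  have "a n * 2 powr (- (real n * c)) \<le> (2 powr (R - c)) ^ n" for n
  proof -
    have "a n * 2 powr (- (real n * c)) \<le> 2 powr (real n * R) * 2 powr (- (real n * c))"
      by (intro mult_right_mono a) simp
    also have "\<dots> = (2 powr (R - c)) ^ n" by (simp add: powr_power algebra_simps flip: powr_add)
    finally show ?thesis .
  qed
  then show "\<forall>\<^sub>F n in sequentially. a n * 2 powr (- (real n * c)) \<le> (2 powr (R - c)) ^ n" by simp
qed (use a in simp)

text \<open>Every strict inequality is a source of exponential decay: the gaps below the entropies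
  beat the numbers of candidates, and the gaps below the power constraints give the energy
  tails.\<close>

lemma achievable_gaussian:
  assumes PQ: "P > 0" "Q > 0" and N: "P < 3/2 * N1" "Q < 3/2 * N2" "P + Q < 3/2 * N3"
    and R: "0 \<le> R1" "0 \<le> R2" "R1 < g P" "R2 < g Q" "R1 + R2 < g (P + Q)"
  shows "achievable N1 N2 N3 (R1, R2)"
proof -
  have PQ0: "P + Q > 0" using PQ by simp
  obtain c1 c2 c3 where c: "R1 < c1" "c1 < g P" "R2 < c2" "c2 < g Q" "R1 + R2 < c3" "c3 < g (P + Q)"
    using R(3-5) by (meson dense)
  obtain J1 \<epsilon>1 where J1: "\<And>n. finite (J1 n)" "\<And>n. J1 n \<subseteq> {j. length j = n}"
    "\<And>n j. j \<in> J1 n \<Longrightarrow> thermal_prod n P j \<le> 2 powr (- (real n * c1))"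
    "\<And>n. 1 - (\<Sum>j\<in>J1 n. thermal_prod n P j) \<le> \<epsilon>1 n" "\<And>n. 0 \<le> \<epsilon>1 n" "\<epsilon>1 \<longlonglongrightarrow> 0"
    using exists_typical_set[OF PQ(1) c(2)] by metis
  obtain J2 \<epsilon>2 where J2: "\<And>n. finite (J2 n)" "\<And>n. J2 n \<subseteq> {j. length j = n}"
    "\<And>n j. j \<in> J2 n \<Longrightarrow> thermal_prod n Q j \<le> 2 powr (- (real n * c2))"
    "\<And>n. 1 - (\<Sum>j\<in>J2 n. thermal_prod n Q j) \<le> \<epsilon>2 n" "\<And>n. 0 \<le> \<epsilon>2 n" "\<epsilon>2 \<longlonglongrightarrow> 0"
    using exists_typical_set[OF PQ(2) c(4)] by metis
  obtain J3 \<epsilon>3 where J3: "\<And>n. finite (J3 n)" "\<And>n. J3 n \<subseteq> {j. length j = n}"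
    "\<And>n j. j \<in> J3 n \<Longrightarrow> thermal_prod n (P + Q) j \<le> 2 powr (- (real n * c3))"
    "\<And>n. 1 - (\<Sum>j\<in>J3 n. thermal_prod n (P + Q) j) \<le> \<epsilon>3 n" "\<And>n. 0 \<le> \<epsilon>3 n" "\<epsilon>3 \<longlonglongrightarrow> 0"
    using exists_typical_set[OF PQ0 c(6)] by metis
  define \<epsilon> where "\<epsilon> n = \<epsilon>1 n + \<epsilon>2 n + \<epsilon>3 n" for n
  have \<epsilon>: "\<epsilon> \<longlonglongrightarrow> 0" "\<And>n. 0 \<le> \<epsilon> n"
    unfolding \<epsilon>_def using tendsto_add[OF tendsto_add[OF J1(6) J2(6)] J3(6)] J1(5) J2(5) J3(5)
    by (auto intro!: add_nonneg_nonneg)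
  obtain q1 where q1: "0 \<le> q1" "q1 < 1"
    "\<And>n. emeasure (codeword_gauss n P) {x \<in> space (codeword_gauss n P). real n * (3/2 * N1) < energy n x} \<le> ennreal (q1 ^ n)"
    by (rule exists_energy_tail[OF PQ(1) N(1)]) (rule that; assumption)
  obtain q2 where q2: "0 \<le> q2" "q2 < 1"
    "\<And>n. emeasure (codeword_gauss n Q) {x \<in> space (codeword_gauss n Q). real n * (3/2 * N2) < energy n x} \<le> ennreal (q2 ^ n)"
    by (rule exists_energy_tail[OF PQ(2) N(2)]) (rule that; assumption)
  obtain q3 where q3: "0 \<le> q3" "q3 < 1"
    "\<And>n. emeasure (codeword_gauss n P \<Otimes>\<^sub>M codeword_gauss n Q)
      {p \<in> space (codeword_gauss n P \<Otimes>\<^sub>M codeword_gauss n Q). real n * (3/2 * N3) < energy n (\<lambda>i. fst p i + snd p i)} \<le> ennreal (q3 ^ n)"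
    by (rule exists_sum_energy_tail[OF PQ N(3)]) (rule that; assumption)
  define \<delta> where "\<delta> n = q1 ^ n + q2 ^ n + q3 ^ n" for n
  have \<delta>0: "0 \<le> \<delta> n" "q1 ^ n \<le> \<delta> n" "q2 ^ n \<le> \<delta> n" "q3 ^ n \<le> \<delta> n" for n
    using q1(1) q2(1) q3(1) by (simp_all add: \<delta>_def)
  have "\<delta> \<longlonglongrightarrow> 0 + 0 + 0"
    unfolding \<delta>_def using q1 q2 q3 by (intro tendsto_add LIMSEQ_realpow_zero) auto
  then have \<delta>: "\<delta> \<longlonglongrightarrow> 0" by simp
  define M1 where "M1 n = real (num_messages n R1)" for n
  define M2 where "M2 n = real (num_messages n R2)" for n
  define l1 where "l1 n = 2 powr (- (real n * c1))" for n
  define l2 where "l2 n = 2 powr (- (real n * c2))" for n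
  define l3 where "l3 n = 2 powr (- (real n * c3))" for n
  define E where "E n = 28 * \<epsilon> n + 4 * (M1 n * l1 n + M2 n * l2 n + M1 n * M2 n * l3 n)" for n
  have E0: "0 \<le> E n" for n using \<epsilon>(2) by (simp add: E_def M1_def M2_def l1_def l2_def l3_def)
  have "M1 n * M2 n \<le> 2 powr (real n * (R1 + R2))" for n
    unfolding M1_def M2_def distrib_left powr_add by (intro mult_mono num_messages_le) auto
  then have "(\<lambda>n. M1 n * l1 n) \<longlonglongrightarrow> 0" "(\<lambda>n. M2 n * l2 n) \<longlonglongrightarrow> 0" "(\<lambda>n. M1 n * M2 n * l3 n) \<longlonglongrightarrow> 0"
    using num_messages_le c unfolding l1_def l2_def l3_def
    by (auto intro!: tendsto_powr_times_powr_minus simp: M1_def M2_def)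
  then have "E \<longlonglongrightarrow> 28 * 0 + 4 * (0 + 0 + 0)"
    unfolding E_def by (intro tendsto_intros \<epsilon>(1))
  then have E: "E \<longlonglongrightarrow> 0" by simp
  define e where "e n = 1 / real (Suc n)" for n
  have e: "e \<longlonglongrightarrow> 0" "e n > 0" for n
    unfolding e_def using LIMSEQ_Suc[OF lim_1_over_n] by auto
  \<comment> \<open>Both \<open>t\<close> and E/t must tend to 0, which the square root balances.
    The summand \<open>e n\<close> keeps \<open>t n\<close> positive even if \<open>E n\<close> is
    0; a further \<open>e n\<close> in \<open>W\<close> will make its defining inequality
    strict.\<close>
  define t where "t n = sqrt (E n + e n)" for n
  have t0: "t n > 0" for n using E0[of n] e(2)[of n] by (simp add: t_def add_nonneg_pos)
  have "t \<longlonglongrightarrow> sqrt (0 + 0)" unfolding t_def by (intro tendsto_intros E e)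
  then have t: "t \<longlonglongrightarrow> 0" by simp
  define W where "W n = 3 * \<delta> n + t n + e n" for n
  have "W \<longlonglongrightarrow> 3 * 0 + 0 + 0" unfolding W_def by (intro tendsto_intros \<delta> e t)
  then have W: "W \<longlonglongrightarrow> 0" by simp
  have W_gt: "3 * \<delta> n + 28 * \<epsilon> n / t n + 4 / t n * (M1 n * l1 n + M2 n * l2 n + M1 n * M2 n * l3 n) < W n" for n
  proof -
    have "E n / t n \<le> (t n)\<^sup>2 / t n"
      using E0[of n] e(2)[of n] t0[of n] by (intro divide_right_mono) (auto simp: t_def)
    also have "\<dots> = t n" using t0[of n] by (simp add: power2_eq_square)
    finally have "E n / t n \<le> t n" .
    moreover have "28 * \<epsilon> n / t n + 4 / t n * (M1 n * l1 n + M2 n * l2 n + M1 n * M2 n * l3 n) = E n / t n"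
      by (simp add: E_def add_divide_distrib)
    ultimately show ?thesis using e(2)[of n] by (simp add: W_def)
  qed
  have N0: "0 \<le> N1" "0 \<le> N2" "0 \<le> N3" using PQ N by linarith+
  define good where "good n C \<longleftrightarrow> is_code N1 N2 N3 n R1 R2 C \<and>
      (0 \<le> error_prob n R1 R2 C \<and> error_prob n R1 R2 C \<le> 14 * t n + W n) \<and>
      (0 \<le> trace_norm n (\<lambda>\<xi> k. warden_avg_state n R1 R2 C \<xi> k - innocent_state n \<xi> k) \<and>
       trace_norm n (\<lambda>\<xi> k. warden_avg_state n R1 R2 C \<xi> k - innocent_state n \<xi> k) \<le> 2 * W n)" for n C
  have "\<exists>C. good n C" if n: "n > 0" for n
  proof -
    interpret typical_sets n P Q "J1 n" "J2 n" "J3 n" "l1 n" "l2 n" "l3 n" "\<epsilon> n"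
    proof
      show "1 - sum (thermal_prod n P) (J1 n) \<le> \<epsilon> n" using J1(4)[of n] J2(5)[of n] J3(5)[of n] by (simp add: \<epsilon>_def)
      show "1 - sum (thermal_prod n Q) (J2 n) \<le> \<epsilon> n" using J2(4)[of n] J1(5)[of n] J3(5)[of n] by (simp add: \<epsilon>_def)
      show "1 - sum (thermal_prod n (P + Q)) (J3 n) \<le> \<epsilon> n" using J3(4)[of n] J1(5)[of n] J2(5)[of n] by (simp add: \<epsilon>_def)
    qed (use PQ J1 J2 J3 \<epsilon> in \<open>auto simp: l1_def l2_def l3_def\<close>)
    have tails: "emeasure A {x \<in> space A. 3/2 * (real n * N1) < energy n x} \<le> ennreal (\<delta> n)"
      "emeasure B {x \<in> space B. 3/2 * (real n * N2) < energy n x} \<le> ennreal (\<delta> n)"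
      "emeasure (A \<Otimes>\<^sub>M B) {p \<in> space (A \<Otimes>\<^sub>M B). 3/2 * (real n * N3) < energy n (\<lambda>i. fst p i + snd p i)} \<le> ennreal (\<delta> n)"
      unfolding mult.left_commute[of "3/2"]
      using q1(3)[of n] q2(3)[of n] q3(3)[of n] \<delta>0(2-4)[of n] by (meson ennreal_leI order_trans)+
    show ?thesis
      by (rule covert_code_exists[OF n N0 R(1,2) t0 \<delta>0(1) tails W_gt[unfolded M1_def M2_def]])
        (auto simp: good_def)
  qed
  then obtain C where "\<And>n. n > 0 \<Longrightarrow> good n (C n)" by metis
  note C = this[unfolded good_def, THEN conjunct1] this[unfolded good_def, THEN conjunct2, THEN conjunct1]
    this[unfolded good_def, THEN conjunct2, THEN conjunct2]
  have "(\<lambda>n. error_prob n R1 R2 (C n)) \<longlonglongrightarrow> 0"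
  proof (rule tendsto_sandwich[OF _ _ tendsto_const])
    have "(\<lambda>n. 14 * t n + W n) \<longlonglongrightarrow> 14 * 0 + 0" by (intro tendsto_intros t W)
    then show "(\<lambda>n. 14 * t n + W n) \<longlonglongrightarrow> 0" by simp
  qed (use C(2) in \<open>auto intro: eventually_mono[OF eventually_gt_at_top[of 0]]\<close>)
  moreover have "(\<lambda>n. trace_norm n (\<lambda>\<xi> k. warden_avg_state n R1 R2 (C n) \<xi> k - innocent_state n \<xi> k)) \<longlonglongrightarrow> 0"
  proof (rule tendsto_sandwich[OF _ _ tendsto_const])
    have "(\<lambda>n. 2 * W n) \<longlonglongrightarrow> 2 * 0" by (intro tendsto_intros W)
    then show "(\<lambda>n. 2 * W n) \<longlonglongrightarrow> 0" by simp
  qed (use C(3) in \<open>auto intro: eventually_mono[OF eventually_gt_at_top[of 0]]\<close>)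
  ultimately show ?thesis unfolding achievable_def using C(1) R(1,2) by auto
qed

section \<open>The rate region\<close>

lemma g_has_derivative:
  assumes "x > 0"
  shows "(g has_real_derivative log 2 (x + 1) - log 2 x) (at x)"
proof -
  have "((\<lambda>x. (x + 1) * log 2 (x + 1) - x * log 2 x) has_real_derivative log 2 (x + 1) - log 2 x) (at x)"
  proof -
    have d: "((\<lambda>x. x * log 2 x) has_real_derivative log 2 y + 1 / ln 2) (at y)" if "y > 0" for y :: real
      using that by (auto intro!: derivative_eq_intros simp: log_def add_divide_distrib)
    have "((\<lambda>x. (x + 1) * log 2 (x + 1)) has_real_derivative log 2 (x + 1) + 1 / ln 2) (at x)"
      using d[of "x + 1"] assms by (simp add: DERIV_shift[of "\<lambda>x. x * log 2 x"])
    from DERIV_diff[OF this d[OF assms]] show ?thesis by simp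
  qed
  then show ?thesis
  proof (rule DERIV_cong_ev[OF refl _ refl, THEN iffD2, rotated])
    show "\<forall>\<^sub>F x in nhds x. g x = (x + 1) * log 2 (x + 1) - x * log 2 x"
    proof -
      have "\<forall>\<^sub>F x in nhds x. x \<in> {0<..}" using assms by (intro eventually_nhds_in_open) auto
      then show ?thesis by eventually_elim (simp add: g_def)
    qed
  qed
qed

lemma isCont_g: "x > 0 \<Longrightarrow> isCont g x"
  by (rule DERIV_isCont[OF g_has_derivative])

text \<open>Only 0 needs care, where x log x tends to 0; elsewhere \<open>g\<close> is
  differentiable.\<close>

lemma continuous_on_g: "continuous_on {0..} g"
  unfolding continuous_on_eq_continuous_within
proof
  fix x :: real assume x: "x \<in> {0..}"
  show "continuous (at x within {0..}) g"
  proof (cases "x = 0")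
    case True
    have "((\<lambda>x::real. (x + 1) * log 2 (x + 1) - x * log 2 x) \<longlongrightarrow> 0) (at_right 0)" by real_asymp
    then have "(g \<longlongrightarrow> 0) (at_right 0)"
      by (rule Lim_transform_eventually) (auto simp: g_def eventually_at_filter)
    then have "(g \<longlongrightarrow> 0) (at 0 within {0..})" by (simp add: at_within_Ici_at_right)
    then show ?thesis using True by (simp add: continuous_within g_def)
  next
    case False
    then have "isCont g x" using x by (intro isCont_g) auto
    then show ?thesis by (rule continuous_at_imp_continuous_at_within)
  qed
qed

lemma g_strict_mono:
  assumes "0 \<le> x" "x < y"
  shows "g x < g y"
proof (rule DERIV_pos_imp_increasing_open[OF assms(2)])
  show "continuous_on {x..y} g" by (rule continuous_on_subset[OF continuous_on_g]) (use assms in auto)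
  fix z assume "x < z" "z < y"
  then have z: "z > 0" using assms by simp
  then show "\<exists>d. (g has_real_derivative d) (at z) \<and> 0 < d"
    by (intro exI[of _ "log 2 (z + 1) - log 2 z"] conjI g_has_derivative) simp_all
qed

text \<open>Subadditivity holds because \<open>g\<close> is concave with \<open>g 0 = 0\<close>.\<close>

lemma g_subadditive:
  assumes "0 \<le> a" "0 \<le> b"
  shows "g (a + b) \<le> g a + g b"
proof (cases "a = 0 \<or> b = 0")
  case False
  then have ab: "a > 0" "b > 0" using assms by auto
  define h where "h x = g x - g (x + b)" for x
  have "h 0 < h a"
  proof (rule DERIV_pos_imp_increasing_open[OF ab(1)])
    have "continuous_on {0..a} (\<lambda>x. g (x + b))"
      by (rule continuous_on_compose2[OF continuous_on_g]) (use ab in \<open>auto intro!: continuous_intros\<close>)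
    then show "continuous_on {0..a} h"
      unfolding h_def by (intro continuous_intros continuous_on_subset[OF continuous_on_g]) auto
    fix z assume z: "0 < z" "z < a"
    have "((\<lambda>x. g (x + b)) has_real_derivative (log 2 (z + b + 1) - log 2 (z + b))) (at z)"
      using DERIV_shift[of g _ z b] g_has_derivative[of "z + b"] z ab by simp
    then have "(h has_real_derivative (log 2 (z + 1) - log 2 z) - (log 2 (z + b + 1) - log 2 (z + b))) (at z)"
      unfolding h_def by (intro DERIV_diff g_has_derivative z)
    moreover have "log 2 (z * (z + b + 1)) < log 2 ((z + 1) * (z + b))"
    proof -
      have "z * (z + b + 1) < (z + 1) * (z + b)" using ab by (simp add: algebra_simps)
      moreover have "0 < z * (z + b + 1)" using z ab by (intro mult_pos_pos) auto
      ultimately show ?thesis by simp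
    qed
    then have "0 < (log 2 (z + 1) - log 2 z) - (log 2 (z + b + 1) - log 2 (z + b))"
      using z ab by (simp add: log_mult_pos)
    ultimately show "\<exists>d. (h has_real_derivative d) (at z) \<and> 0 < d" by blast
  qed
  then show ?thesis by (simp add: h_def g_def[of 0])
qed (auto simp: g_def[of 0])

lemma g_pos_imp_pos: "0 < g x \<Longrightarrow> 0 < x"
  by (rule ccontr) (simp add: g_def)

text \<open>Along P + Q = S a larger \<open>P\<close> favours the first rate and leaves less for the
  second. Subadditivity guarantees that beside the least power for \<open>R1\<close> enough of
  \<open>S\<close> is left for \<open>R2\<close>. Scaling by a factor slightly below 1 makes the
  power bounds strict while the strict rate inequalities persist by continuity.\<close>

lemma exists_power_split:
  assumes "0 \<le> R1" "0 \<le> R2" "a \<le> S" "b \<le> S" "S \<le> a + b"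
    and "R1 < g a" "R2 < g b" "R1 + R2 < g S"
  obtains P Q where "0 < P" "P < a" "0 < Q" "Q < b" "P + Q < S"
    "R1 < g P" "R2 < g Q" "R1 + R2 < g (P + Q)"
proof -
  have pos: "0 < a" "0 < b" "0 < S" using assms by (auto intro: g_pos_imp_pos)
  obtain P0 Q0 where 0: "0 < P0" "P0 \<le> a" "0 < Q0" "Q0 \<le> b" "P0 + Q0 = S" "R1 < g P0" "R2 < g Q0"
  proof -
    obtain p where p: "0 \<le> p" "p \<le> a" "g p = R1"
      using IVT'[of g 0 R1 a] assms(1,6) pos continuous_on_subset[OF continuous_on_g, of "{0..a}"]
      by (auto simp: g_def[of 0])
    have "p < a" using p assms(6) by (cases "p = a") auto
    show thesis
    proof (cases "p < S - b")
      \<comment> \<open>The second user takes its full \<open>b\<close> and the first the remaining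
        S - b, which exceeds \<open>p\<close> and is at most \<open>a\<close>.\<close>
      case True
      then show thesis using g_strict_mono[of p "S - b"] p pos assms by (intro that[of "S - b" b]) auto
    next
      case False
      \<comment> \<open>The sum-rate condition enters here: with g p = R1 it leaves R2 < g (S - p).
        By continuity the first power may move slightly above \<open>p\<close>, which makes the
        inequality for \<open>R1\<close> strict.\<close>
      have "g S \<le> g (S - p) + g p" using g_subadditive[of "S - p" p] p \<open>p < a\<close> assms by simp
      then have "R2 < g (S - p)" using assms p by simp
      moreover have "((\<lambda>x. g (S - x)) \<longlongrightarrow> g (S - p)) (at_right p)"
        using isCont_g[of "S - p"] \<open>p < a\<close> assms(3) by (intro isCont_tendsto_compose[of _ g] tendsto_intros) auto
      ultimately have "\<forall>\<^sub>F x in at_right p. R2 < g (S - x)" by (rule order_tendstoD(1)[rotated])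
      then have "\<forall>\<^sub>F x in at_right p. R2 < g (S - x) \<and> x \<in> {p<..<a}"
        using eventually_at_right_real[OF \<open>p < a\<close>] by (rule eventually_conj)
      then obtain x where "R2 < g (S - x)" "p < x" "x < a"
        using eventually_happens[of _ "at_right p"] by auto
      then show thesis using g_strict_mono[of p x] p False assms by (intro that[of x "S - x"]) auto
    qed
  qed
  have lim: "((\<lambda>c. g (c * x)) \<longlongrightarrow> g x) (at_left 1)" if "0 < x" for x
    by (rule isCont_tendsto_compose[OF isCont_g[OF that]]) (auto intro!: tendsto_eq_intros)
  have "\<forall>\<^sub>F c in at_left 1. R1 < g (c * P0) \<and> R2 < g (c * Q0) \<and> R1 + R2 < g (c * S) \<and> c \<in> {0<..<1}"
    using lim[THEN order_tendstoD(1)] 0 pos assms(8)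
    by (intro eventually_conj eventually_at_left_real) auto
  then obtain c where c: "R1 < g (c * P0)" "R2 < g (c * Q0)" "R1 + R2 < g (c * S)" "0 < c" "c < 1"
    using eventually_happens[of _ "at_left (1::real)"] by auto
  have "c * x < x" if "0 < x" for x using c(5) that by simp
  from this[OF 0(1)] this[OF 0(3)] this[OF pos(3)]
  have "c * P0 < a" "c * Q0 < b" "c * P0 + c * Q0 < S"
    using 0(2,4) unfolding distrib_left[symmetric] 0(5) by auto
  then show thesis using c 0(1,3) by (intro that[of "c * P0" "c * Q0"]) (simp_all add: 0(5) flip: distrib_left)
qed

theorem theorem5:
  fixes N1 N2 N3 R1 R2 :: real
  assumes "0 \<le> N1" and "0 \<le> N2" and "0 \<le> N3"
    and "0 \<le> R1" and "0 \<le> R2"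
    and "R1 < g (3/2 * min N1 N3)"
    and "R2 < g (3/2 * min N2 N3)"
    and "R1 + R2 < g (3/2 * min (N1 + N2) N3)"
  shows "(R1, R2) \<in> covert_capacity_region N1 N2 N3"
proof -
  \<comment> \<open>The sum constraint dominates each single one and is at most their sum: the
    geometry under which the power can be split.\<close>
  have "3/2 * min N1 N3 \<le> 3/2 * min (N1 + N2) N3" "3/2 * min N2 N3 \<le> 3/2 * min (N1 + N2) N3"
    "3/2 * min (N1 + N2) N3 \<le> 3/2 * min N1 N3 + 3/2 * min N2 N3"
    using assms(1-3) by (auto simp: min_def)
  from exists_power_split[OF assms(4,5) this assms(6-8)]
  obtain P Q where PQ: "0 < P" "P < 3/2 * min N1 N3" "0 < Q" "Q < 3/2 * min N2 N3" "P + Q < 3/2 * min (N1 + N2) N3"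
    "R1 < g P" "R2 < g Q" "R1 + R2 < g (P + Q)" .
  then have "P < 3/2 * N1" "Q < 3/2 * N2" "P + Q < 3/2 * N3" by (auto simp: min_def split: if_splits)
  with PQ have "achievable N1 N2 N3 (R1, R2)" by (intro achievable_gaussian[of P Q] assms(4,5))
  then show ?thesis unfolding covert_capacity_region_def using closure_subset by blast
qed

end
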